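(* Let $C$ be an indecomposable Cartan matrix of type $X_l$ with root system $\dot R$ and simple roots $\alpha_1,\dots,\alpha_l$, labelled so that $\alpha_1$ is a long and $\alpha_l$ a short root (see context), and let $A$ be the standard $d$-fold affinization matrix of $C$ of type $X_l^{(b,s,t)}$ in which every added single long root corresponds to $\alpha_1$, every added single short root corresponds to $\alpha_l$, and every added double root corresponds to $2\alpha_l$. Let the null roots $\delta_{1j}$ ($1\le j\le b$), $\delta_{lj}$ ($1\le j\le s$), $\delta'_{lj}$ ($1\le j\le t$) be as in the context. Then the Weyl root system $R^W$ of $A$ is as follows. (1) For type $X_l^{(d,0,0)}$ with $X_l=A_l\ (l\ge2),D_l,E_6,E_7,E_8$: $R^W=\dot R+\mathrm{rad}(\Gamma)$. (2) For type $X_l^{(b,s,0)}$ with $X_l=C_l\ (l\ge3),F_4,G_2$: $R^W=R^W_s\cup R^W_l$, where $R^W_s=\dot R_s+\mathrm{rad}(\Gamma)$ and (2.1) for $X_l=C_l$ ($l\ge3$), $R^W_l=\{\alpha+\sum_{j=1}^b a_j\delta_{1j}+2\sum_{j=1}^s b_j\delta_{lj}\mid \alpha\in\dot R_l,\ a_j,b_j\in\mathbb Z,\text{ and at most one of } a_1,\dots,a_b\text{ is odd}\}$; (2.2) for $X_l=F_4$, $R^W_l=\{\alpha+\sum_{j=1}^b a_j\delta_{1j}+2\sum_{j=1}^s b_j\delta_{lj}\mid \alpha\in\dot R_l,\ a_j,b_j\in\mathbb Z\}$ (with $l=4$ in $\delta_{lj}$); (2.3) for $X_l=G_2$, $R^W_l=\{\alpha+\sum_{j=1}^b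 a_j\delta_{1j}+3\sum_{j=1}^s b_j\delta_{lj}\mid \alpha\in\dot R_l,\ a_j,b_j\in\mathbb Z\}$ (with $l=2$ in $\delta_{lj}$). (3) For type $A_1^{(b,0,t)}$: $R^W=R^W_s\cup R^W_l$, where $R^W_s=\{\pm\alpha_1+\sum_{j=1}^b a_j\delta_{1j}+\sum_{j=1}^t b_j\delta'_{1j}\mid a_j,b_j\in\mathbb Z,\text{ and at most one of }a_1,\dots,a_b\text{ is odd}\}$ and $R^W_l=\{\pm2\alpha_1+4\sum_{j=1}^b a_j\delta_{1j}+\sum_{j=1}^t b_j\delta'_{1j}\mid a_j,b_j\in\mathbb Z,\text{ and exactly one of }b_1,\dots,b_t\text{ is odd}\}$. (4) For type $B_l^{(b,s,t)}$ ($l\ge2$): $R^W=R^W_s\cup R^W_m\cup R^W_l$, where $R^W_s=\{\alpha+\sum_{j=1}^b a_j\delta_{1j}+\sum_{j=1}^s b_j\delta_{lj}+\sum_{j=1}^t c_j\delta'_{lj}\mid\alpha\in\dot R_s,\ a_j,b_j,c_j\in\mathbb Z,\text{ and at most one of }b_1,\dots,b_s\text{ is odd}\}$, $R^W_l=\{2\alpha+2\sum_{j=1}^b a_j\delta_{1j}+4\sum_{j=1}^s b_j\delta_{lj}+\sum_{j=1}^t c_j\delta'_{lj}\mid\alpha\in\dot R_s,\ a_j,b_j,c_j\in\mathbb Z,\text{ and exactly one of }c_1,\dots,c_t\text{ is odd}\}$, and (4.1) for $l=2$, $R^W_m=\{\alpha+\sum_{j=1}^b a_j\delta_{1j}+2\sum_{j=1}^s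 b_j\delta_{lj}+\sum_{j=1}^t c_j\delta'_{lj}\mid\alpha\in\dot R_l,\ a_j,b_j,c_j\in\mathbb Z,\text{ and at most one of }a_1,\dots,a_b\text{ is odd}\}$; (4.2) for $l>2$, $R^W_m=\{\alpha+\sum_{j=1}^b a_j\delta_{1j}+2\sum_{j=1}^s b_j\delta_{lj}+\sum_{j=1}^t c_j\delta'_{lj}\mid\alpha\in\dot R_l,\ a_j,b_j,c_j\in\mathbb Z\}$.
   Context: Setting. $C$ is an indecomposable $l\times l$ Cartan matrix (positive definite) with root system $\dot R$, simple roots $\dot\Delta=\{\alpha_1,\dots,\alpha_l\}$ and induced form $(-,-)_C$, $C_{ij}=2(\alpha_i,\alpha_j)_C/(\alpha_i,\alpha_i)_C$. $\dot R_s,\dot R_l$ are the sets of short and long roots of $\dot R$. A standard $d$-fold affinization is the $(l+d)\times(l+d)$ matrix $\frac{2(\alpha_i,\alpha_j)_C}{(\alpha_i,\alpha_i)_C}$, $1\le i,j\le l+d$, with $\alpha_{l+1},\dots,\alpha_{l+d}\in\dot\Delta\cup2\dot\Delta$ chosen so that all entries are integers. Its type is $X_l^{(b,s,t)}$, $b+s+t=d$, where $b$, $s$ are the numbers of added long, resp. short, roots from $\dot\Delta$, and $t$ is the number of added doubles from $2\dot\Delta$ (if $C$ is symmetric all roots of $\dot R$ count as long). Labelling of simple roots. $A_l$: chain $\alpha_1-\cdots-\alpha_l$. $B_l$: chain $\alpha_1-\cdots-\alpha_l$ with $\alpha_l$ the unique short simple root ($l\ge2$). $C_l$: chain $\alpha_1-\cdots-\alpha_l$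 with $\alpha_1$ the unique long simple root. $D_l$ ($l\ge 4$): chain $\alpha_1-\cdots-\alpha_{l-1}$, with $\alpha_l$ joined to $\alpha_{l-2}$. $E_6$: chain $\alpha_1-\cdots-\alpha_5$, $\alpha_6$ joined to $\alpha_3$. $E_7$: chain $\alpha_1-\cdots-\alpha_6$, $\alpha_7$ joined to $\alpha_3$. $E_8$: chain $\alpha_1-\cdots-\alpha_7$, $\alpha_8$ joined to $\alpha_5$. $F_4$: chain $\alpha_1-\alpha_2-\alpha_3-\alpha_4$ with $\alpha_1,\alpha_2$ long, $\alpha_3,\alpha_4$ short. $G_2$: $\alpha_1$ long, $\alpha_2$ short. Root basis and null roots. Let $H$ be the $\mathbb Q$-vector space with basis $\Delta=\{\alpha_1,\dots,\alpha_l\}\cup\{\alpha_{1j}\}_{j=1}^b\cup\{\alpha_{lj}\}_{j=1}^s\cup\{\beta_{lj}\}_{j=1}^t$, where $\alpha_{1j}$ are the added roots corresponding to $\alpha_1$, $\alpha_{lj}$ those corresponding to $\alpha_l$ as added short roots, and $\beta_{lj}$ those corresponding to $2\alpha_l$. The symmetric bilinear form $(-,-)$ on $H$ is the pullback of $(-,-)_C$ under the linear map $\alpha_i\mapsto\alpha_i$, $\alpha_{1j}\mapsto\alpha_1$, $\alpha_{lj}\mapsto\alpha_l$, $\beta_{lj}\mapsto2\alpha_l$. Put $\delta_{1j}=\alpha_{1j}-\alpha_1$, $\delta_{lj}=\alpha_{lj}-\alpha_l$, $\delta'_{lj}=\beta_{lj}-2\alpha_l$. (For $A_1$, $s=0$,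 $\alpha_l=\alpha_1$, and $\delta'_{1j}=\beta_{1j}-2\alpha_1$.) $\dot R$ is regarded as a subset of $\mathrm{span}(\alpha_1,\dots,\alpha_l)\subset H$. $\Gamma$ is the $\mathbb Z$-span of $\Delta$ and $\mathrm{rad}(\Gamma)=\{\gamma\in\Gamma\mid(\gamma,H)=0\}$, whose elements are called null roots. Weyl root system. For $\alpha\in H$ with $(\alpha,\alpha)\neq0$, $s_\alpha(\beta)=\beta-\frac{2(\alpha,\beta)}{(\alpha,\alpha)}\alpha$. $\mathcal W\subseteq GL(H)$ is the group generated by $s_\alpha$, $\alpha\in\Delta$, and $R^W=\{s(\alpha)\mid s\in\mathcal W,\alpha\in\Delta\}$. $R^W_s,R^W_m,R^W_l$ denote the subsets of short, middle and long elements of $R^W$ by squared length: in (2), $R^W_s$, $R^W_l$ consist of the elements with the squared length of short, resp. long, roots of $\dot R$; in (3), of those with the squared length of $\alpha_1$, resp. of $2\alpha_1$; in (4), $R_s^W,R_m^W,R_l^W$ consist of those with the squared length of $\alpha_l$, of $\alpha_1$, resp. of $2\alpha_l$. *)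

theory Defs
  imports
    Complex_Main
    "HOL-Algebra.Bij"
    "HOL-Algebra.Generated_Groups"
    "HOL-Library.Function_Algebras"
    "HOL-Library.Set_Algebras"
begin

section \<open>Rational coordinate spaces\<close>

text \<open>
  The rational vector space with basis \<open>e\<^sub>1, \<dots>, e\<^sub>n\<close> is the set of coordinate functions supported in
  \<open>{1..n}\<close>.  Thus \<open>coord_space l\<close> is literally the subspace of \<open>coord_space (l + d)\<close> spanned by
  the first \<open>l\<close> basis vectors.  Addition of functions is pointwise (\<open>HOL-Library.Function_Algebras\<close>).
\<close>

type_synonym vec = "nat \<Rightarrow> rat"

definition scale :: "rat \<Rightarrow> vec \<Rightarrow> vec"  (infixr \<open>*\<^sub>q\<close> 75)
  where "c *\<^sub>q x = (\<lambda>i. c * x i)"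

definition basis_vec :: "nat \<Rightarrow> vec"
  where "basis_vec k = (\<lambda>i. if i = k then 1 else 0)"

definition coord_space :: "nat \<Rightarrow> vec set"
  where "coord_space n = {x. \<forall>i. i \<notin> {1..n} \<longrightarrow> x i = 0}"

definition int_span :: "nat \<Rightarrow> vec set"
  where "int_span n = {\<Sum>k=1..n. rat_of_int (c k) *\<^sub>q basis_vec k | c. True}"

text \<open>
  As in \<open>HOL-Algebra.Bij\<close>, elements of \<open>GL V\<close> are functions that are \<^const>\<open>undefined\<close> outside \<open>V\<close>.
\<close>

definition GL :: "vec set \<Rightarrow> (vec \<Rightarrow> vec) monoid"
  where "GL V = (BijGroup V)
    \<lparr>carrier := {f \<in> Bij V. (\<forall>x\<in>V. \<forall>y\<in>V. f (x + y) = f x + f y) \<and>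
                             (\<forall>c. \<forall>x\<in>V. f (c *\<^sub>q x) = c *\<^sub>q f x)}\<rparr>"

section \<open>Roots generated by reflections\<close>

definition reflection :: "(vec \<Rightarrow> vec \<Rightarrow> rat) \<Rightarrow> vec \<Rightarrow> vec \<Rightarrow> vec"
  where "reflection F \<alpha> \<beta> = \<beta> - (2 * F \<alpha> \<beta> / F \<alpha> \<alpha>) *\<^sub>q \<alpha>"

definition weyl_group :: "(vec \<Rightarrow> vec \<Rightarrow> rat) \<Rightarrow> nat \<Rightarrow> (vec \<Rightarrow> vec) set"
  where "weyl_group F n = generate (GL (coord_space n))
    {restrict (reflection F (basis_vec k)) (coord_space n) | k. k \<in> {1..n}}"

definition weyl_roots :: "(vec \<Rightarrow> vec \<Rightarrow> rat) \<Rightarrow> nat \<Rightarrow> vec set"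
  where "weyl_roots F n = {w (basis_vec k) | w k. w \<in> weyl_group F n \<and> k \<in> {1..n}}"

definition radical :: "(vec \<Rightarrow> vec \<Rightarrow> rat) \<Rightarrow> nat \<Rightarrow> vec set"
  where "radical F n = {\<gamma> \<in> int_span n. \<forall>x \<in> coord_space n. F \<gamma> x = 0}"

text \<open>
  Roots of maximal squared length are long, all others short; so if all roots have the same length,
  they are all long.
\<close>

definition long_roots :: "(vec \<Rightarrow> vec \<Rightarrow> rat) \<Rightarrow> vec set \<Rightarrow> vec set"
  where "long_roots F R = {\<alpha> \<in> R. \<forall>\<beta> \<in> R. F \<beta> \<beta> \<le> F \<alpha> \<alpha>}"

definition short_roots :: "(vec \<Rightarrow> vec \<Rightarrow> rat) \<Rightarrow> vec set \<Rightarrow> vec set"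
  where "short_roots F R = R - long_roots F R"

definition same_length :: "(vec \<Rightarrow> vec \<Rightarrow> rat) \<Rightarrow> vec set \<Rightarrow> vec set \<Rightarrow> vec set"
  where "same_length F R S = {\<alpha> \<in> R. \<exists>\<beta> \<in> S. F \<alpha> \<alpha> = F \<beta> \<beta>}"

section \<open>Cartan matrices\<close>

datatype cartan_letter = TypeA | TypeB | TypeC | TypeD | TypeE | TypeF | TypeG

text \<open>Every type is listed exactly once: \<open>A\<^sub>l\<close> (\<open>l \<ge> 1\<close>), \<open>B\<^sub>l\<close> (\<open>l \<ge> 2\<close>), \<open>C\<^sub>l\<close> (\<open>l \<ge> 3\<close>), \<open>D\<^sub>l\<close> (\<open>l \<ge> 4\<close>), etc.\<close>

fun valid_rank :: "cartan_letter \<Rightarrow> nat \<Rightarrow> bool" where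
  "valid_rank TypeA l \<longleftrightarrow> l \<ge> 1"
| "valid_rank TypeB l \<longleftrightarrow> l \<ge> 2"
| "valid_rank TypeC l \<longleftrightarrow> l \<ge> 3"
| "valid_rank TypeD l \<longleftrightarrow> l \<ge> 4"
| "valid_rank TypeE l \<longleftrightarrow> l \<in> {6, 7, 8}"
| "valid_rank TypeF l \<longleftrightarrow> l = 4"
| "valid_rank TypeG l \<longleftrightarrow> l = 2"

text \<open>Adjacency of the nodes \<open>i < j\<close> of the Dynkin diagram.\<close>

fun dynkin_edge :: "cartan_letter \<Rightarrow> nat \<Rightarrow> nat \<Rightarrow> nat \<Rightarrow> bool" where
  "dynkin_edge TypeD l i j \<longleftrightarrow> j < l \<and> j = i + 1 \<or> j = l \<and> i = l - 2"
| "dynkin_edge TypeE l i j \<longleftrightarrow> j < l \<and> j = i + 1 \<or> j = l \<and> i = (if l = 8 then 5 else 3)"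
| "dynkin_edge X l i j \<longleftrightarrow> j = i + 1"

text \<open>
  The off-diagonal entries different from \<open>0\<close> and \<open>-1\<close>.  With the convention
  \<open>C\<^sub>i\<^sub>j = 2(\<alpha>\<^sub>i,\<alpha>\<^sub>j)/(\<alpha>\<^sub>i,\<alpha>\<^sub>i)\<close> they occur in the row of the shorter root.
\<close>

fun multiple_bond :: "cartan_letter \<Rightarrow> nat \<Rightarrow> nat \<Rightarrow> nat \<Rightarrow> int" where
  "multiple_bond TypeB l i j = (if i = l \<and> j = l - 1 then 2 else 1)"
| "multiple_bond TypeC l i j = (if i = 2 \<and> j = 1 then 2 else 1)"
| "multiple_bond TypeF l i j = (if i = 3 \<and> j = 2 then 2 else 1)"
| "multiple_bond TypeG l i j = (if i = 2 \<and> j = 1 then 3 else 1)"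
| "multiple_bond X l i j = 1"

definition cartan_matrix :: "cartan_letter \<Rightarrow> nat \<Rightarrow> nat \<Rightarrow> nat \<Rightarrow> int"
  where "cartan_matrix X l i j =
    (if i = j then 2
     else if dynkin_edge X l (min i j) (max i j) then - multiple_bond X l i j
     else 0)"

definition is_cartan_matrix :: "cartan_letter \<Rightarrow> nat \<Rightarrow> (nat \<Rightarrow> nat \<Rightarrow> int) \<Rightarrow> bool"
  where "is_cartan_matrix X l C \<longleftrightarrow> valid_rank X l \<and>
    (\<forall>i\<in>{1..l}. \<forall>j\<in>{1..l}. C i j = cartan_matrix X l i j)"

text \<open>
  \<open>G i j\<close> is \<open>(\<alpha>\<^sub>i,\<alpha>\<^sub>j)\<^sub>C\<close>.  These conditions determine the form up to a positive scalar; no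
  normalization is imposed.
\<close>

definition induced_gram :: "nat \<Rightarrow> (nat \<Rightarrow> nat \<Rightarrow> int) \<Rightarrow> (nat \<Rightarrow> nat \<Rightarrow> rat) \<Rightarrow> bool"
  where "induced_gram l C G \<longleftrightarrow>
    (\<forall>i\<in>{1..l}. G i i > 0) \<and>
    (\<forall>i\<in>{1..l}. \<forall>j\<in>{1..l}. G i j = G j i \<and> rat_of_int (C i j) = 2 * G i j / G i i)"

definition gram_form :: "nat \<Rightarrow> (nat \<Rightarrow> nat \<Rightarrow> rat) \<Rightarrow> vec \<Rightarrow> vec \<Rightarrow> rat"
  where "gram_form l G x y = (\<Sum>i=1..l. \<Sum>j=1..l. x i * y j * G i j)"

section \<open>Standard affinizations\<close>

text \<open>
  \<open>r 1, \<dots>, r (l + d)\<close> are the roots \<open>\<alpha>\<^sub>1, \<dots>, \<alpha>\<^sub>l\<^sub>+\<^sub>d\<close> in the span of the simple roots, and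
  \<open>A\<close> is the affinization matrix, which is required to be integral.
\<close>

definition simple_roots :: "nat \<Rightarrow> vec set"
  where "simple_roots l = basis_vec ` {1..l}"

definition standard_affinization ::
    "nat \<Rightarrow> nat \<Rightarrow> (nat \<Rightarrow> nat \<Rightarrow> rat) \<Rightarrow> (nat \<Rightarrow> vec) \<Rightarrow> (nat \<Rightarrow> nat \<Rightarrow> int) \<Rightarrow> bool"
  where "standard_affinization l d G r A \<longleftrightarrow>
    (\<forall>k\<in>{1..l}. r k = basis_vec k) \<and>
    (\<forall>k\<in>{l+1..l+d}. r k \<in> simple_roots l \<union> (*\<^sub>q) 2 ` simple_roots l) \<and>
    (\<forall>i\<in>{1..l+d}. \<forall>j\<in>{1..l+d}.
       rat_of_int (A i j) = 2 * gram_form l G (r i) (r j) / gram_form l G (r i) (r i))"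

definition added_long :: "nat \<Rightarrow> nat \<Rightarrow> (nat \<Rightarrow> nat \<Rightarrow> rat) \<Rightarrow> (nat \<Rightarrow> vec) \<Rightarrow> nat set"
  where "added_long l d G r = {k \<in> {l+1..l+d}.
    r k \<in> simple_roots l \<inter> long_roots (gram_form l G) (weyl_roots (gram_form l G) l)}"

definition added_short :: "nat \<Rightarrow> nat \<Rightarrow> (nat \<Rightarrow> nat \<Rightarrow> rat) \<Rightarrow> (nat \<Rightarrow> vec) \<Rightarrow> nat set"
  where "added_short l d G r = {k \<in> {l+1..l+d}.
    r k \<in> simple_roots l \<inter> short_roots (gram_form l G) (weyl_roots (gram_form l G) l)}"

definition added_double :: "nat \<Rightarrow> nat \<Rightarrow> (nat \<Rightarrow> vec) \<Rightarrow> nat set"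
  where "added_double l d r = {k \<in> {l+1..l+d}. r k \<in> (*\<^sub>q) 2 ` simple_roots l}"

definition affinization_type ::
    "nat \<Rightarrow> nat \<Rightarrow> (nat \<Rightarrow> nat \<Rightarrow> rat) \<Rightarrow> (nat \<Rightarrow> vec) \<Rightarrow> nat \<times> nat \<times> nat"
  where "affinization_type l d G r =
    (card (added_long l d G r), card (added_short l d G r), card (added_double l d r))"

text \<open>
  \<open>basis_vec k\<close> for \<open>k > l\<close> is the root basis element of the \<open>k\<close>-th row of \<open>A\<close>, distinct from
  the root \<open>r k\<close> it is mapped to.
\<close>

definition root_map :: "nat \<Rightarrow> (nat \<Rightarrow> vec) \<Rightarrow> vec \<Rightarrow> vec"
  where "root_map n r x = (\<Sum>k=1..n. x k *\<^sub>q r k)"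

definition affine_form ::
    "nat \<Rightarrow> nat \<Rightarrow> (nat \<Rightarrow> nat \<Rightarrow> rat) \<Rightarrow> (nat \<Rightarrow> vec) \<Rightarrow> vec \<Rightarrow> vec \<Rightarrow> rat"
  where "affine_form l d G r x y =
    gram_form l G (root_map (l + d) r x) (root_map (l + d) r y)"

section \<open>Parity conditions\<close>

definition at_most_one_odd :: "nat \<Rightarrow> (nat \<Rightarrow> int) \<Rightarrow> bool"
  where "at_most_one_odd n a \<longleftrightarrow> card {j \<in> {1..n}. odd (a j)} \<le> 1"

definition exactly_one_odd :: "nat \<Rightarrow> (nat \<Rightarrow> int) \<Rightarrow> bool"
  where "exactly_one_odd n a \<longleftrightarrow> card {j \<in> {1..n}. odd (a j)} = 1"

text \<open>The integral combination of \<open>\<delta>\<^sub>1, \<dots>, \<delta>\<^sub>n\<close> with coefficients \<open>a\<^sub>1, \<dots>, a\<^sub>n\<close>.\<close>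

definition int_comb :: "nat \<Rightarrow> (nat \<Rightarrow> int) \<Rightarrow> (nat \<Rightarrow> vec) \<Rightarrow> vec"
  where "int_comb n a \<delta> = (\<Sum>j=1..n. rat_of_int (a j) *\<^sub>q \<delta> j)"

end

theory Submission
  imports Defs
begin

text \<open>
  Write \<open>\<delta>\<^sub>k = e\<^sub>k - r\<^sub>k\<close> for the null root of an added index \<open>k\<close>, where \<open>e\<^sub>k\<close> is the basis vector and
  \<open>r\<^sub>k\<close> the finite vector to which it is mapped.  Every element of \<open>R\<^sup>W\<close> is \<open>x + \<Sum>\<^sub>k c\<^sub>k \<delta>\<^sub>k\<close> with integers
  \<open>c\<^sub>k\<close> and with \<open>x\<close> in the orbit, under the finite Weyl group, of some \<open>e \<in> {\<alpha>\<^sub>1, \<alpha>\<^sub>l, 2\<alpha>\<^sub>l}\<close>; the question is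
  which coefficients \<open>c\<close> occur.  As the finite Weyl group fixes all \<open>\<delta>\<^sub>k\<close>, the answer depends only on
  the orbit of \<open>e\<close>.

  Two effects determine it.  Reflecting \<open>x + \<dots>\<close> in \<open>r\<^sub>k + \<delta>\<^sub>k\<close> changes \<open>c\<^sub>k\<close> by \<open>-\<langle>x, r\<^sub>k\<^sup>\<or>\<rangle>\<close> and no other
  coefficient.  So if \<open>N\<^sub>k\<close> divides \<open>\<langle>x, r\<^sub>k\<^sup>\<or>\<rangle>\<close> for all \<open>x\<close> in the orbit, then \<open>c\<^sub>k\<close> never leaves its class
  modulo \<open>N\<^sub>k\<close>.  Conversely, if \<open>\<beta>\<close> is conjugate to \<open>r\<^sub>k\<close>, the product of the reflections in \<open>\<beta> + \<delta>\<^sub>k\<close> and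
  \<open>\<beta>\<close> is the translation by \<open>\<langle>x, \<beta>\<^sup>\<or>\<rangle> \<delta>\<^sub>k\<close>.  So if some \<open>x\<close> in the orbit and some such \<open>\<beta>\<close> attain
  \<open>\<langle>x, \<beta>\<^sup>\<or>\<rangle> = \<plusminus>N\<^sub>k\<close>, then every value in the class modulo \<open>N\<^sub>k\<close> is attained, independently for the
  different \<open>k\<close>.  The classes that occur are those of the generators: \<open>c = 0\<close> if \<open>e\<close> is a
  simple root, and the unit vector at \<open>k\<close> for every added \<open>r\<^sub>k = e\<close>.  This is
  \<open>weyl_roots_layers\<close>.  For \<open>N\<^sub>k = 2\<close> on the indices with \<open>r\<^sub>k = e\<close> the admissible classes say "at most
  one odd coefficient" when \<open>0\<close> is among the generators and "exactly one odd coefficient" otherwise.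

  For the individual types it remains to find the steps \<open>N\<^sub>k\<close>.  Divisibility is read off the
  Cartan matrix by means of a sublattice \<open>\<Oplus> D\<^sub>j \<int>\<alpha>\<^sub>j\<close> that contains \<open>e\<close> and is stable under the finite Weyl
  group (\<open>graded_orbit\<close>, \<open>layers_graded\<close>); the pairing \<open>\<plusminus>N\<^sub>k\<close> is attained by a pair of simple
  roots, except that in type \<open>G\<^sub>2\<close> two roots of the same length require a reflected simple root.
  With the three columns for the added copies of \<open>\<alpha>\<^sub>1\<close>, \<open>\<alpha>\<^sub>l\<close> and \<open>2\<alpha>\<^sub>l\<close>, the steps are as follows.

  \<^item> \<open>A\<^sub>l\<close> (\<open>l \<ge> 2\<close>), \<open>D\<^sub>l\<close>, \<open>E\<^sub>l\<close>: 1.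
  \<^item> \<open>C\<^sub>l\<close>: long 2, 2; short 1, 1.  \<open>F\<^sub>4\<close>: long 1, 2; short 1, 1.  \<open>G\<^sub>2\<close>: long 1, 3; short 1, 1.
  \<^item> \<open>A\<^sub>1\<close> (columns \<open>\<alpha>\<^sub>1\<close> and \<open>2\<alpha>\<^sub>1\<close> only): \<open>\<alpha>\<^sub>1\<close> has 2, 1; \<open>2\<alpha>\<^sub>1\<close> has 4, 2.
  \<^item> \<open>B\<^sub>l\<close>: \<open>\<alpha>\<^sub>l\<close> has 1, 2, 1; \<open>\<alpha>\<^sub>1\<close> has 1, 2, 1 (for \<open>l = 2\<close>: 2, 2, 1); \<open>2\<alpha>\<^sub>l\<close> has 2, 4, 2.

  Finally, the pieces belonging to different \<open>e\<close> are told apart by their squared length, and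
  \<open>rad(\<Gamma>)\<close> is the integral span of the \<open>\<delta>\<^sub>k\<close> because the finite form is nondegenerate.
\<close>

section \<open>Reflections and orbits\<close>

interpretation vec: vector_space "(*\<^sub>q)"
  by unfold_locales (auto simp: scale_def fun_eq_iff algebra_simps)

text \<open>
The pointwise evaluation rules are deliberately kept out of the simpset: vectors occur mostly as
  arguments of forms and as members of sets, where they should stay opaque.
\<close>

lemma scale_apply: "(c *\<^sub>q x) i = c * x i"
  by (simp add: scale_def)

lemma sum_vec_apply: "(\<Sum>k\<in>S. f k) i = (\<Sum>k\<in>S. (f k :: vec) i)"
  by (induction S rule: infinite_finite_induct) auto

lemma basis_vec_apply: "basis_vec k i = (if i = k then 1 else 0)"
  by (simp add: basis_vec_def)

locale symmetric_form =
  fixes F :: "vec \<Rightarrow> vec \<Rightarrow> rat"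
  assumes add_left: "F (x + y) z = F x z + F y z"
    and scale_left: "F (c *\<^sub>q x) z = c * F x z"
    and commute: "F x y = F y x"
begin

lemma add_right: "F z (x + y) = F z x + F z y"
  by (metis add_left commute)

lemma scale_right: "F z (c *\<^sub>q x) = c * F z x"
  by (metis scale_left commute)

lemma diff_left: "F (x - y) z = F x z - F y z"
  using add_left[of "x - y" y z] by simp

lemma diff_right: "F z (x - y) = F z x - F z y"
  by (metis diff_left commute)

lemmas bilinear = add_left add_right diff_left diff_right scale_left scale_right

lemma reflection_add: "reflection F a (x + y) = reflection F a x + reflection F a y"
  by (simp add: reflection_def bilinear fun_eq_iff scale_apply add_divide_distrib algebra_simps)

lemma reflection_scale: "reflection F a (c *\<^sub>q x) = c *\<^sub>q reflection F a x"
  by (simp add: reflection_def bilinear fun_eq_iff scale_apply algebra_simps)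

lemma reflection_diff: "reflection F a (x - y) = reflection F a x - reflection F a y"
  using reflection_add[of a "x - y" y] by simp

lemma reflection_scaled_root: "c \<noteq> 0 \<Longrightarrow> reflection F (c *\<^sub>q a) x = reflection F a x"
  by (simp add: reflection_def bilinear fun_eq_iff scale_apply field_simps)

lemma reflection_self: "F a a \<noteq> 0 \<Longrightarrow> reflection F a a = - a"
  by (simp add: reflection_def fun_eq_iff scale_apply)

lemma reflection_involution:
  assumes "F a a \<noteq> 0"
  shows "reflection F a (reflection F a x) = x"
  using assms by (simp add: reflection_def bilinear fun_eq_iff scale_apply field_simps)

lemma reflection_isometry:
  assumes "F a a \<noteq> 0"
  shows "F (reflection F a x) (reflection F a y) = F x y"
  using assms by (simp add: reflection_def bilinear commute[of x a] field_simps)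

text \<open>
For an isometry \<open>w\<close> one has \<open>s\<^sub>w\<^sub>b = w s\<^sub>b w\<^sup>-\<^sup>1\<close>; here \<open>w\<close> is the reflection in \<open>a\<close>, its own inverse.
\<close>

lemma reflection_conjugate:
  assumes "F a a \<noteq> 0"
  shows "reflection F (reflection F a b) x = reflection F a (reflection F b (reflection F a x))"
proof -
  have "F (reflection F a b) x = F b (reflection F a x)"
    by (metis assms reflection_involution reflection_isometry)
  then have "reflection F (reflection F a b) x
      = reflection F a (reflection F a x) - (2 * F b (reflection F a x) / F b b) *\<^sub>q reflection F a b"
    by (simp add: reflection_def[of F "reflection F a b"] reflection_isometry[OF assms]
        reflection_involution[OF assms])
  also have "\<dots> = reflection F a (reflection F b (reflection F a x))"
    by (simp only: reflection_def[of F b] reflection_diff reflection_scale)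
  finally show ?thesis .
qed

end

text \<open>
The Weyl group is generated by involutions, so its orbits are obtained by applying simple
  reflections repeatedly.  Working with orbits instead of group elements turns every statement
  about \<open>w x\<close> into a rule induction.
\<close>

inductive_set orbit :: "(vec \<Rightarrow> vec \<Rightarrow> rat) \<Rightarrow> nat \<Rightarrow> vec \<Rightarrow> vec set"
  for F n e where
  orbit_start: "e \<in> orbit F n e"
| orbit_step: "x \<in> orbit F n e \<Longrightarrow> k \<in> {1..n} \<Longrightarrow> reflection F (basis_vec k) x \<in> orbit F n e"

lemma orbit_trans: "y \<in> orbit F n x \<Longrightarrow> x \<in> orbit F n e \<Longrightarrow> y \<in> orbit F n e"
  by (induction rule: orbit.induct) (auto intro: orbit_step)

lemma coord_space_closed:
  "x \<in> coord_space n \<Longrightarrow> y \<in> coord_space n \<Longrightarrow> x + y \<in> coord_space n"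
  "x \<in> coord_space n \<Longrightarrow> y \<in> coord_space n \<Longrightarrow> x - y \<in> coord_space n"
  "x \<in> coord_space n \<Longrightarrow> c *\<^sub>q x \<in> coord_space n"
  "k \<in> {1..n} \<Longrightarrow> basis_vec k \<in> coord_space n"
  by (auto simp: coord_space_def scale_apply basis_vec_apply)

lemma orbit_coord_space:
  assumes "x \<in> orbit F n e" "e \<in> coord_space n"
  shows "x \<in> coord_space n"
  using assms by (induction rule: orbit.induct) (auto simp: reflection_def coord_space_closed)

locale root_form = symmetric_form +
  fixes n :: nat
  assumes anisotropic: "k \<in> {1..n} \<Longrightarrow> F (basis_vec k) (basis_vec k) \<noteq> 0"
begin

lemma orbit_sym: "x \<in> orbit F n e \<Longrightarrow> e \<in> orbit F n x"
proof (induction rule: orbit.induct)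
  case (orbit_step x k)
  have "x \<in> orbit F n (reflection F (basis_vec k) x)"
    using orbit.orbit_step[OF orbit_start orbit_step(2), of F "reflection F (basis_vec k) x"]
    by (simp add: reflection_involution[OF anisotropic[OF orbit_step(2)]])
  then show ?case using orbit_step(3) orbit_trans by blast
qed (rule orbit_start)

lemma orbit_eq: "x \<in> orbit F n e \<Longrightarrow> orbit F n x = orbit F n e"
  using orbit_sym orbit_trans by blast

lemma orbit_norm: "x \<in> orbit F n e \<Longrightarrow> F x x = F e e"
  by (induction rule: orbit.induct) (auto simp: reflection_isometry anisotropic)

text \<open>
Reflections are linear; this is what relates the orbit of \<open>2\<alpha>\<^sub>l\<close> to that of \<open>\<alpha>\<^sub>l\<close>.
\<close>

lemma orbit_scale: "x \<in> orbit F n e \<Longrightarrow> c *\<^sub>q x \<in> orbit F n (c *\<^sub>q e)"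
  by (induction rule: orbit.induct) (auto simp flip: reflection_scale intro: orbit.intros)

definition simple_reflection :: "nat \<Rightarrow> vec \<Rightarrow> vec"
  where "simple_reflection k = restrict (reflection F (basis_vec k)) (coord_space n)"

lemma simple_reflection_closed:
  assumes "k \<in> {1..n}" "x \<in> coord_space n"
  shows "reflection F (basis_vec k) x \<in> coord_space n"
  using assms by (auto simp: reflection_def coord_space_closed)

lemma simple_reflection_in_GL:
  assumes k: "k \<in> {1..n}"
  shows "simple_reflection k \<in> carrier (GL (coord_space n))"
proof -
  have "bij_betw (simple_reflection k) (coord_space n) (coord_space n)"
    by (rule bij_betw_byWitness[where f' = "simple_reflection k"])
      (use k in \<open>auto simp: simple_reflection_def simple_reflection_closed
        reflection_involution anisotropic\<close>)
  then show ?thesis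
    by (auto simp: GL_def Bij_def simple_reflection_def coord_space_closed reflection_add
        reflection_scale)
qed

text \<open>
A generated subgroup also contains the inverses of its generators; since these are the
  generators themselves, they add nothing to the orbits.
\<close>

lemma simple_reflection_inv:
  assumes k: "k \<in> {1..n}"
  shows "inv\<^bsub>GL (coord_space n)\<^esub> simple_reflection k = simple_reflection k"
proof -
  let ?V = "coord_space n" and ?s = "simple_reflection k"
  have s: "?s \<in> carrier (GL ?V)" by (rule simple_reflection_in_GL[OF k])
  have one: "\<one>\<^bsub>GL ?V\<^esub> = (\<lambda>x\<in>?V. x)" by (simp add: GL_def BijGroup_def)
  have mult: "f \<otimes>\<^bsub>GL ?V\<^esub> g = compose ?V f g" if "f \<in> carrier (GL ?V)" "g \<in> carrier (GL ?V)" for f g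
    using that by (simp add: GL_def BijGroup_def)
  have ss: "compose ?V ?s ?s = (\<lambda>x\<in>?V. x)"
    using k by (auto simp: compose_def simple_reflection_def fun_eq_iff simple_reflection_closed
        reflection_involution anisotropic)
  show ?thesis unfolding m_inv_def
  proof (rule the_equality)
    fix y assume y: "y \<in> carrier (GL ?V) \<and> ?s \<otimes>\<^bsub>GL ?V\<^esub> y = \<one>\<^bsub>GL ?V\<^esub> \<and> y \<otimes>\<^bsub>GL ?V\<^esub> ?s = \<one>\<^bsub>GL ?V\<^esub>"
    then have sy: "compose ?V ?s y = (\<lambda>x\<in>?V. x)" and yB: "y \<in> Bij ?V"
      using s one mult by (auto simp: GL_def)
    have "y x = ?s x" for x
    proof (cases "x \<in> ?V")
      case True
      then have yx: "y x \<in> ?V" using yB by (auto simp: Bij_def bij_betw_def)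
      have "?s (y x) = x" using fun_cong[OF sy, of x] True by (simp add: compose_def)
      moreover have "?s (?s (y x)) = y x" using fun_cong[OF ss, of "y x"] yx by (simp add: compose_def)
      ultimately show ?thesis by simp
    next
      case False
      then show ?thesis using yB by (simp add: Bij_def extensional_def simple_reflection_def)
    qed
    then show "y = ?s" by blast
  qed (use s one mult ss in auto)
qed

lemma weyl_group_closed:
  assumes "w \<in> weyl_group F n"
  shows "w \<in> carrier (GL (coord_space n)) \<and> (\<forall>x\<in>coord_space n. w x \<in> orbit F n x)"
proof -
  let ?V = "coord_space n"
  have gen: "simple_reflection k \<in> carrier (GL ?V) \<and> (\<forall>x\<in>?V. simple_reflection k x \<in> orbit F n x)"
    if "k \<in> {1..n}" for k
    using simple_reflection_in_GL[OF that] orbit_step[OF orbit_start that]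
    by (auto simp: simple_reflection_def)
  have "w \<in> generate (GL ?V) {simple_reflection k | k. k \<in> {1..n}}"
    using assms by (simp add: weyl_group_def simple_reflection_def)
  then show ?thesis
  proof (induction rule: generate.induct)
    case one
    define i where "i = (\<lambda>x\<in>?V. x)"
    have "i \<in> Bij ?V" "\<And>x. x \<in> ?V \<Longrightarrow> i x = x" "\<one>\<^bsub>GL ?V\<^esub> = i"
      by (auto simp: i_def Bij_def bij_betw_def inj_on_def GL_def BijGroup_def)
    then show ?case
      by (auto simp: GL_def coord_space_closed intro: orbit_start)
  next
    case (incl h) then show ?case using gen by auto
  next
    case (inv h) then show ?case using gen by (auto simp: simple_reflection_inv)
  next
    case (eng h1 h2)
    then have B: "h1 \<in> Bij ?V" "h2 \<in> Bij ?V" by (auto simp: GL_def)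
    then have in_V: "h1 x \<in> ?V" "h2 x \<in> ?V" if "x \<in> ?V" for x
      using that by (auto simp: Bij_def bij_betw_def)
    have m: "h1 \<otimes>\<^bsub>GL ?V\<^esub> h2 = compose ?V h1 h2"
      using B by (simp add: GL_def BijGroup_def)
    define h where "h = compose ?V h1 h2"
    have "h \<in> Bij ?V" unfolding h_def using B by (rule compose_Bij)
    moreover have "\<And>x. x \<in> ?V \<Longrightarrow> h x = h1 (h2 x)" by (simp add: h_def compose_def)
    moreover have "h1 (h2 x) \<in> orbit F n x" if "x \<in> ?V" for x
      using eng.IH in_V(2)[OF that] that orbit_trans by blast
    ultimately have "h \<in> carrier (GL ?V)" "\<forall>x\<in>?V. h x \<in> orbit F n x"
      using eng.IH in_V by (auto simp: GL_def coord_space_closed)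
    then show ?case by (simp add: m h_def)
  qed
qed

lemma weyl_roots_eq_orbits: "weyl_roots F n = (\<Union>k\<in>{1..n}. orbit F n (basis_vec k))"
proof (intro equalityI subsetI)
  fix x assume "x \<in> weyl_roots F n"
  then show "x \<in> (\<Union>k\<in>{1..n}. orbit F n (basis_vec k))"
    using weyl_group_closed by (fastforce simp: weyl_roots_def coord_space_closed)
next
  let ?V = "coord_space n"
  fix x assume "x \<in> (\<Union>k\<in>{1..n}. orbit F n (basis_vec k))"
  then obtain k where k: "k \<in> {1..n}" and "x \<in> orbit F n (basis_vec k)" by blast
  from this(2) have "\<exists>w\<in>weyl_group F n. x = w (basis_vec k)"
  proof (induction rule: orbit.induct)
    case orbit_start
    have "\<one>\<^bsub>GL ?V\<^esub> \<in> weyl_group F n" unfolding weyl_group_def by (rule generate.one)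
    then show ?case using k
      by (intro bexI[of _ "\<one>\<^bsub>GL ?V\<^esub>"]) (auto simp: GL_def BijGroup_def coord_space_closed)
  next
    case (orbit_step x j)
    then obtain w where w: "w \<in> weyl_group F n" "x = w (basis_vec k)" by blast
    let ?s = "simple_reflection j"
    have s: "?s \<in> weyl_group F n" unfolding weyl_group_def
      by (rule generate.incl) (use orbit_step(2) in \<open>auto simp: simple_reflection_def\<close>)
    have "?s \<otimes>\<^bsub>GL ?V\<^esub> w \<in> weyl_group F n"
      using s w(1) unfolding weyl_group_def by (rule generate.eng)
    moreover have "?s \<otimes>\<^bsub>GL ?V\<^esub> w = compose ?V ?s w"
      using weyl_group_closed[OF s] weyl_group_closed[OF w(1)] by (simp add: GL_def BijGroup_def)
    moreover have "w (basis_vec k) \<in> ?V"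
      using weyl_group_closed[OF w(1)] k orbit_coord_space coord_space_closed(4) by blast
    ultimately show ?case using k w(2)
      by (intro bexI[of _ "?s \<otimes>\<^bsub>GL ?V\<^esub> w"])
        (auto simp: compose_def simple_reflection_def coord_space_closed)
  qed
  then show "x \<in> weyl_roots F n" using k by (auto simp: weyl_roots_def)
qed

lemma basis_in_weyl_roots: "k \<in> {1..n} \<Longrightarrow> basis_vec k \<in> weyl_roots F n"
  by (auto simp: weyl_roots_eq_orbits intro: orbit_start)

lemma simple_reflection_weyl_roots:
  "x \<in> weyl_roots F n \<Longrightarrow> k \<in> {1..n} \<Longrightarrow> reflection F (basis_vec k) x \<in> weyl_roots F n"
  unfolding weyl_roots_eq_orbits using orbit_step by blast

text \<open>
The way in which upper bounds for the set of roots are proved.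
\<close>

lemma weyl_roots_minimal:
  assumes "\<And>k. k \<in> {1..n} \<Longrightarrow> basis_vec k \<in> T"
    and "\<And>k x. k \<in> {1..n} \<Longrightarrow> x \<in> T \<Longrightarrow> reflection F (basis_vec k) x \<in> T"
  shows "weyl_roots F n \<subseteq> T"
proof
  fix x assume "x \<in> weyl_roots F n"
  then obtain k where k: "k \<in> {1..n}" and "x \<in> orbit F n (basis_vec k)"
    by (auto simp: weyl_roots_eq_orbits)
  from this(2) show "x \<in> T" by (induction rule: orbit.induct) (auto intro: assms k)
qed

lemma reflection_orbit_stable:
  assumes "\<And>y. y \<in> weyl_roots F n \<Longrightarrow> reflection F e y \<in> weyl_roots F n"
    and "x \<in> orbit F n e" "y \<in> weyl_roots F n"
  shows "reflection F x y \<in> weyl_roots F n"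
  using assms(2,3)
proof (induction arbitrary: y rule: orbit.induct)
  case (orbit_step x k)
  then show ?case
    by (simp add: reflection_conjugate anisotropic simple_reflection_weyl_roots)
qed (rule assms(1))

lemma reflection_weyl_roots:
  assumes "x \<in> weyl_roots F n" "y \<in> weyl_roots F n"
  shows "reflection F x y \<in> weyl_roots F n"
proof -
  obtain k where k: "k \<in> {1..n}" and x: "x \<in> orbit F n (basis_vec k)"
    using assms(1) by (auto simp: weyl_roots_eq_orbits)
  show ?thesis
    using reflection_orbit_stable[OF _ x assms(2)] simple_reflection_weyl_roots k by blast
qed

end

section \<open>Translations by null roots\<close>

text \<open>
A property that survives changing the \<open>k\<close>-th coordinate by \<open>\<plusminus>N\<^sub>k\<close> spreads from \<open>a\<close> to its whole coset.
  The finitely many coordinates are adjusted one after the other.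
\<close>

lemma coset_fill:
  assumes "finite S"
    and step: "\<And>c k. P c \<Longrightarrow> k \<in> S \<Longrightarrow> P (c(k := c k + N k)) \<and> P (c(k := c k - (N k :: int)))"
    and "P a" "\<And>k. k \<in> S \<Longrightarrow> N k dvd c k - a k" "\<And>k. k \<notin> S \<Longrightarrow> c k = a k"
  shows "P c"
proof -
  have shift: "P (c(k := c k + N k * z))" if "P c" "k \<in> S" for c k z
  proof (induction z rule: int_induct[where k = 0])
    case base show ?case using that by simp
  next
    case (step1 z)
    let ?b = "c(k := c k + N k * z)"
    have "P (?b(k := ?b k + N k))" using step[OF step1(2) that(2)] by blast
    also have "?b(k := ?b k + N k) = c(k := c k + N k * (z + 1))"
      by (rule ext) (simp add: algebra_simps)
    finally show ?case .
  next
    case (step2 z)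
    let ?b = "c(k := c k + N k * z)"
    have "P (?b(k := ?b k - N k))" using step[OF step2(2) that(2)] by blast
    also have "?b(k := ?b k - N k) = c(k := c k + N k * (z - 1))"
      by (rule ext) (simp add: algebra_simps)
    finally show ?case .
  qed
  have "P (\<lambda>k. if k \<in> T then c k else a k)" if "T \<subseteq> S" for T
    using finite_subset[OF that assms(1)] that
  proof (induction T rule: finite_induct)
    case empty show ?case using assms(3) by simp
  next
    case (insert k T)
    define b where "b = (\<lambda>k. if k \<in> T then c k else a k)"
    obtain z where z: "c k - a k = N k * z" using assms(4)[of k] insert by auto
    have "P (b(k := b k + N k * z))" using insert by (intro shift) (auto simp: b_def)
    also have "b(k := b k + N k * z) = (\<lambda>j. if j \<in> insert k T then c j else a j)"
      using insert z by (auto simp: b_def fun_eq_iff)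
    finally show ?case .
  qed
  moreover have "(\<lambda>k. if k \<in> S then c k else a k) = c"
    using assms(5) by auto
  ultimately show ?thesis by (metis order_refl)
qed

text \<open>
Only what the translation argument uses: a Gram matrix of \<open>C\<close> and, for each added index, a simple
  root or the double of one.  The position of these roots in the diagram is still arbitrary.
\<close>

locale affinization =
  fixes l d :: nat and C :: "nat \<Rightarrow> nat \<Rightarrow> int" and G :: "nat \<Rightarrow> nat \<Rightarrow> rat" and r :: "nat \<Rightarrow> vec"
  assumes gram: "induced_gram l C G"
    and simple: "\<And>k. k \<in> {1..l} \<Longrightarrow> r k = basis_vec k"
    and added: "\<And>k. k \<in> {l+1..l+d} \<Longrightarrow> r k \<in> simple_roots l \<union> (*\<^sub>q) 2 ` simple_roots l"
begin

abbreviation F0 where "F0 \<equiv> gram_form l G"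
abbreviation F where "F \<equiv> affine_form l d G r"
abbreviation RW where "RW \<equiv> weyl_roots F (l + d)"
abbreviation K where "K \<equiv> {l+1..l+d}"

definition coroot_pairing :: "vec \<Rightarrow> vec \<Rightarrow> rat"
  where "coroot_pairing \<beta> x = 2 * F0 \<beta> x / F0 \<beta> \<beta>"

text \<open>The null root with coefficients \<open>c\<close>; only the values of \<open>c\<close> at added indices matter.\<close>

definition null_vec :: "(nat \<Rightarrow> int) \<Rightarrow> vec"
  where "null_vec c = (\<Sum>k\<in>K. rat_of_int (c k) *\<^sub>q (basis_vec k - r k))"

lemma gram_symmetric: "i \<in> {1..l} \<Longrightarrow> j \<in> {1..l} \<Longrightarrow> G i j = G j i"
  and gram_positive: "i \<in> {1..l} \<Longrightarrow> G i i > 0"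
  using gram unfolding induced_gram_def by blast+

lemma gram_cartan:
  assumes "i \<in> {1..l}" "j \<in> {1..l}"
  shows "2 * G i j = rat_of_int (C i j) * G i i"
proof -
  have "rat_of_int (C i j) = 2 * G i j / G i i"
    using gram assms unfolding induced_gram_def by blast
  then show ?thesis using gram_positive[OF assms(1)] by simp
qed

lemma gram_form_basis_left:
  assumes "i \<in> {1..l}"
  shows "gram_form l G (basis_vec i) x = (\<Sum>j=1..l. x j * G i j)"
proof -
  have "gram_form l G (basis_vec i) x = (\<Sum>k=1..l. if k = i then \<Sum>j=1..l. x j * G i j else 0)"
    unfolding gram_form_def by (intro sum.cong) (auto simp: basis_vec_apply)
  then show ?thesis using assms by simp
qed

lemma gram_form_basis:
  assumes "i \<in> {1..l}" "j \<in> {1..l}"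
  shows "gram_form l G (basis_vec i) (basis_vec j) = G i j"
proof -
  have "gram_form l G (basis_vec i) (basis_vec j) = (\<Sum>k=1..l. if k = j then G i j else 0)"
    unfolding gram_form_basis_left[OF assms(1)] by (intro sum.cong) (auto simp: basis_vec_apply)
  then show ?thesis using assms by simp
qed

sublocale finite: root_form F0 l
proof
  show "F0 (x + y) z = F0 x z + F0 y z" for x y z
    by (simp add: gram_form_def sum.distrib algebra_simps)
  show "F0 (c *\<^sub>q x) z = c * F0 x z" for c x z
    by (simp add: gram_form_def scale_apply sum_distrib_left algebra_simps)
  show "F0 x y = F0 y x" for x y
    unfolding gram_form_def
    by (subst sum.swap) (intro sum.cong refl, simp add: gram_symmetric mult.commute)
  show "F0 (basis_vec k) (basis_vec k) \<noteq> 0" if "k \<in> {1..l}" for k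
    using gram_positive[OF that] gram_form_basis[OF that that] by simp
qed

lemma root_map_add: "root_map n r (x + y) = root_map n r x + root_map n r y"
  by (simp add: root_map_def vec.scale_left_distrib sum.distrib)

lemma root_map_scale: "root_map n r (c *\<^sub>q x) = c *\<^sub>q root_map n r x"
  by (simp add: root_map_def vec.scale_sum_right scale_apply)

lemma root_map_basis:
  assumes "k \<in> {1..l + d}"
  shows "root_map (l + d) r (basis_vec k) = r k"
proof -
  have "root_map (l + d) r (basis_vec k) = (\<Sum>j=1..l+d. if j = k then r k else 0)"
    unfolding root_map_def by (intro sum.cong) (auto simp: basis_vec_apply)
  then show ?thesis using assms by (simp add: sum.delta)
qed

lemma added_cases:
  assumes "k \<in> {1..l + d}"
  obtains i where "i \<in> {1..l}" "r k = basis_vec i" | i where "i \<in> {1..l}" "r k = 2 *\<^sub>q basis_vec i"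
proof (cases "k \<le> l")
  case True
  then show ?thesis using that(1) simple assms by auto
next
  case False
  then have "r k \<in> simple_roots l \<union> (*\<^sub>q) 2 ` simple_roots l" using added assms by simp
  then show ?thesis using that unfolding simple_roots_def by blast
qed

lemma root_in_coord_space: "k \<in> {1..l + d} \<Longrightarrow> r k \<in> coord_space l"
  by (rule added_cases) (auto simp: coord_space_closed)

lemma root_anisotropic: "k \<in> {1..l + d} \<Longrightarrow> F0 (r k) (r k) \<noteq> 0"
  by (erule added_cases) (auto simp: finite.bilinear finite.anisotropic)

lemma root_map_id:
  assumes "x \<in> coord_space l"
  shows "root_map (l + d) r x = x"
proof
  fix i
  have "root_map (l + d) r x i = (\<Sum>k=1..l+d. x k * r k i)"
    by (simp add: root_map_def sum_vec_apply scale_apply)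
  also have "\<dots> = (\<Sum>k=1..l+d. if k = i then x i else 0)"
  proof (intro sum.cong refl)
    fix k assume k: "k \<in> {1..l+d}"
    show "x k * r k i = (if k = i then x i else 0)"
    proof (cases "k \<le> l")
      case True
      then have "r k = basis_vec k" using k by (intro simple) auto
      then show ?thesis by (auto simp: basis_vec_apply)
    next
      case False
      then show ?thesis using assms by (auto simp: coord_space_def)
    qed
  qed
  also have "\<dots> = x i" using assms by (auto simp: coord_space_def)
  finally show "root_map (l + d) r x i = x i" .
qed

sublocale affine: root_form F "l + d"
proof
  show "F (x + y) z = F x z + F y z" for x y z
    by (simp add: affine_form_def root_map_add finite.bilinear)
  show "F (c *\<^sub>q x) z = c * F x z" for c x z
    by (simp add: affine_form_def root_map_scale finite.bilinear)
  show "F x y = F y x" for x y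
    unfolding affine_form_def by (rule finite.commute)
  show "F (basis_vec k) (basis_vec k) \<noteq> 0" if "k \<in> {1..l + d}" for k
    using that by (simp add: affine_form_def root_map_basis root_anisotropic)
qed

lemma null_vec_add: "null_vec (\<lambda>k. a k + m * c k) = null_vec a + rat_of_int m *\<^sub>q null_vec c"
  by (simp add: null_vec_def vec.scale_left_distrib sum.distrib vec.scale_sum_right)

lemma null_vec_zero: "null_vec (\<lambda>k. 0) = 0"
  by (simp add: null_vec_def)

lemma null_vec_cong: "(\<And>k. k \<in> K \<Longrightarrow> a k = c k) \<Longrightarrow> null_vec a = null_vec c"
  by (simp add: null_vec_def)

lemma null_vec_unit: "k \<in> K \<Longrightarrow> null_vec (\<lambda>j. if j = k then 1 else 0) = basis_vec k - r k"
  by (simp add: null_vec_def if_distrib[of "\<lambda>z. rat_of_int z *\<^sub>q _"] sum.delta cong: if_cong)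

text \<open>
The difference of \<open>e\<^sub>k\<close> and \<open>r\<^sub>k\<close> is mapped to \<open>r\<^sub>k - r\<^sub>k\<close>, since \<open>root_map\<close> fixes the finite space.
\<close>

lemma root_map_null_vec: "root_map (l + d) r (null_vec c) = 0"
proof -
  have *: "root_map (l + d) r (\<Sum>k\<in>S. rat_of_int (c k) *\<^sub>q (basis_vec k - r k)) = 0" 
    if "S \<subseteq> K" for S
    using finite_subset[OF that finite_atLeastAtMost] that
  proof (induction S rule: finite_induct)
    case empty
    show ?case by (simp add: root_map_def)
  next
    case (insert k S)
    then have k: "k \<in> {1..l + d}" by auto
    have "root_map (l + d) r (basis_vec k - r k) + root_map (l + d) r (r k)
        = root_map (l + d) r (basis_vec k)"
      by (simp flip: root_map_add)
    then have "root_map (l + d) r (basis_vec k - r k) = 0"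
      using k by (simp add: root_map_basis root_map_id root_in_coord_space)
    moreover have "root_map (l + d) r (\<Sum>j\<in>S. rat_of_int (c j) *\<^sub>q (basis_vec j - r j)) = 0"
      using insert by blast
    ultimately show ?case
      by (simp only: sum.insert[OF insert(1,2)] root_map_add root_map_scale vec.scale_zero_right
          add_0_right)
  qed
  show ?thesis unfolding null_vec_def by (rule *) simp
qed

lemma affine_form_shift:
  assumes "x \<in> coord_space l" "y \<in> coord_space l"
  shows "F (x + null_vec a) (y + null_vec c) = F0 x y"
  using assms by (simp add: affine_form_def root_map_add root_map_null_vec root_map_id)

lemma affine_form_finite: "x \<in> coord_space l \<Longrightarrow> y \<in> coord_space l \<Longrightarrow> F x y = F0 x y"
  using affine_form_shift[of x y "\<lambda>_. 0" "\<lambda>_. 0"] by (simp add: null_vec_zero)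

text \<open>
The null part of a root contributes nothing to the form, so the finite part of the vector is
  reflected in the finite part of the root, and the null part changes by a multiple of that of
  the root.  Upper and lower bounds on the roots both rest on this formula.
\<close>

lemma reflection_shift:
  assumes "\<beta> \<in> coord_space l" "x \<in> coord_space l"
  shows "reflection F (\<beta> + null_vec a) (x + null_vec c)
    = reflection F0 \<beta> x + null_vec c - coroot_pairing \<beta> x *\<^sub>q null_vec a"
  using assms
  by (simp add: reflection_def affine_form_shift coroot_pairing_def vec.scale_right_distrib)

lemma reflection_shift_finite:
  assumes "\<beta> \<in> coord_space l" "x \<in> coord_space l"
  shows "reflection F \<beta> (x + null_vec c) = reflection F0 \<beta> x + null_vec c"
  using reflection_shift[OF assms, of "\<lambda>_. 0" c] by (simp add: null_vec_zero)

lemma basis_shift: "k \<in> K \<Longrightarrow> basis_vec k = r k + null_vec (\<lambda>j. if j = k then 1 else 0)"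
  by (simp add: null_vec_unit)

lemma reflection_root_orbit:
  assumes "k \<in> {1..l + d}" "x \<in> orbit F0 l e"
  shows "reflection F0 (r k) x \<in> orbit F0 l e"
  using assms(1)
proof (cases rule: added_cases)
  case (1 i) then show ?thesis using assms(2) orbit_step by simp
next
  case (2 i) then show ?thesis
    using assms(2) orbit_step by (simp add: finite.reflection_scaled_root)
qed

text \<open>
The null coefficients of the generators whose finite part is \<open>e\<close>: zero for a simple root, and a
  unit vector for each added index mapped to \<open>e\<close>.
\<close>

definition base_coeffs :: "vec \<Rightarrow> (nat \<Rightarrow> int) set"
  where "base_coeffs e = {a. e \<in> simple_roots l \<and> a = (\<lambda>_. 0) \<or>
    (\<exists>k\<in>K. r k = e \<and> a = (\<lambda>j. if j = k then 1 else 0))}"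

definition null_coeffs :: "vec \<Rightarrow> (nat \<Rightarrow> int) \<Rightarrow> (nat \<Rightarrow> int) set"
  where "null_coeffs e N = {c. \<exists>a\<in>base_coeffs e. \<forall>k\<in>K. N k dvd c k - a k}"

lemma base_in_null_coeffs: "a \<in> base_coeffs e \<Longrightarrow> a \<in> null_coeffs e N"
  unfolding null_coeffs_def by (intro CollectI bexI[of _ a]) auto

text \<open>
The candidate for the set of roots with finite part in the orbit of \<open>e\<close>.  The step \<open>N k\<close> is the
  modulus that governs the coefficient of the \<open>k\<close>-th null root.
\<close>

definition layer :: "vec \<Rightarrow> (nat \<Rightarrow> int) \<Rightarrow> vec set"
  where "layer e N = {x + null_vec c | x c. x \<in> orbit F0 l e \<and> c \<in> null_coeffs e N}"

lemma layerI: "x \<in> orbit F0 l e \<Longrightarrow> c \<in> null_coeffs e N \<Longrightarrow> x + null_vec c \<in> layer e N"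
  unfolding layer_def by blast

lemma layer_norm:
  "e \<in> coord_space l \<Longrightarrow> y \<in> layer e N \<Longrightarrow> F y y = F0 e e"
  by (auto simp: layer_def affine_form_shift orbit_coord_space finite.orbit_norm)

text \<open>
The simple reflections with index at most \<open>l\<close> leave the null part unchanged.  The one with an
  added index \<open>k\<close> changes the \<open>k\<close>-th coefficient by the pairing with \<open>r\<^sub>k\<close>, which is assumed to be
  divisible by \<open>N k\<close>.
\<close>

lemma layer_stable:
  assumes e: "e \<in> coord_space l"
    and divisible: "\<And>x k. x \<in> orbit F0 l e \<Longrightarrow> k \<in> K \<Longrightarrow>
      \<exists>z. coroot_pairing (r k) x = rat_of_int (N k * z)"
    and k: "k \<in> {1..l + d}" and y: "y \<in> layer e N"
  shows "reflection F (basis_vec k) y \<in> layer e N"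
proof -
  from y obtain x c where y_eq: "y = x + null_vec c"
    and x: "x \<in> orbit F0 l e" and c: "c \<in> null_coeffs e N"
    by (auto simp: layer_def)
  have xV: "x \<in> coord_space l" using x e by (rule orbit_coord_space)
  show ?thesis
  proof (cases "k \<in> K")
    case False
    then have "k \<in> {1..l}" using k by auto
    then have "reflection F (basis_vec k) y = reflection F0 (basis_vec k) x + null_vec c"
      "reflection F0 (basis_vec k) x \<in> orbit F0 l e"
      using x xV orbit_step by (auto simp: y_eq reflection_shift_finite coord_space_closed)
    then show ?thesis using layerI c by simp
  next
    case True
    define u where "u = (\<lambda>j. if j = k then 1 else 0 :: int)"
    obtain z where z: "coroot_pairing (r k) x = rat_of_int (N k * z)"
      using divisible[OF x True] by blast
    have "reflection F (basis_vec k) y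
        = reflection F0 (r k) x + null_vec c - rat_of_int (N k * z) *\<^sub>q null_vec u"
      using basis_shift[OF True] reflection_shift[OF root_in_coord_space[OF k] xV] z
      by (simp add: y_eq u_def)
    also have "\<dots> = reflection F0 (r k) x + null_vec (\<lambda>j. c j + (- (N k * z)) * u j)"
      by (simp only: null_vec_add of_int_minus vec.scale_minus_left) simp
    also have "\<dots> \<in> layer e N"
    proof -
      from c obtain a where a: "a \<in> base_coeffs e" and dvd: "\<And>j. j \<in> K \<Longrightarrow> N j dvd c j - a j"
        unfolding null_coeffs_def by blast
      have "N j dvd (c j + (- (N k * z)) * u j) - a j" if "j \<in> K" for j
      proof -
        have "N j dvd - (N k * z) * u j" by (auto simp: u_def)
        then have "N j dvd (c j - a j) + - (N k * z) * u j" using dvd[OF that] by (rule dvd_add[rotated])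
        then show ?thesis by (simp add: algebra_simps)
      qed
      then have "(\<lambda>j. c j + (- (N k * z)) * u j) \<in> null_coeffs e N"
        using a unfolding null_coeffs_def by blast
      then show ?thesis using layerI reflection_root_orbit[OF k x] by blast
    qed
    finally show ?thesis .
  qed
qed

text \<open>
The finite Weyl group fixes the null vectors, so the null parts that occur with \<open>e\<close> occur with
  every vector of its orbit.
\<close>

lemma finite_weyl_orbit_roots:
  assumes "e \<in> coord_space l" "e + null_vec c \<in> RW" "x \<in> orbit F0 l e"
  shows "x + null_vec c \<in> RW"
  using assms(3)
proof (induction rule: orbit.induct)
  case (orbit_step x k)
  have "k \<in> {1..l + d}" using orbit_step(2) by simp
  with orbit_step.IH have "reflection F (basis_vec k) (x + null_vec c) \<in> RW"
    by (rule affine.simple_reflection_weyl_roots)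
  also have "reflection F (basis_vec k) (x + null_vec c) = reflection F0 (basis_vec k) x + null_vec c"
    using orbit_coord_space[OF orbit_step(1) assms(1)] coord_space_closed(4)[OF orbit_step(2)]
    by (intro reflection_shift_finite)
  finally show ?case .
qed (rule assms(2))

text \<open>
An added \<open>r\<^sub>k = 2\<alpha>\<^sub>i\<close> is not a root itself, but its reflection is the simple reflection of \<open>\<alpha>\<^sub>i\<close>.
  Hence the finite vectors \<open>\<beta>\<close> in its orbit can be used in translations.
\<close>

lemma root_reflection_stable:
  assumes k: "k \<in> {1..l + d}" and \<beta>: "\<beta> \<in> orbit F0 l (r k)" and y: "y \<in> RW"
  shows "reflection F \<beta> y \<in> RW"
  using \<beta> y
proof (induction arbitrary: y rule: orbit.induct)
  case orbit_start
  from k show ?case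
  proof (cases rule: added_cases)
    case (1 i) then show ?thesis using affine.simple_reflection_weyl_roots orbit_start by simp
  next
    case (2 i) then show ?thesis
      using affine.simple_reflection_weyl_roots orbit_start by (simp add: affine.reflection_scaled_root)
  qed
next
  case (orbit_step x j)
  have j: "j \<in> {1..l + d}" "basis_vec j \<in> coord_space l"
    using orbit_step(2) by (auto simp: coord_space_closed)
  have xV: "x \<in> coord_space l"
    using orbit_step(1) root_in_coord_space[OF k] by (rule orbit_coord_space)
  have "reflection F (basis_vec j) x = reflection F0 (basis_vec j) x"
    using reflection_shift_finite[OF j(2) xV, of "\<lambda>_. 0"] by (simp add: null_vec_zero)
  then show ?case
    using affine.reflection_conjugate[OF affine.anisotropic[OF j(1)], of x y]
      affine.simple_reflection_weyl_roots[OF _ j(1)] orbit_step.IH orbit_step.prems by simp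
qed

lemma coroot_pairing_reflection:
  assumes "F0 \<beta> \<beta> \<noteq> 0"
  shows "coroot_pairing \<beta> (reflection F0 \<beta> x) = - coroot_pairing \<beta> x"
  using assms by (simp add: coroot_pairing_def reflection_def finite.bilinear field_simps)

text \<open>
Let \<open>\<delta>\<close> be the \<open>k\<close>-th null root.  Both \<open>\<beta>\<close> and \<open>\<beta> + \<delta>\<close> have reflections that preserve the roots, and
  the product of the two reflections is the translation by the multiple \<open>\<langle>x, \<beta>\<^sup>\<or>\<rangle>\<close> of \<open>\<delta>\<close>.  The order
  of the factors decides the sign.
\<close>

lemma translation:
  assumes k: "k \<in> K" and \<beta>: "\<beta> \<in> orbit F0 l (r k)"
    and x: "x \<in> coord_space l" "x + null_vec c \<in> RW"
    and p: "coroot_pairing \<beta> x = rat_of_int m"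
  shows "x + null_vec (c(k := c k + m)) \<in> RW" "x + null_vec (c(k := c k - m)) \<in> RW"
proof -
  define u where "u = (\<lambda>j. if j = k then 1 else 0 :: int)"
  have k': "k \<in> {1..l + d}" using k by auto
  have \<beta>V: "\<beta> \<in> coord_space l"
    using \<beta> root_in_coord_space[OF k'] by (rule orbit_coord_space)
  have \<beta>0: "F0 \<beta> \<beta> \<noteq> 0" using finite.orbit_norm[OF \<beta>] root_anisotropic[OF k'] by simp
  have sx: "reflection F0 \<beta> x \<in> coord_space l"
    using x \<beta>V by (simp add: reflection_def coord_space_closed)
  have \<beta>u: "\<beta> + null_vec u \<in> RW"
    using finite_weyl_orbit_roots[OF root_in_coord_space[OF k'] _ \<beta>, of u]
      affine.basis_in_weyl_roots[OF k'] basis_shift[OF k] by (simp add: u_def)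
  have stable: "reflection F \<beta> y \<in> RW" if "y \<in> RW" for y
    using root_reflection_stable[OF k' \<beta> that] .
  have upd: "c(k := c k + q) = (\<lambda>j. c j + q * u j)" for q
    by (auto simp: u_def)
  have "reflection F (\<beta> + null_vec u) (reflection F \<beta> (x + null_vec c)) \<in> RW"
    by (intro affine.reflection_weyl_roots stable \<beta>u x)
  then show "x + null_vec (c(k := c k + m)) \<in> RW"
    by (simp add: upd null_vec_add reflection_shift_finite[OF \<beta>V x(1)] reflection_shift[OF \<beta>V sx]
        finite.reflection_involution[OF \<beta>0] coroot_pairing_reflection[OF \<beta>0] p
        vec.scale_minus_left add.assoc)
  have "reflection F \<beta> (reflection F (\<beta> + null_vec u) (x + null_vec c)) \<in> RW"
    by (intro affine.reflection_weyl_roots stable \<beta>u x)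
  moreover have "reflection F (\<beta> + null_vec u) (x + null_vec c)
      = reflection F0 \<beta> x + null_vec (\<lambda>j. c j + (- m) * u j)"
    unfolding null_vec_add
    by (simp add: reflection_shift[OF \<beta>V x(1)] p vec.scale_minus_left)
  ultimately have "x + null_vec (\<lambda>j. c j + (- m) * u j) \<in> RW"
    by (simp add: reflection_shift_finite[OF \<beta>V sx] finite.reflection_involution[OF \<beta>0])
  then show "x + null_vec (c(k := c k - m)) \<in> RW"
    using upd[of "- m"] by simp
qed

text \<open>
It is enough that the step \<open>N k\<close> is attained by a single pair \<open>(x, \<beta>)\<close>: a translation that is
  possible at one vector of the orbit of \<open>e\<close> is possible at all of them.
\<close>

lemma layer_subset:
  assumes e: "e \<in> coord_space l"
    and steps: "\<And>k. k \<in> K \<Longrightarrow> \<exists>x\<in>orbit F0 l e. \<exists>\<beta>\<in>orbit F0 l (r k).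
      coroot_pairing \<beta> x \<in> {rat_of_int (N k), - rat_of_int (N k)}"
  shows "layer e N \<subseteq> RW"
proof
  fix y assume "y \<in> layer e N"
  then obtain x c a where y: "y = x + null_vec c" and x: "x \<in> orbit F0 l e"
    and a: "a \<in> base_coeffs e"
    and dvd: "\<And>k. k \<in> K \<Longrightarrow> N k dvd c k - a k"
    unfolding layer_def null_coeffs_def by blast
  have move: "y + null_vec c \<in> RW"
    if "x + null_vec c \<in> RW" "x \<in> orbit F0 l e" "y \<in> orbit F0 l e" for x y c
    using finite_weyl_orbit_roots[OF orbit_coord_space[OF that(2) e] that(1)] that
      finite.orbit_eq by simp
  \<comment> \<open>The admissible null parts are the same for all vectors of the orbit, so they are studied at \<open>e\<close>.\<close>
  define P where "P = (\<lambda>c. e + null_vec c \<in> RW)"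
  have "P a"
  proof (cases "\<exists>k\<in>K. r k = e \<and> a = (\<lambda>j. if j = k then 1 else 0)")
    case True
    then obtain k where "k \<in> K" "e + null_vec a = basis_vec k" using basis_shift by metis
    then show ?thesis using affine.basis_in_weyl_roots[of k] by (simp add: P_def)
  next
    case False
    then obtain i where "i \<in> {1..l}" "e + null_vec a = basis_vec i"
      using a by (auto simp: base_coeffs_def simple_roots_def null_vec_zero)
    then show ?thesis using affine.basis_in_weyl_roots[of i] by (simp add: P_def)
  qed
  have step: "P (c(k := c k + N k)) \<and> P (c(k := c k - N k))" if "P c" "k \<in> K" for c k
  proof -
    obtain x \<beta> where x: "x \<in> orbit F0 l e" and \<beta>: "\<beta> \<in> orbit F0 l (r k)"
      and p: "coroot_pairing \<beta> x = rat_of_int (N k) \<or> coroot_pairing \<beta> x = rat_of_int (- N k)"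
      using steps[OF \<open>k \<in> K\<close>] by auto
    have xc: "x + null_vec c \<in> RW" using move orbit_start x \<open>P c\<close> unfolding P_def by blast
    have "x + null_vec (c(k := c k + N k)) \<in> RW \<and> x + null_vec (c(k := c k - N k)) \<in> RW"
      using p translation[OF \<open>k \<in> K\<close> \<beta> orbit_coord_space[OF x e] xc] by fastforce
    then show ?thesis using move[OF _ x orbit_start] by (auto simp: P_def)
  qed
  define c' where "c' = (\<lambda>k. if k \<in> K then c k else a k)"
  have dvd': "N k dvd c' k - a k" if "k \<in> K" for k using dvd[OF that] that by (simp add: c'_def)
  have outside: "c' k = a k" if "k \<notin> K" for k using that by (simp only: c'_def if_False)
  have "P c'"
    by (rule coset_fill[where P = P and S = K and N = N and a = a])
      (fact finite_atLeastAtMost step \<open>P a\<close> dvd' outside)+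
  moreover have "null_vec c' = null_vec c" by (rule null_vec_cong) (simp add: c'_def)
  ultimately have "e + null_vec c \<in> RW" by (simp only: P_def)
  then show "y \<in> RW" unfolding y using move orbit_start x by blast
qed

text \<open>
The general form of the result.  The set \<open>E\<close> contains one representative of each orbit of finite
  parts, and the steps \<open>N e (r k)\<close> are at the same time a common divisor of the pairings that occur
  and one of their values up to sign.
\<close>

theorem weyl_roots_layers:
  assumes E: "E \<subseteq> coord_space l"
    and covers: "\<And>i. i \<in> {1..l} \<Longrightarrow> \<exists>e\<in>E \<inter> simple_roots l. basis_vec i \<in> orbit F0 l e"
    and added_in: "\<And>k. k \<in> K \<Longrightarrow> r k \<in> E"
    and divisible: "\<And>e x k. e \<in> E \<Longrightarrow> x \<in> orbit F0 l e \<Longrightarrow> k \<in> K \<Longrightarrow>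
      \<exists>z. coroot_pairing (r k) x = rat_of_int (N e (r k) * z)"
    and steps: "\<And>e k. e \<in> E \<Longrightarrow> k \<in> K \<Longrightarrow> \<exists>x\<in>orbit F0 l e. \<exists>\<beta>\<in>orbit F0 l (r k).
      coroot_pairing \<beta> x \<in> {rat_of_int (N e (r k)), - rat_of_int (N e (r k))}"
  shows "RW = (\<Union>e\<in>E. layer e (\<lambda>k. N e (r k)))"
proof
  show "(\<Union>e\<in>E. layer e (\<lambda>k. N e (r k))) \<subseteq> RW"
  proof (rule UN_least)
    fix e assume e: "e \<in> E"
    then have "e \<in> coord_space l" using E by blast
    then show "layer e (\<lambda>k. N e (r k)) \<subseteq> RW" using steps[OF e] by (rule layer_subset)
  qed
  show "RW \<subseteq> (\<Union>e\<in>E. layer e (\<lambda>k. N e (r k)))"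
  proof (rule affine.weyl_roots_minimal)
    fix k assume k: "k \<in> {1..l + d}"
    show "basis_vec k \<in> (\<Union>e\<in>E. layer e (\<lambda>k. N e (r k)))"
    proof (cases "k \<le> l")
      case True
      then obtain e where e: "e \<in> E" "e \<in> simple_roots l" "basis_vec k \<in> orbit F0 l e"
        using covers[of k] k by auto
      then have "(\<lambda>_. 0) \<in> null_coeffs e (\<lambda>k. N e (r k))" 
        by (intro base_in_null_coeffs) (simp add: base_coeffs_def)
      then have "basis_vec k + null_vec (\<lambda>_. 0) \<in> layer e (\<lambda>k. N e (r k))"
        using e(3) layerI by blast
      then show ?thesis using e(1) by (auto simp: null_vec_zero)
    next
      case False
      then have kK: "k \<in> K" using k by auto
      let ?u = "\<lambda>j. if j = k then 1 else 0 :: int"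
      have "?u \<in> base_coeffs (r k)" unfolding base_coeffs_def using kK by blast
      then have "?u \<in> null_coeffs (r k) (\<lambda>j. N (r k) (r j))" by (rule base_in_null_coeffs)
      then have "basis_vec k \<in> layer (r k) (\<lambda>j. N (r k) (r j))"
        using basis_shift[OF kK] orbit_start[of "r k"] unfolding layer_def by blast
      then show ?thesis using added_in[OF kK] by blast
    qed
  next
    fix k x assume k: "k \<in> {1..l + d}" and "x \<in> (\<Union>e\<in>E. layer e (\<lambda>k. N e (r k)))"
    then obtain e where e: "e \<in> E" and x: "x \<in> layer e (\<lambda>k. N e (r k))" by blast
    have "e \<in> coord_space l" using e E by blast
    then have "reflection F (basis_vec k) x \<in> layer e (\<lambda>k. N e (r k))"
      using divisible[OF e] k x by (rule layer_stable)
    then show "reflection F (basis_vec k) x \<in> (\<Union>e\<in>E. layer e (\<lambda>k. N e (r k)))"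
      using e by blast
  qed
qed

end

section \<open>Divisibility of coroot pairings\<close>

context affinization
begin

text \<open>
In terms of the Cartan matrix alone; so the finite orbits do not depend on the scale of the form.
\<close>

lemma coroot_pairing_simple:
  assumes i: "i \<in> {1..l}"
  shows "coroot_pairing (basis_vec i) x = (\<Sum>j=1..l. rat_of_int (C i j) * x j)"
proof -
  have "2 * F0 (basis_vec i) x = (\<Sum>j=1..l. rat_of_int (C i j) * x j) * G i i"
    unfolding gram_form_basis_left[OF i] sum_distrib_left sum_distrib_right
  proof (intro sum.cong refl)
    fix j assume "j \<in> {1..l}"
    from gram_cartan[OF i this]
    have "x j * (2 * G i j) = x j * (rat_of_int (C i j) * G i i)" by simp
    then show "2 * (x j * G i j) = rat_of_int (C i j) * x j * G i i" by (simp add: algebra_simps)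
  qed
  then show ?thesis using gram_positive[OF i] by (simp add: coroot_pairing_def gram_form_basis[OF i i])
qed

lemma coroot_pairing_basis:
  assumes i: "i \<in> {1..l}" and j: "j \<in> {1..l}"
  shows "coroot_pairing (basis_vec i) (basis_vec j) = rat_of_int (C i j)"
  using gram_cartan[OF i j] gram_positive[OF i]
  by (simp add: coroot_pairing_def gram_form_basis[OF i i] gram_form_basis[OF i j])

lemma coroot_pairing_scale_left:
  "coroot_pairing (c *\<^sub>q \<beta>) x = coroot_pairing \<beta> x / c"
  by (simp add: coroot_pairing_def finite.bilinear field_simps)

lemma coroot_pairing_scale_right:
  "coroot_pairing \<beta> (c *\<^sub>q x) = c * coroot_pairing \<beta> x"
  by (simp add: coroot_pairing_def finite.bilinear)

lemma coroot_pairing_add_right: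
  "coroot_pairing \<beta> (x + y) = coroot_pairing \<beta> x + coroot_pairing \<beta> y"
  by (simp add: coroot_pairing_def finite.bilinear add_divide_distrib algebra_simps)

lemma reflection_eq: "reflection F0 \<beta> x = x - coroot_pairing \<beta> x *\<^sub>q \<beta>"
  by (simp add: reflection_def coroot_pairing_def)

text \<open>
Membership in the lattice \<open>\<Oplus> D\<^sub>j \<int>\<alpha>\<^sub>j\<close>.
\<close>

definition graded :: "(nat \<Rightarrow> int) \<Rightarrow> vec \<Rightarrow> bool"
  where "graded D x \<longleftrightarrow> (\<forall>j\<in>{1..l}. \<exists>z. x j = rat_of_int (D j * z))"

lemma coroot_pairing_divisible:
  assumes "graded D x" and i: "i \<in> {1..l}" and dvd: "\<And>j. j \<in> {1..l} \<Longrightarrow> m dvd C i j * D j"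
  shows "\<exists>z. coroot_pairing (basis_vec i) x = rat_of_int (m * z)"
proof -
  from assms(1) obtain z where z: "\<And>j. j \<in> {1..l} \<Longrightarrow> x j = rat_of_int (D j * z j)"
    unfolding graded_def by metis
  have "coroot_pairing (basis_vec i) x = rat_of_int (\<Sum>j=1..l. C i j * D j * z j)"
    by (simp add: coroot_pairing_simple[OF i] z mult.assoc)
  moreover have "m dvd (\<Sum>j=1..l. C i j * D j * z j)"
    by (intro dvd_sum dvd_mult2 dvd)
  ultimately show ?thesis by (metis dvdE)
qed

text \<open>
The \<open>i\<close>-th simple reflection changes only the \<open>i\<close>-th coordinate, and does so by the pairing with
  \<open>\<alpha>\<^sub>i\<^sup>\<or>\<close>; the hypothesis on \<open>C\<close> makes this pairing divisible by \<open>D i\<close>.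
\<close>

lemma graded_orbit:
  assumes "graded D e" and stable: "\<And>i j. i \<in> {1..l} \<Longrightarrow> j \<in> {1..l} \<Longrightarrow> D i dvd C i j * D j"
    and "x \<in> orbit F0 l e"
  shows "graded D x"
  using assms(3)
proof (induction rule: orbit.induct)
  case (orbit_step x i)
  obtain w where w: "coroot_pairing (basis_vec i) x = rat_of_int (D i * w)"
    using coroot_pairing_divisible[OF orbit_step.IH orbit_step(2), of "D i"]
      stable[OF orbit_step(2)] by blast
  show ?case unfolding graded_def
  proof
    fix j assume "j \<in> {1..l}"
    with orbit_step.IH obtain z where z: "x j = rat_of_int (D j * z)"
      unfolding graded_def by blast
    have "reflection F0 (basis_vec i) x j = x j - (if j = i then rat_of_int (D j * w) else 0)"
      by (simp add: reflection_eq w scale_apply basis_vec_apply)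
    then have "reflection F0 (basis_vec i) x j = rat_of_int (D j * (if j = i then z - w else z))"
      by (simp add: z right_diff_distrib)
    then show "\<exists>z. reflection F0 (basis_vec i) x j = rat_of_int (D j * z)" by blast
  qed
qed (rule assms(1))

lemma graded_basis:
  assumes "D i dvd m"
  shows "graded D (rat_of_int m *\<^sub>q basis_vec i)"
  unfolding graded_def
proof
  fix j
  obtain z where z: "m = D i * z" using assms by (rule dvdE)
  have "(rat_of_int m *\<^sub>q basis_vec i) j = rat_of_int (D j * (if j = i then z else 0))"
    by (simp add: scale_apply basis_vec_apply z)
  then show "\<exists>z. (rat_of_int m *\<^sub>q basis_vec i) j = rat_of_int (D j * z)" by blast
qed

lemma graded_basis_1: "D i = 1 \<Longrightarrow> graded D (basis_vec i)"
  using graded_basis[of D i 1] by simp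

lemma graded_basis_2: "D i = 2 \<Longrightarrow> graded D (2 *\<^sub>q basis_vec i)"
  using graded_basis[of D i 2] by simp

text \<open>
For a single bond \<open>s\<^sub>i s\<^sub>j \<alpha>\<^sub>i = s\<^sub>i (\<alpha>\<^sub>i + \<alpha>\<^sub>j) = \<alpha>\<^sub>j\<close>.
\<close>

lemma adjacent_orbit:
  assumes i: "i \<in> {1..l}" and j: "j \<in> {1..l}" and "C i j = - 1" "C j i = - 1"
  shows "basis_vec j \<in> orbit F0 l (basis_vec i)"
proof -
  have "reflection F0 (basis_vec j) (basis_vec i) \<in> orbit F0 l (basis_vec i)"
    using j by (intro orbit_step orbit_start)
  then have "reflection F0 (basis_vec i) (reflection F0 (basis_vec j) (basis_vec i))
      \<in> orbit F0 l (basis_vec i)"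
    using i by (rule orbit_step)
  moreover have "C i i = 2" 
    using gram_cartan[OF i i] gram_positive[OF i] by simp
  then have "reflection F0 (basis_vec i) (reflection F0 (basis_vec j) (basis_vec i)) = basis_vec j"
    using assms(3,4) coroot_pairing_basis[OF i i] coroot_pairing_basis[OF i j]
      coroot_pairing_basis[OF j i]
    by (simp add: reflection_eq coroot_pairing_add_right vec.scale_minus_left)
  ultimately show ?thesis by simp
qed

lemma chain_orbit:
  assumes "m \<le> n" "{m..n} \<subseteq> {1..l}"
    and "\<And>i. m \<le> i \<Longrightarrow> i < n \<Longrightarrow> C i (i + 1) = - 1 \<and> C (i + 1) i = - 1"
  shows "basis_vec n \<in> orbit F0 l (basis_vec m)"
  using assms
proof (induction n rule: dec_induct)
  case base show ?case by (rule orbit_start)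
next
  case (step n)
  have "basis_vec n \<in> orbit F0 l (basis_vec m)"
    using step.prems by (intro step.IH) (auto simp: subset_iff)
  moreover have "{n, n + 1} \<subseteq> {1..l}" using step by (auto simp: subset_iff)
  then have "basis_vec (n + 1) \<in> orbit F0 l (basis_vec n)"
    using step.prems(2)[of n] step.hyps by (intro adjacent_orbit) auto
  ultimately show ?case using orbit_trans by fastforce
qed

lemma weyl_roots_finite: "weyl_roots F0 l = (\<Union>i\<in>{1..l}. orbit F0 l (basis_vec i))"
  by (rule finite.weyl_roots_eq_orbits)

end

section \<open>Layers in terms of integral combinations\<close>

text \<open>
The coefficients allowed on one of the three groups of added indices, renumbered by \<open>{1..n}\<close>.  The
  flag \<open>own\<close> says that this group is mapped to the vector \<open>e\<close> whose layer is considered, and \<open>zero\<close>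
  that \<open>e\<close> is a simple root, so that the zero coefficients are allowed besides the unit vectors.
\<close>

definition coset_family :: "bool \<Rightarrow> bool \<Rightarrow> nat \<Rightarrow> int \<Rightarrow> (nat \<Rightarrow> int) set"
  where "coset_family own zero n N = {a. if own
    then zero \<and> (\<forall>j\<in>{1..n}. N dvd a j) \<or>
      (\<exists>i\<in>{1..n}. \<forall>j\<in>{1..n}. N dvd a j - (if j = i then 1 else 0))
    else \<forall>j\<in>{1..n}. N dvd a j}"

lemma bij_betw_coset_family:
  assumes "bij_betw p {1..n} A"
  shows "(\<lambda>j. c (p j)) \<in> coset_family own zero n N \<longleftrightarrow>
    (if own then zero \<and> (\<forall>k\<in>A. N dvd c k) \<or>
        (\<exists>i\<in>A. \<forall>k\<in>A. N dvd c k - (if k = i then 1 else 0))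
      else \<forall>k\<in>A. N dvd c k)"
proof -
  have A: "A = p ` {1..n}" and inj: "inj_on p {1..n}" using assms by (auto simp: bij_betw_def)
  have "N dvd c (p j) - (if p j = p i then 1 else 0) \<longleftrightarrow> N dvd c (p j) - (if j = i then 1 else 0)"
    if "i \<in> {1..n}" "j \<in> {1..n}" for i j
    using inj_on_eq_iff[OF inj that(2,1)] by simp
  then show ?thesis unfolding A coset_family_def by simp
qed

lemma coset_family_cong:
  assumes "\<And>j. j \<in> {1..n} \<Longrightarrow> a j = c j"
  shows "a \<in> coset_family own zero n N \<longleftrightarrow> c \<in> coset_family own zero n N"
  using assms by (simp add: coset_family_def)

lemma coset_family_other: "coset_family False z n N = {a. \<forall>j\<in>{1..n}. N dvd a j}"
  by (simp add: coset_family_def)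

lemma coset_family_1: "coset_family own True n 1 = UNIV" "coset_family False z n 1 = UNIV"
  by (auto simp: coset_family_def)

text \<open>
Modulo 2, a unit vector is a vector with exactly one odd entry.
\<close>

lemma coset_family_2_exactly: "coset_family True False n 2 = {a. exactly_one_odd n a}"
proof -
  have "(\<exists>i\<in>{1..n}. \<forall>j\<in>{1..n}. 2 dvd a j - (if j = i then 1 else 0)) \<longleftrightarrow> exactly_one_odd n a" for a
  proof
    assume "\<exists>i\<in>{1..n}. \<forall>j\<in>{1..n}. 2 dvd a j - (if j = i then 1 else 0)"
    then obtain i where i: "i \<in> {1..n}" and *: "\<And>j. j \<in> {1..n} \<Longrightarrow> even (a j - (if j = i then 1 else 0))"
      by blast
    have "odd (a j) \<longleftrightarrow> j = i" if "j \<in> {1..n}" for j using *[OF that] by (auto split: if_splits)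
    then have "{j \<in> {1..n}. odd (a j)} = {i}" using i by auto
    then show "exactly_one_odd n a" unfolding exactly_one_odd_def by simp
  next
    assume "exactly_one_odd n a"
    then obtain i where i: "{j \<in> {1..n}. odd (a j)} = {i}"
      by (auto simp: exactly_one_odd_def card_1_singleton_iff)
    have "even (a j - (if j = i then 1 else 0))" if "j \<in> {1..n}" for j
    proof (cases "j = i")
      case True then show ?thesis using i by auto
    next
      case False then have "j \<notin> {j \<in> {1..n}. odd (a j)}" using i by simp
      then show ?thesis using that False by simp
    qed
    moreover have "i \<in> {1..n}" using i by auto
    ultimately show "\<exists>i\<in>{1..n}. \<forall>j\<in>{1..n}. 2 dvd a j - (if j = i then 1 else 0)" by blast
  qed
  then show ?thesis by (simp add: coset_family_def)
qed

lemma coset_family_2_at_most: "coset_family True True n 2 = {a. at_most_one_odd n a}"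
proof -
  have "coset_family True True n 2 = {a. \<forall>j\<in>{1..n}. even (a j)} \<union> coset_family True False n 2"
    by (auto simp: coset_family_def)
  also have "\<dots> = {a. (\<forall>j\<in>{1..n}. even (a j)) \<or> exactly_one_odd n a}"
    unfolding coset_family_2_exactly by blast
  also have "\<dots> = {a. at_most_one_odd n a}"
  proof -
    have "(\<forall>j\<in>{1..n}. even (a j)) \<longleftrightarrow> card {j \<in> {1..n}. odd (a j)} = 0" for a :: "nat \<Rightarrow> int"
      by auto
    then show ?thesis unfolding exactly_one_odd_def at_most_one_odd_def
      by (simp only: le_eq_less_or_eq less_one)
  qed
  finally show ?thesis .
qed

definition combs :: "(nat \<Rightarrow> vec) \<Rightarrow> nat \<Rightarrow> (nat \<Rightarrow> int) set \<Rightarrow> vec set"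
  where "combs \<delta> n S = {int_comb n a \<delta> | a. a \<in> S}"

lemma int_comb_scale: "int_comb n (\<lambda>j. N * a j) \<delta> = rat_of_int N *\<^sub>q int_comb n a \<delta>"
  by (simp add: int_comb_def vec.scale_sum_right)

lemma int_comb_cong: "(\<And>j. j \<in> {1..n} \<Longrightarrow> a j = c j) \<Longrightarrow> int_comb n a \<delta> = int_comb n c \<delta>"
  by (simp add: int_comb_def)

lemma combs_multiples:
  "combs \<delta> n {a. \<forall>j\<in>{1..n}. N dvd a j} = {rat_of_int N *\<^sub>q int_comb n a \<delta> | a. True}"
proof (intro equalityI subsetI)
  fix v assume "v \<in> combs \<delta> n {a. \<forall>j\<in>{1..n}. N dvd a j}"
  then obtain a where v: "v = int_comb n a \<delta>" and a: "\<And>j. j \<in> {1..n} \<Longrightarrow> N dvd a j"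
    by (auto simp: combs_def)
  have "v = int_comb n (\<lambda>j. N * (a j div N)) \<delta>" unfolding v by (rule int_comb_cong) (simp add: a)
  then show "v \<in> {rat_of_int N *\<^sub>q int_comb n a \<delta> | a. True}" unfolding int_comb_scale by blast
next
  fix v assume "v \<in> {rat_of_int N *\<^sub>q int_comb n a \<delta> | a. True}"
  then obtain a where "v = int_comb n (\<lambda>j. N * a j) \<delta>" unfolding int_comb_scale by blast
  then show "v \<in> combs \<delta> n {a. \<forall>j\<in>{1..n}. N dvd a j}" unfolding combs_def by auto
qed

text \<open>
The added indices fall into three groups on which \<open>r\<close> is constant, each with a numbering.
\<close>

locale split_affinization = affinization +
  fixes A1 A2 A3 :: "nat set" and f1 f2 f3 :: vec and p1 p2 p3 :: "nat \<Rightarrow> nat" and n1 n2 n3 :: nat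
  assumes K_split: "{l+1..l+d} = A1 \<union> A2 \<union> A3"
    and disjoint: "A1 \<inter> A2 = {}" "A1 \<inter> A3 = {}" "A2 \<inter> A3 = {}"
    and bij: "bij_betw p1 {1..n1} A1" "bij_betw p2 {1..n2} A2" "bij_betw p3 {1..n3} A3"
    and root: "\<And>k. k \<in> A1 \<Longrightarrow> r k = f1" "\<And>k. k \<in> A2 \<Longrightarrow> r k = f2" "\<And>k. k \<in> A3 \<Longrightarrow> r k = f3"
begin

abbreviation "\<delta>1 \<equiv> \<lambda>j. basis_vec (p1 j) - f1"
abbreviation "\<delta>2 \<equiv> \<lambda>j. basis_vec (p2 j) - f2"
abbreviation "\<delta>3 \<equiv> \<lambda>j. basis_vec (p3 j) - f3"

lemma null_vec_split:
  "null_vec c = int_comb n1 (\<lambda>j. c (p1 j)) \<delta>1 + int_comb n2 (\<lambda>j. c (p2 j)) \<delta>2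
    + int_comb n3 (\<lambda>j. c (p3 j)) \<delta>3"
proof -
  have fin: "finite A1" "finite A2" "finite A3" using bij bij_betw_finite by blast+
  have part: "(\<Sum>k\<in>A. rat_of_int (c k) *\<^sub>q (basis_vec k - r k))
      = int_comb n (\<lambda>j. c (p j)) (\<lambda>j. basis_vec (p j) - f)"
    if "bij_betw p {1..n} A" "\<And>k. k \<in> A \<Longrightarrow> r k = f" for A n p f
  proof -
    have "(\<Sum>k\<in>A. rat_of_int (c k) *\<^sub>q (basis_vec k - r k))
        = (\<Sum>k\<in>A. rat_of_int (c k) *\<^sub>q (basis_vec k - f))"
      using that(2) by (intro sum.cong) auto
    then show ?thesis
      using sum.reindex_bij_betw[OF that(1), of "\<lambda>k. rat_of_int (c k) *\<^sub>q (basis_vec k - f)"]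
      by (simp add: int_comb_def)
  qed
  have "(A1 \<union> A2) \<inter> A3 = {}" using disjoint by blast
  then show ?thesis
    using fin disjoint(1) part[OF bij(1) root(1)] part[OF bij(2) root(2)] part[OF bij(3) root(3)]
    unfolding null_vec_def K_split by (simp add: sum.union_disjoint)
qed

lemma null_coeffs_exist:
  "\<exists>c. (\<forall>j\<in>{1..n1}. c (p1 j) = a1 j) \<and> (\<forall>j\<in>{1..n2}. c (p2 j) = a2 j) \<and>
    (\<forall>j\<in>{1..n3}. c (p3 j) = (a3 j :: int))"
proof -
  define c where "c k = (if k \<in> A1 then a1 (the_inv_into {1..n1} p1 k)
    else if k \<in> A2 then a2 (the_inv_into {1..n2} p2 k) else a3 (the_inv_into {1..n3} p3 k))" for k
  have img: "p1 j \<in> A1" if "j \<in> {1..n1}" for j using bij(1) that by (auto simp: bij_betw_def)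
  have img2: "p2 j \<in> A2" if "j \<in> {1..n2}" for j using bij(2) that by (auto simp: bij_betw_def)
  have img3: "p3 j \<in> A3" if "j \<in> {1..n3}" for j using bij(3) that by (auto simp: bij_betw_def)
  have inv: "the_inv_into {1..n} p (p j) = j" if "bij_betw p {1..n} A" "j \<in> {1..n}" for n p A j
    using that by (auto simp: bij_betw_def the_inv_into_f_f)
  have 1: "c (p1 j) = a1 j" if "j \<in> {1..n1}" for j
    using img[OF that] inv[OF bij(1) that] by (simp only: c_def if_True)
  have 2: "c (p2 j) = a2 j" if "j \<in> {1..n2}" for j
  proof -
    have "p2 j \<notin> A1" using disjoint img2[OF that] by blast
    then show ?thesis using img2[OF that] inv[OF bij(2) that] by (simp only: c_def if_True if_False)
  qed
  have 3: "c (p3 j) = a3 j" if "j \<in> {1..n3}" for j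
  proof -
    have "p3 j \<notin> A1" "p3 j \<notin> A2" using disjoint img3[OF that] by blast+
    then show ?thesis using inv[OF bij(3) that] by (simp only: c_def if_False)
  qed
  from 1 2 3 show ?thesis by blast
qed

lemma null_vecs:
  "{x + null_vec c | x c. x \<in> S \<and> (\<lambda>j. c (p1 j)) \<in> coset_family o1 z1 n1 N1 \<and>
      (\<lambda>j. c (p2 j)) \<in> coset_family o2 z2 n2 N2 \<and> (\<lambda>j. c (p3 j)) \<in> coset_family o3 z3 n3 N3}
   = {x + u + v + w | x u v w. x \<in> S \<and> u \<in> combs \<delta>1 n1 (coset_family o1 z1 n1 N1) \<and>
      v \<in> combs \<delta>2 n2 (coset_family o2 z2 n2 N2) \<and> w \<in> combs \<delta>3 n3 (coset_family o3 z3 n3 N3)}"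
  (is "?L = ?R")
proof (intro equalityI subsetI)
  fix y assume "y \<in> ?L"
  then obtain x c where "x \<in> S" "y = x + null_vec c"
    "(\<lambda>j. c (p1 j)) \<in> coset_family o1 z1 n1 N1" "(\<lambda>j. c (p2 j)) \<in> coset_family o2 z2 n2 N2"
    "(\<lambda>j. c (p3 j)) \<in> coset_family o3 z3 n3 N3" by blast
  then show "y \<in> ?R" unfolding null_vec_split combs_def add.assoc[symmetric] by blast
next
  fix y assume "y \<in> ?R"
  then obtain x a1 a2 a3 where x: "x \<in> S"
    and y: "y = x + int_comb n1 a1 \<delta>1 + int_comb n2 a2 \<delta>2 + int_comb n3 a3 \<delta>3"
    and a: "a1 \<in> coset_family o1 z1 n1 N1" "a2 \<in> coset_family o2 z2 n2 N2"
      "a3 \<in> coset_family o3 z3 n3 N3"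
    unfolding combs_def by blast
  obtain c where c: "\<And>j. j \<in> {1..n1} \<Longrightarrow> c (p1 j) = a1 j" "\<And>j. j \<in> {1..n2} \<Longrightarrow> c (p2 j) = a2 j"
    "\<And>j. j \<in> {1..n3} \<Longrightarrow> c (p3 j) = a3 j" using null_coeffs_exist[of a1 a2 a3] by blast
  have "y = x + null_vec c"
    unfolding y null_vec_split add.assoc[symmetric]
    by (simp only: int_comb_cong[OF c(1)] int_comb_cong[OF c(2)] int_comb_cong[OF c(3)])
  moreover have "(\<lambda>j. c (p1 j)) \<in> coset_family o1 z1 n1 N1"
    "(\<lambda>j. c (p2 j)) \<in> coset_family o2 z2 n2 N2" "(\<lambda>j. c (p3 j)) \<in> coset_family o3 z3 n3 N3"
    using a by (simp_all only: coset_family_cong[OF c(1)] coset_family_cong[OF c(2)]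
      coset_family_cong[OF c(3)])
  ultimately show "y \<in> ?L" using x by blast
qed

text \<open>
The generating unit vectors are supported on the indices mapped to \<open>e\<close>, so all other coefficients
  are simply multiples of their steps.
\<close>

lemma null_coeffs_own:
  "c \<in> null_coeffs e N \<longleftrightarrow>
    (\<forall>k\<in>K. r k \<noteq> e \<longrightarrow> N k dvd c k) \<and>
    (e \<in> simple_roots l \<and> (\<forall>k\<in>K. r k = e \<longrightarrow> N k dvd c k) \<or>
     (\<exists>i\<in>K. r i = e \<and> (\<forall>k\<in>K. r k = e \<longrightarrow> N k dvd c k - (if k = i then 1 else 0))))"
  (is "_ \<longleftrightarrow> ?R")
proof
  assume "c \<in> null_coeffs e N"
  then obtain a where a: "a \<in> base_coeffs e" and dvd: "\<And>k. k \<in> K \<Longrightarrow> N k dvd c k - a k"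
    by (auto simp: null_coeffs_def)
  from a consider "e \<in> simple_roots l" "a = (\<lambda>_. 0)"
    | i where "i \<in> K" "r i = e" "a = (\<lambda>j. if j = i then 1 else 0)"
    unfolding base_coeffs_def by blast
  then show ?R
  proof cases
    case 1 then show ?thesis using dvd by simp
  next
    case 2
    have "N k dvd c k" if "k \<in> K" "r k \<noteq> e" for k using dvd[OF that(1)] 2 that(2) by (auto split: if_splits)
    moreover have "\<forall>k\<in>K. N k dvd c k - (if k = i then 1 else 0)" using dvd 2(3) by blast
    ultimately show ?thesis using 2 by blast
  qed
next
  assume R: ?R
  then consider "e \<in> simple_roots l" "\<forall>k\<in>K. N k dvd c k"
    | i where "i \<in> K" "r i = e" "\<forall>k\<in>K. r k = e \<longrightarrow> N k dvd c k - (if k = i then 1 else 0)"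
    by blast
  then show "c \<in> null_coeffs e N"
  proof cases
    case 1
    then have "(\<lambda>_. 0) \<in> base_coeffs e" by (simp add: base_coeffs_def)
    then show ?thesis unfolding null_coeffs_def using 1 by (intro CollectI bexI) auto
  next
    case 2
    let ?a = "\<lambda>j. if j = i then 1 else 0 :: int"
    have "?a \<in> base_coeffs e" unfolding base_coeffs_def using 2 by blast
    moreover have "N k dvd c k - ?a k" if "k \<in> K" for k
      using R 2 that by (cases "r k = e") auto
    ultimately show ?thesis unfolding null_coeffs_def by (intro CollectI bexI[of _ ?a] ballI)
  qed
qed

text \<open>
Exactly one of the flags \<open>o1\<close>, \<open>o2\<close>, \<open>o3\<close> holds and names the group that is mapped to \<open>e\<close>.  That group
  may be empty.
\<close>

lemma layer_eq:
  assumes own: "{k \<in> K. r k = e} = (if o1 then A1 else if o2 then A2 else A3)"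
    and o: "o1 \<and> \<not> o2 \<and> \<not> o3 \<or> \<not> o1 \<and> o2 \<and> \<not> o3 \<or> \<not> o1 \<and> \<not> o2 \<and> o3"
    and N: "\<And>k. k \<in> A1 \<Longrightarrow> N k = N1" "\<And>k. k \<in> A2 \<Longrightarrow> N k = N2" "\<And>k. k \<in> A3 \<Longrightarrow> N k = N3"
    and z: "z \<longleftrightarrow> e \<in> simple_roots l"
  shows "layer e N = {x + u + v + w | x u v w. x \<in> orbit F0 l e \<and>
      u \<in> combs \<delta>1 n1 (coset_family o1 z n1 N1) \<and>
      v \<in> combs \<delta>2 n2 (coset_family o2 z n2 N2) \<and> w \<in> combs \<delta>3 n3 (coset_family o3 z n3 N3)}"
proof -
  have own': "k \<in> K \<and> r k = e \<longleftrightarrow> k \<in> (if o1 then A1 else if o2 then A2 else A3)" for k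
    using own by blast
  have coeffs: "c \<in> null_coeffs e N \<longleftrightarrow> (\<lambda>j. c (p1 j)) \<in> coset_family o1 z n1 N1 \<and>
      (\<lambda>j. c (p2 j)) \<in> coset_family o2 z n2 N2 \<and> (\<lambda>j. c (p3 j)) \<in> coset_family o3 z n3 N3" for c
  proof -
    define B where "B = (if o1 then A1 else if o2 then A2 else A3)"
    have "c \<in> null_coeffs e N \<longleftrightarrow> (\<forall>k\<in>K - B. N k dvd c k) \<and>
      (z \<and> (\<forall>k\<in>B. N k dvd c k) \<or> (\<exists>i\<in>B. \<forall>k\<in>B. N k dvd c k - (if k = i then 1 else 0)))"
      unfolding null_coeffs_own z using own' unfolding B_def[symmetric] by blast
    moreover have "K - B = (if o1 then A2 \<union> A3 else if o2 then A1 \<union> A3 else A1 \<union> A2)"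
      using disjoint unfolding B_def K_split by auto
    ultimately show ?thesis
      using o N unfolding B_def bij_betw_coset_family[OF bij(1)] bij_betw_coset_family[OF bij(2)]
        bij_betw_coset_family[OF bij(3)]
      by (elim disjE conjE) (simp_all add: ball_Un, blast+)
  qed
  show ?thesis unfolding layer_def coeffs null_vecs[symmetric] by blast
qed

end

section \<open>Squared lengths and the radical\<close>

lemma basis_vec_eq_iff [simp]: "basis_vec i = basis_vec j \<longleftrightarrow> i = j"
  by (metis basis_vec_apply one_neq_zero)

lemma double_basis_vec_neq [simp]: "2 *\<^sub>q basis_vec i \<noteq> basis_vec j" "basis_vec j \<noteq> 2 *\<^sub>q basis_vec i"
proof -
  show "2 *\<^sub>q basis_vec i \<noteq> basis_vec j"
  proof
    assume "2 *\<^sub>q basis_vec i = basis_vec j"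
    from fun_cong[OF this, of j] show False
      by (simp add: scale_apply basis_vec_apply split: if_splits)
  qed
  then show "basis_vec j \<noteq> 2 *\<^sub>q basis_vec i" by metis
qed

text \<open>
The standing hypotheses: every added root is one of \<open>\<alpha>\<^sub>1\<close>, \<open>\<alpha>\<^sub>l\<close>, \<open>2\<alpha>\<^sub>l\<close>.
\<close>

locale labelled_affinization =
  fixes X :: cartan_letter
    and l d b s t :: nat
    and C A :: "nat \<Rightarrow> nat \<Rightarrow> int"
    and G :: "nat \<Rightarrow> nat \<Rightarrow> rat"
    and r :: "nat \<Rightarrow> vec"
    and long_idx short_idx double_idx :: "nat \<Rightarrow> nat"
  assumes cartan: "is_cartan_matrix X l C"
    and form: "induced_gram l C G"
    and affinization: "standard_affinization l d G r A"
    and type: "affinization_type l d G r = (b, s, t)"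
    and long: "\<forall>k\<in>added_long l d G r. r k = basis_vec 1"
    and short: "\<forall>k\<in>added_short l d G r. r k = basis_vec l"
    and double: "\<forall>k\<in>added_double l d r. r k = 2 *\<^sub>q basis_vec l"
    and long_idx: "bij_betw long_idx {1..b} (added_long l d G r)"
    and short_idx: "bij_betw short_idx {1..s} (added_short l d G r)"
    and double_idx: "bij_betw double_idx {1..t} (added_double l d r)"
begin

sublocale affinization l d C G r
proof
  show "induced_gram l C G" by (rule form)
  show "r k = basis_vec k" if "k \<in> {1..l}" for k
    using affinization that unfolding standard_affinization_def by blast
  show "r k \<in> simple_roots l \<union> (*\<^sub>q) 2 ` simple_roots l" if "k \<in> {l+1..l+d}" for k
    using affinization that unfolding standard_affinization_def by blast
qed

abbreviation R where "R \<equiv> weyl_roots F0 l"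
abbreviation \<alpha>1 where "\<alpha>1 \<equiv> basis_vec 1"
abbreviation \<alpha>l where "\<alpha>l \<equiv> basis_vec l"
abbreviation \<beta>l where "\<beta>l \<equiv> 2 *\<^sub>q basis_vec l"
abbreviation AL where "AL \<equiv> added_long l d G r"
abbreviation AS where "AS \<equiv> added_short l d G r"
abbreviation AD where "AD \<equiv> added_double l d r"

lemma rank_pos: "1 \<le> l"
  using cartan by (cases X) (auto simp: is_cartan_matrix_def)

lemma ends: "1 \<in> {1..l}" "l \<in> {1..l}"
  using rank_pos by auto

lemma ends_coord: "\<alpha>1 \<in> coord_space l" "\<alpha>l \<in> coord_space l" "\<beta>l \<in> coord_space l"
  using coord_space_closed(3) coord_space_closed(4)[OF ends(1)] coord_space_closed(4)[OF ends(2)]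
  by blast+

lemma ends_simple: "\<alpha>1 \<in> simple_roots l" "\<alpha>l \<in> simple_roots l" "\<beta>l \<notin> simple_roots l"
  using ends by (auto simp: simple_roots_def)

lemma cartan_entry: "i \<in> {1..l} \<Longrightarrow> j \<in> {1..l} \<Longrightarrow> C i j = cartan_matrix X l i j"
  using cartan by (simp add: is_cartan_matrix_def)

lemma simple_in_R: "x \<in> simple_roots l \<Longrightarrow> x \<in> R"
  using finite.basis_in_weyl_roots by (auto simp: simple_roots_def)

sublocale split_affinization l d C G r AL AS AD \<alpha>1 \<alpha>l \<beta>l long_idx short_idx double_idx b s t
proof
  show "{l+1..l+d} = AL \<union> AS \<union> AD"
  proof (intro equalityI subsetI)
    fix k assume k: "k \<in> {l+1..l+d}"
    then show "k \<in> AL \<union> AS \<union> AD"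
      using added[OF k] simple_in_R
      unfolding added_long_def added_short_def added_double_def short_roots_def by blast
  qed (auto simp: added_long_def added_short_def added_double_def)
  show "AL \<inter> AS = {}" unfolding added_long_def added_short_def short_roots_def by blast
  show "AL \<inter> AD = {}" "AS \<inter> AD = {}"
    by (auto simp: added_long_def added_short_def added_double_def simple_roots_def)
qed (use long short double long_idx short_idx double_idx in auto)

lemma empty_double: "t = 0 \<Longrightarrow> AD = {}"
  using double_idx by (auto simp: bij_betw_def)

lemma empty_short: "s = 0 \<Longrightarrow> AS = {}"
  using short_idx by (auto simp: bij_betw_def)

lemma added_root: "k \<in> K \<Longrightarrow> r k \<in> {\<alpha>1, \<alpha>l, \<beta>l}"
  using K_split root by blast

text \<open>
Here the divisibility of the pairings on a whole orbit is reduced to finitely many conditions on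
  the entries of \<open>C\<close>.  The factor 2 for \<open>2\<alpha>\<^sub>l\<close> arises since \<open>(2\<alpha>\<^sub>l)\<^sup>\<or> = \<alpha>\<^sub>l\<^sup>\<or> / 2\<close>.
\<close>

lemma layers_graded:
  assumes E: "E \<subseteq> {\<alpha>1, \<alpha>l, \<beta>l}"
    and covers: "\<And>i. i \<in> {1..l} \<Longrightarrow> \<exists>e\<in>E \<inter> simple_roots l. basis_vec i \<in> orbit F0 l e"
    and added_in: "\<And>k. k \<in> K \<Longrightarrow> r k \<in> E"
    and graded: "\<And>e. e \<in> E \<Longrightarrow> graded (D e) e"
    and stable: "\<And>e i j. e \<in> E \<Longrightarrow> i \<in> {1..l} \<Longrightarrow> j \<in> {1..l} \<Longrightarrow> D e i dvd C i j * D e j"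
    and simple_dvd: "\<And>e i j. e \<in> E \<Longrightarrow> basis_vec i \<in> E \<Longrightarrow> i \<in> {1..l} \<Longrightarrow> j \<in> {1..l} \<Longrightarrow>
      N e (basis_vec i) dvd C i j * D e j"
    and double_dvd: "\<And>e j. e \<in> E \<Longrightarrow> \<beta>l \<in> E \<Longrightarrow> j \<in> {1..l} \<Longrightarrow> 2 * N e \<beta>l dvd C l j * D e j"
    and steps: "\<And>e f. e \<in> E \<Longrightarrow> f \<in> E \<Longrightarrow> \<exists>x\<in>orbit F0 l e. \<exists>\<beta>\<in>orbit F0 l f.
      coroot_pairing \<beta> x \<in> {rat_of_int (N e f), - rat_of_int (N e f)}"
  shows "RW = (\<Union>e\<in>E. layer e (\<lambda>k. N e (r k)))"
proof (rule weyl_roots_layers)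
  show "E \<subseteq> coord_space l" using E ends_coord by blast
  fix e x k assume e: "e \<in> E" and x: "x \<in> orbit F0 l e" and k: "k \<in> K"
  have k': "k \<in> {1..l + d}" using k by auto
  have x_graded: "graded (D e) x" by (rule graded_orbit[OF graded[OF e] stable[OF e] x])
  from k' show "\<exists>z. coroot_pairing (r k) x = rat_of_int (N e (r k) * z)"
  proof (cases rule: added_cases)
    case (1 i)
    then show ?thesis
      using coroot_pairing_divisible[OF x_graded 1(1) simple_dvd[OF e _ 1(1)]] added_in[OF k] by simp
  next
    case (2 i)
    then have i: "r k = \<beta>l" using added_root[OF k] by fastforce
    then obtain z where "coroot_pairing \<alpha>l x = rat_of_int (2 * N e \<beta>l * z)"
      using coroot_pairing_divisible[OF x_graded ends(2) double_dvd[OF e]] added_in[OF k] by metis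
    then show ?thesis unfolding i coroot_pairing_scale_left by (intro exI[of _ z]) simp
  qed
qed (use covers added_in steps in blast)+

lemma steps_simple:
  assumes "i \<in> {1..l}" "j \<in> {1..l}" "basis_vec i \<in> orbit F0 l f" "basis_vec j \<in> orbit F0 l e"
    "C i j = n \<or> C i j = - n"
  shows "\<exists>x\<in>orbit F0 l e. \<exists>\<beta>\<in>orbit F0 l f. coroot_pairing \<beta> x \<in> {rat_of_int n, - rat_of_int n}"
  using assms coroot_pairing_basis[OF assms(1,2)] by (intro bexI) auto

text \<open>
All vectors of a layer have the squared length of its representative.
\<close>

lemma layer_length:
  assumes RW: "RW = (\<Union>e\<in>E. layer e (N e))" and E: "E \<subseteq> {\<alpha>1, \<alpha>l, \<beta>l}"
    and e: "e \<in> E" and inj: "inj_on (\<lambda>e. F0 e e) E"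
    and S: "S \<noteq> {}" "\<And>y. y \<in> S \<Longrightarrow> y \<in> coord_space l \<and> F0 y y = F0 e e"
  shows "same_length F RW S = layer e (N e)"
proof -
  have norm: "F y y = F0 e' e'" if "e' \<in> E" "y \<in> layer e' (N e')" for e' y
    using layer_norm[OF _ that(2)] that(1) E ends_coord by blast
  have "F y y = F0 e e" if "y \<in> S" for y using S(2)[OF that] affine_form_finite by simp
  then have "same_length F RW S = {y \<in> RW. F y y = F0 e e}"
    using S(1) unfolding same_length_def by auto
  also have "\<dots> = layer e (N e)"
  proof (intro equalityI subsetI)
    fix y assume "y \<in> {y \<in> RW. F y y = F0 e e}"
    then obtain e' where e': "e' \<in> E" "y \<in> layer e' (N e')" and "F y y = F0 e e"
      unfolding RW by blast
    then have "F0 e' e' = F0 e e" using norm by metis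
    then have "e' = e" using inj_onD[OF inj _ e'(1) e] by blast
    then show "y \<in> layer e (N e)" using e'(2) by simp
  next
    fix y assume "y \<in> layer e (N e)"
    then show "y \<in> {y \<in> RW. F y y = F0 e e}" using norm[OF e] e unfolding RW by blast
  qed
  finally show ?thesis .
qed

text \<open>
Subtracting from \<open>\<gamma>\<close> the null vector with the same added coefficients leaves its finite part \<open>y\<close>, which is
  orthogonal to all simple roots and hence zero.
\<close>

lemma radical_eq:
  assumes nondegenerate: "\<And>y j. (\<And>i. i \<in> {1..l} \<Longrightarrow> (\<Sum>j=1..l. rat_of_int (C i j) * y j) = 0) \<Longrightarrow>
    j \<in> {1..l} \<Longrightarrow> y j = 0"
  shows "radical F (l + d) = range null_vec"
proof (intro equalityI subsetI)
  fix \<gamma> assume "\<gamma> \<in> radical F (l + d)"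
  then obtain c where c: "\<gamma> = (\<Sum>k=1..l+d. rat_of_int (c k) *\<^sub>q basis_vec k)"
    and rad: "\<And>x. x \<in> coord_space (l + d) \<Longrightarrow> F \<gamma> x = 0"
    unfolding radical_def int_span_def by blast
  define y where "y = (\<Sum>k=1..l+d. rat_of_int (c k) *\<^sub>q r k)"
  have split: "{1..l+d} = {1..l} \<union> K" "{1..l} \<inter> K = {}" by auto
  have y_span: "y \<in> coord_space l"
  proof -
    have "y i = 0" if i: "i \<notin> {1..l}" for i
    proof -
      have "r k i = 0" if "k \<in> {1..l+d}" for k
        using root_in_coord_space[OF that] i unfolding coord_space_def by blast
      then show ?thesis by (simp add: y_def sum_vec_apply scale_apply)
    qed
    then show ?thesis by (simp add: coord_space_def)
  qed
  have \<gamma>: "\<gamma> = y + null_vec c"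
  proof -
    have "null_vec c = (\<Sum>k=1..l+d. rat_of_int (c k) *\<^sub>q (basis_vec k - r k))"
      unfolding null_vec_def split(1)
      by (subst sum.union_disjoint) (use split(2) simple in auto)
    then show ?thesis
      by (simp add: c y_def vec.scale_right_diff_distrib sum_subtractf)
  qed
  have "(\<Sum>j=1..l. rat_of_int (C i j) * y j) = 0" if i: "i \<in> {1..l}" for i
  proof -
    have bi: "basis_vec i \<in> coord_space l" "basis_vec i \<in> coord_space (l + d)"
      using i by (auto intro: coord_space_closed)
    have "F0 y (basis_vec i) = 0"
      using rad[OF bi(2)] affine_form_shift[OF y_span bi(1), of c "\<lambda>_. 0"]
      by (simp add: \<gamma> null_vec_zero)
    then show ?thesis
      unfolding coroot_pairing_simple[OF i, symmetric] coroot_pairing_def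
      by (simp add: finite.commute)
  qed
  then have "y j = 0" if "j \<in> {1..l}" for j using nondegenerate that by blast
  then have "y = 0" using y_span by (auto simp: coord_space_def fun_eq_iff)
  then show "\<gamma> \<in> range null_vec" using \<gamma> by simp
next
  fix \<gamma> assume "\<gamma> \<in> range null_vec"
  then obtain c where c: "\<gamma> = null_vec c" by blast
  \<comment> \<open>The coordinates of the vectors \<open>r j\<close> are integers, so the floor does not change them.\<close>
  define a where "a k = (if k \<in> K then c k else - (\<Sum>j\<in>K. c j * \<lfloor>r j k\<rfloor>))" for k
  have "\<gamma> = (\<Sum>k=1..l+d. rat_of_int (a k) *\<^sub>q basis_vec k)"
  proof
    fix i
    have "(\<Sum>k=1..l+d. rat_of_int (a k) *\<^sub>q basis_vec k) i
        = (\<Sum>k=1..l+d. if k = i then rat_of_int (a i) else 0)"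
      unfolding sum_vec_apply by (intro sum.cong) (auto simp: scale_apply basis_vec_apply)
    also have "\<dots> = (if i \<in> {1..l+d} then rat_of_int (a i) else 0)" by simp
    also have "\<dots> = \<gamma> i"
    proof -
      have \<gamma>i: "\<gamma> i = (\<Sum>k\<in>K. if k = i then rat_of_int (c i) else 0) - (\<Sum>k\<in>K. rat_of_int (c k) * r k i)"
        unfolding c null_vec_def sum_vec_apply sum_subtractf[symmetric]
        by (intro sum.cong) (auto simp: scale_apply basis_vec_apply algebra_simps)
      have zero: "r k i = 0" if "k \<in> K" "i \<notin> {1..l}" for k
      proof -
        have "r k \<in> coord_space l" using that(1) by (intro root_in_coord_space) auto
        then show ?thesis using that(2) unfolding coord_space_def by blast
      qed
      have int: "rat_of_int \<lfloor>r k i\<rfloor> = r k i" if "k \<in> K" for k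
        using added[OF that] by (auto simp: simple_roots_def basis_vec_apply scale_apply)
      show ?thesis
      proof (cases "i \<in> {1..l}")
        case True
        then show ?thesis by (simp add: \<gamma>i a_def int)
      next
        case False
        then show ?thesis using zero by (auto simp: \<gamma>i a_def)
      qed
    qed
    finally show "\<gamma> i = (\<Sum>k=1..l+d. rat_of_int (a k) *\<^sub>q basis_vec k) i" by simp
  qed
  moreover have "F \<gamma> x = 0" for x
    unfolding affine_form_def c root_map_null_vec
    using finite.scale_left[of 0 0] by simp
  ultimately show "\<gamma> \<in> radical F (l + d)" unfolding radical_def int_span_def by blast
qed

text \<open>
What the types \<open>B\<close>, \<open>C\<close>, \<open>F\<close>, \<open>G\<close> have in common: \<open>Sh\<close> consists of the indices of the short simple roots,
  simple roots of equal length are conjugate, and \<open>q\<close> is the ratio of the squared lengths.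
\<close>

definition two_lengths :: "int \<Rightarrow> nat set \<Rightarrow> bool"
  where "two_lengths q Sh \<longleftrightarrow> q \<ge> 2 \<and> Sh \<subseteq> {1..l} \<and> 1 \<notin> Sh \<and> l \<in> Sh \<and>
    (\<forall>i\<in>{1..l}. basis_vec i \<in> orbit F0 l (if i \<in> Sh then \<alpha>l else \<alpha>1)) \<and>
    (\<forall>i\<in>Sh. \<forall>j\<in>{1..l} - Sh. q dvd C i j) \<and>
    (\<exists>i\<in>Sh. \<exists>j\<in>{1..l} - Sh. C i j = - q \<and> C j i = - 1)"

context
  fixes q Sh
  assumes two: "two_lengths q Sh"
begin

lemma two_lengths_orbit:
  assumes "i \<in> {1..l}"
  shows "i \<in> Sh \<Longrightarrow> basis_vec i \<in> orbit F0 l \<alpha>l" "i \<notin> Sh \<Longrightarrow> basis_vec i \<in> orbit F0 l \<alpha>1"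
proof -
  have "basis_vec i \<in> orbit F0 l (if i \<in> Sh then \<alpha>l else \<alpha>1)"
    using two assms unfolding two_lengths_def by blast
  then show "i \<in> Sh \<Longrightarrow> basis_vec i \<in> orbit F0 l \<alpha>l" "i \<notin> Sh \<Longrightarrow> basis_vec i \<in> orbit F0 l \<alpha>1"
    by (simp_all only: if_True if_False)
qed

lemma two_lengths_bond:
  obtains i j where "i \<in> {1..l}" "basis_vec i \<in> orbit F0 l \<alpha>l"
    "j \<in> {1..l}" "basis_vec j \<in> orbit F0 l \<alpha>1" "C i j = - q" "C j i = - 1"
proof -
  obtain i j where ij: "i \<in> Sh" "j \<in> {1..l}" "j \<notin> Sh" "C i j = - q" "C j i = - 1"
    using two unfolding two_lengths_def by blast
  have i: "i \<in> {1..l}" using two ij(1) unfolding two_lengths_def by blast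
  show ?thesis
    using that[OF i two_lengths_orbit(1)[OF i ij(1)] ij(2) two_lengths_orbit(2)[OF ij(2,3)] ij(4,5)] .
qed

lemma two_lengths_norm: "F0 \<alpha>1 \<alpha>1 = rat_of_int q * F0 \<alpha>l \<alpha>l" "F0 \<alpha>l \<alpha>l > 0" "F0 \<alpha>l \<alpha>l < F0 \<alpha>1 \<alpha>1"
proof -
  obtain i j where i: "i \<in> {1..l}" "basis_vec i \<in> orbit F0 l \<alpha>l"
    and j: "j \<in> {1..l}" "basis_vec j \<in> orbit F0 l \<alpha>1" and ij: "C i j = - q" "C j i = - 1"
    by (rule two_lengths_bond)
  have "rat_of_int q * G i i = G j j"
    using gram_cartan[OF i(1) j(1)] gram_cartan[OF j(1) i(1)] gram_symmetric[OF i(1) j(1)] ij by simp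
  then show "F0 \<alpha>1 \<alpha>1 = rat_of_int q * F0 \<alpha>l \<alpha>l"
    using finite.orbit_norm[OF i(2)] finite.orbit_norm[OF j(2)]
      gram_form_basis[OF i(1) i(1)] gram_form_basis[OF j(1) j(1)] by simp
  moreover show pos: "F0 \<alpha>l \<alpha>l > 0"
    using gram_positive[OF ends(2)] gram_form_basis[OF ends(2) ends(2)] by simp
  moreover have "rat_of_int q > 1" using two unfolding two_lengths_def by simp
  ultimately show "F0 \<alpha>l \<alpha>l < F0 \<alpha>1 \<alpha>1" by simp
qed

lemma two_lengths_roots: "R = orbit F0 l \<alpha>1 \<union> orbit F0 l \<alpha>l"
proof
  have "basis_vec i \<in> orbit F0 l \<alpha>1 \<union> orbit F0 l \<alpha>l" if "i \<in> {1..l}" for i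
    using two that unfolding two_lengths_def by (auto split: if_splits)
  then show "R \<subseteq> orbit F0 l \<alpha>1 \<union> orbit F0 l \<alpha>l"
    unfolding weyl_roots_finite using orbit_trans by blast
  show "orbit F0 l \<alpha>1 \<union> orbit F0 l \<alpha>l \<subseteq> R"
    unfolding weyl_roots_finite using ends by blast
qed

text \<open>
The form is constant on orbits, so the two orbits are separated by length.
\<close>

lemma two_lengths_long: "long_roots F0 R = orbit F0 l \<alpha>1"
  and two_lengths_short: "short_roots F0 R = orbit F0 l \<alpha>l"
proof -
  have 1: "F0 x x = F0 \<alpha>1 \<alpha>1" if "x \<in> orbit F0 l \<alpha>1" for x by (rule finite.orbit_norm[OF that])
  have 2: "F0 x x = F0 \<alpha>l \<alpha>l" if "x \<in> orbit F0 l \<alpha>l" for x by (rule finite.orbit_norm[OF that])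
  show long: "long_roots F0 R = orbit F0 l \<alpha>1"
  proof (intro equalityI subsetI)
    fix x assume "x \<in> long_roots F0 R"
    then have "x \<in> R" "F0 \<alpha>1 \<alpha>1 \<le> F0 x x"
      using simple_in_R[OF ends_simple(1)] unfolding long_roots_def by blast+
    then show "x \<in> orbit F0 l \<alpha>1"
      using 2 two_lengths_norm(3) unfolding two_lengths_roots by fastforce
  next
    fix x assume x: "x \<in> orbit F0 l \<alpha>1"
    have "F0 y y \<le> F0 x x" if "y \<in> R" for y
      using that 1 2 x two_lengths_norm(3) unfolding two_lengths_roots by fastforce
    then show "x \<in> long_roots F0 R"
      using x unfolding long_roots_def two_lengths_roots by blast
  qed
  have "orbit F0 l \<alpha>1 \<inter> orbit F0 l \<alpha>l = {}" using 1 2 two_lengths_norm(3) by fastforce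
  then show "short_roots F0 R = orbit F0 l \<alpha>l"
    unfolding short_roots_def long by (subst two_lengths_roots) blast
qed

lemma two_lengths_ends: "\<alpha>1 \<noteq> \<alpha>l"
  using two_lengths_norm(3) by auto

lemma two_lengths_steps:
  "\<exists>x\<in>orbit F0 l \<alpha>1. \<exists>\<beta>\<in>orbit F0 l \<alpha>l. coroot_pairing \<beta> x \<in> {rat_of_int q, - rat_of_int q}"
  "\<exists>x\<in>orbit F0 l \<alpha>l. \<exists>\<beta>\<in>orbit F0 l \<alpha>1. coroot_pairing \<beta> x \<in> {rat_of_int 1, - rat_of_int 1}"
proof -
  obtain i j where i: "i \<in> {1..l}" "basis_vec i \<in> orbit F0 l \<alpha>l"
    and j: "j \<in> {1..l}" "basis_vec j \<in> orbit F0 l \<alpha>1" and ij: "C i j = - q" "C j i = - 1"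
    by (rule two_lengths_bond)
  show "\<exists>x\<in>orbit F0 l \<alpha>1. \<exists>\<beta>\<in>orbit F0 l \<alpha>l. coroot_pairing \<beta> x \<in> {rat_of_int q, - rat_of_int q}"
    by (rule steps_simple[OF i(1) j(1) i(2) j(2) disjI2[OF ij(1)]])
  show "\<exists>x\<in>orbit F0 l \<alpha>l. \<exists>\<beta>\<in>orbit F0 l \<alpha>1. coroot_pairing \<beta> x \<in> {rat_of_int 1, - rat_of_int 1}"
    by (rule steps_simple[OF j(1) i(1) j(2) i(2) disjI2[OF ij(2)]])
qed

text \<open>
A long root has coefficients divisible by \<open>q\<close> at the short simple roots: the lattice spanned by the
  long simple roots and \<open>q\<close> times the short ones is stable under the Weyl group.
\<close>

definition long_grading :: "nat \<Rightarrow> int"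
  where "long_grading j = (if j \<in> Sh then q else 1)"

lemma long_graded: "graded long_grading \<alpha>1"
  using two by (intro graded_basis_1) (simp add: two_lengths_def long_grading_def)

lemma long_grading_stable:
  "i \<in> {1..l} \<Longrightarrow> j \<in> {1..l} \<Longrightarrow> long_grading i dvd C i j * long_grading j"
  using two by (auto simp: long_grading_def two_lengths_def)

end

end

section \<open>Nondegeneracy of the Cartan matrices\<close>

text \<open>
A row of the Cartan matrix at an inner node of a chain of single bonds says that the second
  difference of the coordinates vanishes there.
\<close>

lemma arithmetic_progression:
  fixes z :: "nat \<Rightarrow> rat"
  assumes "z 0 = 0" and "\<And>i. 1 \<le> i \<Longrightarrow> i < m \<Longrightarrow> z (i + 1) = 2 * z i - z (i - 1)"
  shows "i \<le> m \<Longrightarrow> z i = of_nat i * z 1"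
proof (induction i rule: less_induct)
  case (less i)
  show ?case
  proof (cases "i \<le> 1")
    case True
    then have "i = 0 \<or> i = 1" by auto
    then show ?thesis using assms(1) by auto
  next
    case False
    then obtain k where k: "i = k + 2" by (metis add.commute le_add_diff_inverse less_eq_Suc_le not_less Suc_1 Suc_eq_plus1 one_add_one)
    have "z (k + 2) = 2 * z (k + 1) - z k" using assms(2)[of "k + 1"] less.prems k by simp
    then show ?thesis using less.IH[of "k + 1"] less.IH[of k] less.prems k by (simp add: algebra_simps)
  qed
qed

lemma sum_neighbours:
  fixes f :: "nat \<Rightarrow> rat"
  assumes "1 \<le> i"
  shows "(\<Sum>j\<in>{i - 1, i, i + 1}. f j) = f (i - 1) + f i + f (i + 1)"
  using assms by (cases i) (simp_all add: add.assoc)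

context labelled_affinization
begin

lemma valid: "valid_rank X l"
  using cartan by (simp add: is_cartan_matrix_def)

text \<open>
Rows of a Cartan matrix are sparse.
\<close>

lemma row_sum:
  assumes "S \<subseteq> {1..l}" "i \<in> {1..l}" "\<And>j. j \<in> {1..l} - S \<Longrightarrow> cartan_matrix X l i j = 0"
  shows "(\<Sum>j=1..l. rat_of_int (C i j) * y j) = (\<Sum>j\<in>S. rat_of_int (cartan_matrix X l i j) * y j)"
proof -
  have "(\<Sum>j=1..l. rat_of_int (C i j) * y j) = (\<Sum>j=1..l. rat_of_int (cartan_matrix X l i j) * y j)"
    using assms(2) by (intro sum.cong) (simp_all only: cartan_entry)
  also have "\<dots> = (\<Sum>j\<in>S. rat_of_int (cartan_matrix X l i j) * y j)"
    using assms(1,3) by (intro sum.mono_neutral_right) auto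
  finally show ?thesis .
qed

text \<open>
With the convention \<open>y\<^sub>0 = y\<^sub>l\<^sub>+\<^sub>1 = 0\<close> the rows at the two ends have the form of inner rows.  So \<open>y\<close> is an
  arithmetic progression that vanishes at \<open>0\<close> and at \<open>l + 1\<close>.
\<close>

lemma nondegenerate_A:
  assumes X: "X = TypeA" and rows: "\<And>i. i \<in> {1..l} \<Longrightarrow> (\<Sum>j=1..l. rat_of_int (C i j) * y j) = 0"
    and j: "j \<in> {1..l}"
  shows "y j = 0"
proof -
  define z where "z i = (if i \<in> {1..l} then y i else 0)" for i
  have row: "z (i + 1) = 2 * z i - z (i - 1)" if "1 \<le> i" "i < l + 1" for i
  proof -
    have i: "i \<in> {1..l}" using that by simp
    have "(\<Sum>j=1..l. rat_of_int (C i j) * y j)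
        = (\<Sum>j\<in>{i - 1, i, i + 1} \<inter> {1..l}. rat_of_int (cartan_matrix X l i j) * y j)"
      using i by (intro row_sum) (auto simp: cartan_matrix_def X min_def max_def)
    also have "\<dots> = (\<Sum>j\<in>{i - 1, i, i + 1}. if j \<in> {1..l} then rat_of_int (cartan_matrix X l i j) * y j else 0)"
      by (rule sum.inter_restrict) simp
    also have "\<dots> = 2 * z i - z (i - 1) - z (i + 1)"
      using that by (subst sum_neighbours) (auto simp: z_def cartan_matrix_def X min_def max_def)
    finally show ?thesis using rows[OF i] by simp
  qed
  have ap: "z i = of_nat i * z 1" if "i \<le> l + 1" for i
    by (rule arithmetic_progression[of z "l + 1", OF _ row that]) (simp_all add: z_def)
  have "of_nat (l + 1) * z 1 = 0" using ap[of "l + 1"] by (simp add: z_def)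
  then have "z 1 = 0" by (metis mult_eq_0_iff of_nat_eq_0_iff Suc_eq_plus1 nat.distinct(1))
  then have "z j = 0" using ap[of j] j by simp
  then show ?thesis using j by (simp add: z_def)
qed

text \<open>
Along the chain up to the branching node \<open>y\<close> is a progression \<open>y\<^sub>i = i y\<^sub>1\<close>.  Both end nodes carry half the
  value of the branching node \<open>l - 2\<close>, so its row gives \<open>y\<^sub>l\<^sub>-\<^sub>2 = y\<^sub>l\<^sub>-\<^sub>3\<close> and the progression is zero.
\<close>

lemma nondegenerate_D:
  assumes X: "X = TypeD" and rows: "\<And>i. i \<in> {1..l} \<Longrightarrow> (\<Sum>j=1..l. rat_of_int (C i j) * y j) = 0"
    and j: "j \<in> {1..l}"
  shows "y j = 0"
proof -
  have l: "4 \<le> l" using valid by (simp add: X)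
  then obtain m where m: "l = m + 4" by (metis add.commute le_iff_add)
  define z where "z i = (if i = 0 then 0 else y i)" for i
  have row: "z (i + 1) = 2 * z i - z (i - 1)" if "1 \<le> i" "i < m + 2" for i
  proof -
    have i: "i \<in> {1..l}" using that m by simp
    have "(\<Sum>j=1..l. rat_of_int (C i j) * y j)
        = (\<Sum>j\<in>{i - 1, i, i + 1} \<inter> {1..l}. rat_of_int (cartan_matrix X l i j) * y j)"
      using i that m by (intro row_sum) (auto simp: cartan_matrix_def X min_def max_def)
    also have "\<dots> = (\<Sum>j\<in>{i - 1, i, i + 1}. if j \<in> {1..l} then rat_of_int (cartan_matrix X l i j) * y j else 0)"
      by (rule sum.inter_restrict) simp
    also have "\<dots> = 2 * z i - z (i - 1) - z (i + 1)"
      using that m by (subst sum_neighbours) (auto simp: z_def cartan_matrix_def X min_def max_def)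
    finally show ?thesis using rows[OF i] by simp
  qed
  have ap: "z i = of_nat i * z 1" if "i \<le> m + 2" for i
    by (rule arithmetic_progression[of z "m + 2", OF _ row that]) (simp_all add: z_def)
  have "(\<Sum>j=1..l. rat_of_int (C (m+2) j) * y j)
      = (\<Sum>j\<in>{m+1, m+2, m+3, m+4}. rat_of_int (cartan_matrix X l (m+2) j) * y j)"
    using m by (intro row_sum) (auto simp: cartan_matrix_def X min_def max_def)
  then have r2: "2 * y (m+2) = y (m+1) + y (m+3) + y (m+4)"
    using rows[of "m+2"] m by (simp add: cartan_matrix_def X min_def max_def)
  have "(\<Sum>j=1..l. rat_of_int (C (m+3) j) * y j)
      = (\<Sum>j\<in>{m+2, m+3}. rat_of_int (cartan_matrix X l (m+3) j) * y j)"
    using m by (intro row_sum) (auto simp: cartan_matrix_def X min_def max_def)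
  then have r3: "2 * y (m+3) = y (m+2)"
    using rows[of "m+3"] m by (simp add: cartan_matrix_def X min_def max_def)
  have "(\<Sum>j=1..l. rat_of_int (C (m+4) j) * y j)
      = (\<Sum>j\<in>{m+2, m+4}. rat_of_int (cartan_matrix X l (m+4) j) * y j)"
    using m by (intro row_sum) (auto simp: cartan_matrix_def X min_def max_def)
  then have r4: "2 * y (m+4) = y (m+2)"
    using rows[of "m+4"] m by (simp add: cartan_matrix_def X min_def max_def)
  have a1: "y (m+1) = of_nat (m + 1) * y 1" using ap[of "m+1"] by (simp add: z_def)
  have a2: "y (m+2) = of_nat (m + 2) * y 1" using ap[of "m+2"] by (simp add: z_def)
  have "y (m+2) = y (m+1)" using r2 r3 r4 by linarith
  then have "y 1 = 0" using a1 a2 by (simp add: algebra_simps)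
  then have small: "y i = 0" if "1 \<le> i" "i \<le> m + 2" for i using ap[OF that(2)] that by (simp add: z_def)
  then have "y (m+2) = 0" by simp
  then have "y (m+3) = 0" "y (m+4) = 0" using r3 r4 by simp_all
  moreover have "j \<le> m + 2 \<or> j = m + 3 \<or> j = m + 4" using j m by auto
  ultimately show ?thesis using small j by auto
qed

text \<open>
The progression starts at the short end \<open>l\<close>, so the numbering is reversed.  The first two rows
  give \<open>y\<^sub>2 = 2 y\<^sub>1 = 2 y\<^sub>2 - y\<^sub>3\<close>, hence \<open>y\<^sub>2 = y\<^sub>3\<close>, and the progression is zero.
\<close>

lemma nondegenerate_C:
  assumes X: "X = TypeC" and rows: "\<And>i. i \<in> {1..l} \<Longrightarrow> (\<Sum>j=1..l. rat_of_int (C i j) * y j) = 0"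
    and j: "j \<in> {1..l}"
  shows "y j = 0"
proof -
  have l: "3 \<le> l" using valid by (simp add: X)
  then obtain m where m: "l = m + 3" by (metis add.commute le_iff_add)
  define z where "z k = (if k = 0 then 0 else y (l + 1 - k))" for k
  have row: "z (k + 1) = 2 * z k - z (k - 1)" if k: "1 \<le> k" "k < m + 2" for k
  proof -
    define i where "i = l + 1 - k"
    have i: "i \<in> {1..l}" "3 \<le> i" using k m by (auto simp: i_def)
    have "(\<Sum>j=1..l. rat_of_int (C i j) * y j)
        = (\<Sum>j\<in>{i - 1, i, i + 1} \<inter> {1..l}. rat_of_int (cartan_matrix X l i j) * y j)"
      using i by (intro row_sum) (auto simp: cartan_matrix_def X min_def max_def)
    also have "\<dots> = (\<Sum>j\<in>{i - 1, i, i + 1}. if j \<in> {1..l} then rat_of_int (cartan_matrix X l i j) * y j else 0)"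
      by (rule sum.inter_restrict) simp
    also have "\<dots> = 2 * y i - y (i - 1) - (if i + 1 \<le> l then y (i + 1) else 0)"
      using i by (subst sum_neighbours) (auto simp: cartan_matrix_def X min_def max_def)
    also have "y i = z k" using k by (simp add: z_def i_def)
    also have "y (i - 1) = z (k + 1)" using k by (simp add: z_def i_def)
    also have "(if i + 1 \<le> l then y (i + 1) else 0) = z (k - 1)"
    proof (cases "k = 1")
      case True then show ?thesis by (simp add: z_def i_def)
    next
      case False
      then have "i + 1 = l + 1 - (k - 1)" "i + 1 \<le> l" "k - 1 \<noteq> 0" using k m by (auto simp: i_def)
      then show ?thesis by (simp add: z_def)
    qed
    finally show ?thesis using rows[OF i(1)] by simp
  qed
  have ap: "z k = of_nat k * z 1" if "k \<le> m + 2" for k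
    by (rule arithmetic_progression[of z "m + 2", OF _ row that]) (simp_all add: z_def)
  have "(\<Sum>j=1..l. rat_of_int (C 1 j) * y j)
      = (\<Sum>j\<in>{1, 2}. rat_of_int (cartan_matrix X l 1 j) * y j)"
    using m by (intro row_sum) (auto simp: cartan_matrix_def X min_def max_def)
  then have r1: "2 * y 1 = y 2"
    using rows[of 1] m by (simp add: cartan_matrix_def X min_def max_def)
  have "(\<Sum>j=1..l. rat_of_int (C 2 j) * y j)
      = (\<Sum>j\<in>{1, 2, 3}. rat_of_int (cartan_matrix X l 2 j) * y j)"
    using m by (intro row_sum) (auto simp: cartan_matrix_def X min_def max_def)
  then have r2: "2 * y 2 = 2 * y 1 + y 3"
    using rows[of 2] m by (simp add: cartan_matrix_def X min_def max_def)
  have a2: "y 2 = of_nat (m + 2) * z 1" using ap[of "m + 2"] by (simp add: z_def m)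
  have a3: "y 3 = of_nat (m + 1) * z 1" using ap[of "m + 1"] by (simp add: z_def m)
  have "y 2 = y 3" using r1 r2 by linarith
  then have "z 1 = 0" using a2 a3 by (simp add: algebra_simps)
  then have z: "z k = 0" if "k \<le> m + 2" for k using ap[OF that] by simp
  have big: "y i = 0" if "2 \<le> i" "i \<le> l" for i
    using z[of "l + 1 - i"] that m by (simp add: z_def)
  then have "y 1 = 0" using r1 l by simp
  moreover have "j = 1 \<or> 2 \<le> j" using j by auto
  ultimately show ?thesis using big j by auto
qed

lemma interval_numerals:
  "{1..2::nat} = {1, 2}" "{1..4::nat} = {1, 2, 3, 4}" "{1..6::nat} = {1, 2, 3, 4, 5, 6}"
  "{1..7::nat} = {1, 2, 3, 4, 5, 6, 7}" "{1..8::nat} = {1, 2, 3, 4, 5, 6, 7, 8}"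
  by auto

lemma nondegenerate_exceptional:
  assumes X: "X = TypeE \<or> X = TypeF \<or> X = TypeG"
    and rows: "\<And>i. i \<in> {1..l} \<Longrightarrow> (\<Sum>j=1..l. rat_of_int (C i j) * y j) = 0"
    and j: "j \<in> {1..l}"
  shows "y j = 0"
proof -
  have rows': "\<forall>i\<in>{1..l}. (\<Sum>j\<in>{1..l}. rat_of_int (cartan_matrix X l i j) * y j) = 0"
    using rows row_sum[OF order_refl] by simp
  consider "X = TypeE" "l = 6" | "X = TypeE" "l = 7" | "X = TypeE" "l = 8"
    | "X = TypeF" "l = 4" | "X = TypeG" "l = 2"
    using X valid by auto
  then show ?thesis
  proof cases
    case 1
    with rows' have "\<forall>i\<in>{1,2,3,4,5,6}. (\<Sum>j\<in>{1,2,3,4,5,6}. rat_of_int (cartan_matrix TypeE 6 i j) * y j) = 0"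
      by (simp only: interval_numerals)
    then have "y 1 = 0 \<and> y 2 = 0 \<and> y 3 = 0 \<and> y 4 = 0 \<and> y 5 = 0 \<and> y 6 = 0"
      by (simp add: cartan_matrix_def)
    then show ?thesis using j unfolding \<open>l = 6\<close> interval_numerals by auto
  next
    case 2
    with rows' have "\<forall>i\<in>{1,2,3,4,5,6,7}. (\<Sum>j\<in>{1,2,3,4,5,6,7}. rat_of_int (cartan_matrix TypeE 7 i j) * y j) = 0"
      by (simp only: interval_numerals)
    then have "y 1 = 0 \<and> y 2 = 0 \<and> y 3 = 0 \<and> y 4 = 0 \<and> y 5 = 0 \<and> y 6 = 0 \<and> y 7 = 0"
      by (simp add: cartan_matrix_def)
    then show ?thesis using j unfolding \<open>l = 7\<close> interval_numerals by auto
  next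
    case 3
    with rows' have "\<forall>i\<in>{1,2,3,4,5,6,7,8}. (\<Sum>j\<in>{1,2,3,4,5,6,7,8}. rat_of_int (cartan_matrix TypeE 8 i j) * y j) = 0"
      by (simp only: interval_numerals)
    then have "y 1 = 0 \<and> y 2 = 0 \<and> y 3 = 0 \<and> y 4 = 0 \<and> y 5 = 0 \<and> y 6 = 0 \<and> y 7 = 0 \<and> y 8 = 0"
      by (simp add: cartan_matrix_def)
    then show ?thesis using j unfolding \<open>l = 8\<close> interval_numerals by auto
  next
    case 4
    with rows' have "\<forall>i\<in>{1,2,3,4}. (\<Sum>j\<in>{1,2,3,4}. rat_of_int (cartan_matrix TypeF 4 i j) * y j) = 0"
      by (simp only: interval_numerals)
    then have "y 1 = 0 \<and> y 2 = 0 \<and> y 3 = 0 \<and> y 4 = 0"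
      by (simp add: cartan_matrix_def)
    then show ?thesis using j unfolding \<open>l = 4\<close> interval_numerals by auto
  next
    case 5
    with rows' have "\<forall>i\<in>{1,2}. (\<Sum>j\<in>{1,2}. rat_of_int (cartan_matrix TypeG 2 i j) * y j) = 0"
      by (simp only: interval_numerals)
    then have "y 1 = 0 \<and> y 2 = 0"
      by (simp add: cartan_matrix_def)
    then show ?thesis using j unfolding \<open>l = 2\<close> interval_numerals by auto
  qed
qed

lemma radical_null_vecs:
  assumes "X \<noteq> TypeB"
  shows "radical F (l + d) = range null_vec"
proof (rule radical_eq)
  fix y :: "nat \<Rightarrow> rat" and j
  assume *: "\<And>i. i \<in> {1..l} \<Longrightarrow> (\<Sum>j=1..l. rat_of_int (C i j) * y j) = 0" "j \<in> {1..l}"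
  show "y j = 0"
    using nondegenerate_A[OF _ *] nondegenerate_C[OF _ *] nondegenerate_D[OF _ *]
      nondegenerate_exceptional[OF _ *] assms by (cases X) blast+
qed

lemma layer_full:
  assumes "e \<in> simple_roots l"
  shows "layer e (\<lambda>_. 1) = orbit F0 l e + range null_vec"
proof -
  have "(\<lambda>_. 0) \<in> base_coeffs e" using assms by (simp add: base_coeffs_def)
  then have "null_coeffs e (\<lambda>_. 1) = UNIV" unfolding null_coeffs_def by auto
  then show ?thesis unfolding layer_def set_plus_def by blast
qed

end

section \<open>The classification by types\<close>

context labelled_affinization
begin

text \<open>
The diagram is a chain, except that in types \<open>D\<close> and \<open>E\<close> the last node is attached to an inner node.
\<close>

lemma simply_laced_connected:
  assumes X: "X = TypeA \<and> l \<ge> 2 \<or> X = TypeD \<or> X = TypeE"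
  shows "2 \<in> {1..l}" "C 2 1 = - 1" "i \<in> {1..l} \<Longrightarrow> basis_vec i \<in> orbit F0 l \<alpha>1"
proof -
  have l: "2 \<le> l" using X valid by auto
  then show "2 \<in> {1..l}" by simp
  then show "C 2 1 = - 1"
    using X valid l cartan_entry[OF _ ends(1), of 2] by (auto simp: cartan_matrix_def)
  assume i: "i \<in> {1..l}"
  define m where "m = (if X = TypeA then l else l - 1)"
  have chain: "basis_vec n \<in> orbit F0 l \<alpha>1" if n: "1 \<le> n" "n \<le> m" for n
  proof (rule chain_orbit[OF n(1)])
    show "{1..n} \<subseteq> {1..l}" using n by (auto simp: m_def split: if_splits)
    fix j assume j: "1 \<le> j" "j < n"
    then have jl: "j \<in> {1..l}" "j + 1 \<in> {1..l}" using n by (auto simp: m_def split: if_splits)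
    have "X \<noteq> TypeA \<Longrightarrow> j + 1 < l" using j n by (auto simp: m_def split: if_splits)
    then show "C j (j + 1) = - 1 \<and> C (j + 1) j = - 1"
      unfolding cartan_entry[OF jl] cartan_entry[OF jl(2,1)]
      using X by (auto simp: cartan_matrix_def min_def max_def)
  qed
  show "basis_vec i \<in> orbit F0 l \<alpha>1"
  proof (cases "i \<le> m")
    case True then show ?thesis using chain i by simp
  next
    case False
    then have il: "i = l" "X = TypeD \<or> X = TypeE"
      using i X by (auto simp: m_def split: if_splits)
    define j where "j = (if X = TypeD then l - 2 else if l = 8 then 5 else 3)"
    have j: "1 \<le> j" "j \<le> m" "j < l" "j \<in> {1..l}"
      using il(2) valid by (auto simp: j_def m_def)
    have "basis_vec l \<in> orbit F0 l (basis_vec j)"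
    proof (rule adjacent_orbit[OF j(4) ends(2)])
      show "C j l = - 1" unfolding cartan_entry[OF j(4) ends(2)]
        using il(2) j(3) by (auto simp: cartan_matrix_def j_def min_def max_def)
      show "C l j = - 1" unfolding cartan_entry[OF ends(2) j(4)]
        using il(2) j(3) by (auto simp: cartan_matrix_def j_def min_def max_def)
    qed
    then show ?thesis unfolding il(1) using orbit_trans chain[OF j(1,2)] by blast
  qed
qed

text \<open>
All steps are 1, because \<open>\<langle>\<alpha>\<^sub>1, \<alpha>\<^sub>2\<^sup>\<or>\<rangle> = -1\<close> and \<open>\<alpha>\<^sub>2\<close> is conjugate to \<open>\<alpha>\<^sub>1\<close>.
\<close>

lemma weyl_roots_simply_laced:
  assumes X: "X = TypeA \<and> l \<ge> 2 \<or> X = TypeD \<or> X = TypeE" and bst: "(b, s, t) = (d, 0, 0)"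
  shows "RW = R + radical F (l + d)"
proof -
  note connected = simply_laced_connected[OF X]
  have "AS = {}" "AD = {}" using empty_short empty_double bst by auto
  then have K: "r k = \<alpha>1" if "k \<in> K" for k using K_split root(1) that by blast
  have "RW = (\<Union>e\<in>{\<alpha>1}. layer e (\<lambda>_. 1))"
  proof (rule layers_graded[where D = "\<lambda>_ _. 1" and N = "\<lambda>_ _. 1"])
    show "\<exists>e\<in>{\<alpha>1} \<inter> simple_roots l. basis_vec i \<in> orbit F0 l e" if "i \<in> {1..l}" for i
      using connected(3)[OF that] ends_simple by blast
    show "graded (\<lambda>_. 1) e" if "e \<in> {\<alpha>1}" for e
      using that graded_basis_1 by auto
    show "\<exists>x\<in>orbit F0 l e. \<exists>\<beta>\<in>orbit F0 l f. coroot_pairing \<beta> x \<in> {rat_of_int 1, - rat_of_int 1}"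
      if "e \<in> {\<alpha>1}" "f \<in> {\<alpha>1}" for e f
    proof -
      have "e = \<alpha>1" "f = \<alpha>1" using that by blast+
      then show ?thesis
        using steps_simple[OF connected(1) ends(1) connected(3)[OF connected(1)] orbit_start, of 1]
          connected(2) by simp
    qed
  qed (use K in auto)
  also have "\<dots> = orbit F0 l \<alpha>1 + range null_vec" using layer_full[OF ends_simple(1)] by simp
  also have "orbit F0 l \<alpha>1 = R"
    unfolding weyl_roots_finite using connected(3) ends(1) orbit_trans by blast
  also have "range null_vec = radical F (l + d)" using radical_null_vecs X by auto
  finally show ?thesis .
qed

text \<open>
A short root pairs to \<open>\<plusminus>1\<close> with some long coroot and a long root to \<open>\<plusminus>q\<close> with some short one.  So only the
  pairings between roots of the same length distinguish the types: \<open>N\<close> is the step of long roots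
  with respect to the added long roots.
\<close>

lemma two_length_layers:
  assumes two: "two_lengths q Sh" and t: "t = 0"
    and N_dvd: "\<forall>j\<in>{1..l}. N dvd C 1 j * long_grading q Sh j"
    and long_step: "\<exists>x\<in>orbit F0 l \<alpha>1. \<exists>\<beta>\<in>orbit F0 l \<alpha>1.
      coroot_pairing \<beta> x \<in> {rat_of_int N, - rat_of_int N}"
    and short_step: "\<exists>x\<in>orbit F0 l \<alpha>l. \<exists>\<beta>\<in>orbit F0 l \<alpha>l.
      coroot_pairing \<beta> x \<in> {rat_of_int 1, - rat_of_int 1}"
    and X: "X \<noteq> TypeB"
  shows "RW = same_length F RW (short_roots F0 R) \<union> same_length F RW (long_roots F0 R)"
    and "same_length F RW (short_roots F0 R) = short_roots F0 R + radical F (l + d)"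
    and "same_length F RW (long_roots F0 R) = {\<alpha> + u + v | \<alpha> u v. \<alpha> \<in> long_roots F0 R \<and>
      u \<in> combs \<delta>1 b (coset_family True True b N) \<and>
      v \<in> combs \<delta>2 s (coset_family False True s q)}"
proof -
  note ne = two_lengths_ends[OF two]
  have AD: "AD = {}" using empty_double[OF t] .
  have K: "r k \<in> {\<alpha>1, \<alpha>l}" if "k \<in> K" for k using K_split root(1,2) AD that by blast
  define D where "D e j = (if e = \<alpha>1 then long_grading q Sh j else 1)" for e j
  define M where "M e f = (if e = \<alpha>1 then if f = \<alpha>1 then N else q else 1)" for e f :: vec
  define E where "E = {\<alpha>1, \<alpha>l}"
  have q_dvd: "q dvd C l j * long_grading q Sh j" if "j \<in> {1..l}" for j
  proof -
    have "l \<in> Sh" using two by (simp add: two_lengths_def)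
    then show ?thesis
      using long_grading_stable[OF two ends(2) that] by (simp add: long_grading_def[OF two])
  qed
  have RW: "RW = (\<Union>e\<in>E. layer e (\<lambda>k. M e (r k)))"
  proof (rule layers_graded[where D = D])
    show "E \<subseteq> {\<alpha>1, \<alpha>l, \<beta>l}" by (auto simp: E_def)
    show "\<exists>e\<in>E \<inter> simple_roots l. basis_vec i \<in> orbit F0 l e" if "i \<in> {1..l}" for i
      using two_lengths_orbit[OF two that] ends_simple unfolding E_def by blast
    show "r k \<in> E" if "k \<in> K" for k using K[OF that] by (simp add: E_def)
    show "graded (D e) e" if "e \<in> E" for e
    proof (cases "e = \<alpha>1")
      case True
      then have "D e = long_grading q Sh" by (simp add: D_def fun_eq_iff)
      then show ?thesis using long_graded[OF two] True by simp
    next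
      case False
      then have e: "e = \<alpha>l" using that by (simp add: E_def)
      show ?thesis unfolding e using ne by (intro graded_basis_1) (simp add: D_def)
    qed
    show "D e i dvd C i j * D e j" if "e \<in> E" "i \<in> {1..l}" "j \<in> {1..l}" for e i j
      using long_grading_stable[OF two that(2,3)] by (simp add: D_def)
    show "M e (basis_vec i) dvd C i j * D e j"
      if "e \<in> E" "basis_vec i \<in> E" "i \<in> {1..l}" "j \<in> {1..l}" for e i j
      using that(2) ne bspec[OF N_dvd that(4)] q_dvd[OF that(4)] by (auto simp: M_def D_def E_def)
    show "2 * M e \<beta>l dvd C l j * D e j" if "e \<in> E" "\<beta>l \<in> E" "j \<in> {1..l}" for e j
      using that by (simp add: E_def)
    show "\<exists>x\<in>orbit F0 l e. \<exists>\<beta>\<in>orbit F0 l f.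
        coroot_pairing \<beta> x \<in> {rat_of_int (M e f), - rat_of_int (M e f)}"
      if "e \<in> E" "f \<in> E" for e f
    proof -
      have "e = \<alpha>1 \<or> e = \<alpha>l" "f = \<alpha>1 \<or> f = \<alpha>l" using that by (simp_all add: E_def)
      then show ?thesis
      proof (elim disjE)
        assume 1: "e = \<alpha>1" "f = \<alpha>1" then have "M e f = N" by (simp add: M_def)
        then show ?thesis using long_step 1 by simp
      next
        assume 2: "e = \<alpha>1" "f = \<alpha>l" then have "M e f = q" using ne by (simp add: M_def)
        then show ?thesis using two_lengths_steps(1)[OF two] 2 by simp
      next
        assume 3: "e = \<alpha>l" "f = \<alpha>1" then have "M e f = 1" using ne by (simp add: M_def)
        then show ?thesis using two_lengths_steps(2)[OF two] 3 by simp
      next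
        assume 4: "e = \<alpha>l" "f = \<alpha>l" then have "M e f = 1" using ne by (simp add: M_def)
        then show ?thesis using short_step 4 by simp
      qed
    qed
  qed
  note long = two_lengths_long[OF two] and short = two_lengths_short[OF two]
  have inj: "inj_on (\<lambda>e. F0 e e) E" using two_lengths_norm(3)[OF two] by (auto simp: E_def inj_on_def)
  have members: "\<alpha>1 \<in> E" "\<alpha>l \<in> E" by (simp_all add: E_def)
  have E: "E \<subseteq> {\<alpha>1, \<alpha>l, \<beta>l}" by (auto simp: E_def)
  have L: "same_length F RW (long_roots F0 R) = layer \<alpha>1 (\<lambda>k. M \<alpha>1 (r k))"
    unfolding long
    by (rule layer_length[OF RW E members(1) inj])
      (use orbit_start orbit_coord_space ends_coord finite.orbit_norm in blast)+
  have S: "same_length F RW (short_roots F0 R) = layer \<alpha>l (\<lambda>k. M \<alpha>l (r k))"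
    unfolding short
    by (rule layer_length[OF RW E members(2) inj])
      (use orbit_start orbit_coord_space ends_coord finite.orbit_norm in blast)+
  show "RW = same_length F RW (short_roots F0 R) \<union> same_length F RW (long_roots F0 R)"
    unfolding L S using RW by (simp add: E_def Un_commute)
  have M_short: "(\<lambda>k. M \<alpha>l (r k)) = (\<lambda>_. 1)" using ne by (simp add: M_def)
  show "same_length F RW (short_roots F0 R) = short_roots F0 R + radical F (l + d)"
    unfolding S M_short layer_full[OF ends_simple(2)] radical_null_vecs[OF X]
    unfolding short by (rule refl)
  have own: "{k \<in> K. r k = \<alpha>1} = AL" using K_split root ne AD by auto
  have "layer \<alpha>1 (\<lambda>k. M \<alpha>1 (r k)) = {x + u + v + w | x u v w. x \<in> orbit F0 l \<alpha>1 \<and>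
      u \<in> combs \<delta>1 b (coset_family True True b N) \<and>
      v \<in> combs \<delta>2 s (coset_family False True s q) \<and> w \<in> combs \<delta>3 t (coset_family False True t 1)}"
    by (rule layer_eq)
      (use own root ne AD ends_simple in \<open>auto simp: M_def\<close>)
  moreover have "combs \<delta>3 t (coset_family False True t 1) = {0}"
    by (simp add: combs_def int_comb_def t coset_family_def)
  ultimately show "same_length F RW (long_roots F0 R) = {\<alpha> + u + v | \<alpha> u v. \<alpha> \<in> long_roots F0 R \<and>
      u \<in> combs \<delta>1 b (coset_family True True b N) \<and>
      v \<in> combs \<delta>2 s (coset_family False True s q)}"
    unfolding L unfolding long by simp
qed

end

lemma sums_with_zero:
  fixes f :: "'a \<Rightarrow> 'b :: comm_monoid_add"
  shows "{x + u + v + w | x u v w. x \<in> f ` S \<and> u \<in> U \<and> v \<in> {0} \<and> w \<in> W}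
    = {f x + u + w | x u w. x \<in> S \<and> u \<in> U \<and> w \<in> W}"
  by (simp add: image_iff) blast

context labelled_affinization
begin

text \<open>
The pairing of \<open>s\<^sub>j \<alpha>\<^sub>i\<close> with \<open>\<alpha>\<^sub>i\<^sup>\<or>\<close>.  In type \<open>G\<^sub>2\<close> it is \<open>2 - 3 = -1\<close>, a value that no two simple roots of
  equal length attain.
\<close>

lemma reflected_step:
  assumes i: "i \<in> {1..l}" and j: "j \<in> {1..l}" and n: "2 - C i j * C j i = n \<or> 2 - C i j * C j i = - n"
  shows "\<exists>x\<in>orbit F0 l (basis_vec i). \<exists>\<beta>\<in>orbit F0 l (basis_vec i).
    coroot_pairing \<beta> x \<in> {rat_of_int n, - rat_of_int n}"
proof (intro bexI)
  let ?x = "reflection F0 (basis_vec j) (basis_vec i)"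
  have "C i i = 2" using gram_cartan[OF i i] gram_positive[OF i] by simp
  have "coroot_pairing (basis_vec i) ?x + rat_of_int (C j i) * coroot_pairing (basis_vec i) (basis_vec j)
      = coroot_pairing (basis_vec i) (basis_vec i)"
    unfolding coroot_pairing_scale_right[symmetric] coroot_pairing_add_right[symmetric]
    by (simp add: reflection_eq coroot_pairing_basis[OF j i])
  then have "coroot_pairing (basis_vec i) ?x = rat_of_int (2 - C i j * C j i)"
    using \<open>C i i = 2\<close> by (simp add: coroot_pairing_basis[OF i i] coroot_pairing_basis[OF i j] algebra_simps)
  then show "coroot_pairing (basis_vec i) ?x \<in> {rat_of_int n, - rat_of_int n}" using n
    by (metis insertCI of_int_minus)
qed (use j orbit_start orbit_step in blast)+

lemma two_lengths_C:
  assumes X: "X = TypeC"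
  shows "two_lengths 2 {2..l}"
proof -
  have l: "3 \<le> l" using valid by (simp add: X)
  then have two: "2 \<in> {1..l}" by simp
  have chain: "basis_vec i \<in> orbit F0 l (basis_vec 2)" if "2 \<le> i" "i \<le> l" for i
  proof (rule chain_orbit[OF that(1)])
    show "{2..i} \<subseteq> {1..l}" using that by auto
    fix j assume j: "2 \<le> j" "j < i"
    then have jl: "j \<in> {1..l}" "j + 1 \<in> {1..l}" using that by auto
    show "C j (j + 1) = - 1 \<and> C (j + 1) j = - 1"
      unfolding cartan_entry[OF jl] cartan_entry[OF jl(2,1)]
      using j by (simp add: cartan_matrix_def X min_def max_def)
  qed
  have "orbit F0 l \<alpha>l = orbit F0 l (basis_vec 2)"
    using finite.orbit_eq[OF chain[OF _ order_refl]] l by simp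
  then have orbits: "basis_vec i \<in> orbit F0 l (if i \<in> {2..l} then \<alpha>l else \<alpha>1)" if "i \<in> {1..l}" for i
    using chain that orbit_start by (cases "i = 1") simp_all
  have even: "2 dvd C i j" if "i \<in> {2..l}" "j \<in> {1..l} - {2..l}" for i j
  proof -
    have ij: "i \<in> {1..l}" "j = 1" using that by auto
    show ?thesis unfolding ij(2) cartan_entry[OF ij(1) ends(1)]
      using that(1) by (simp add: cartan_matrix_def X)
  qed
  have "C 2 1 = - 2 \<and> C 1 2 = - 1"
    unfolding cartan_entry[OF two ends(1)] cartan_entry[OF ends(1) two]
    by (simp add: cartan_matrix_def X)
  then have bond: "\<exists>i\<in>{2..l}. \<exists>j\<in>{1..l} - {2..l}. C i j = - 2 \<and> C j i = - 1"
    using two l by (intro bexI[of _ 2] bexI[of _ 1]) auto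
  show ?thesis unfolding two_lengths_def using orbits even bond l by auto
qed

text \<open>
Distinct long roots are orthogonal or opposite, so their step is 2.
\<close>

lemma weyl_roots_C:
  assumes X: "X = TypeC" and t: "t = 0"
  shows "RW = same_length F RW (short_roots F0 R) \<union> same_length F RW (long_roots F0 R)"
    and "same_length F RW (short_roots F0 R) = short_roots F0 R + radical F (l + d)"
    and "same_length F RW (long_roots F0 R) =
      {\<alpha> + int_comb b a \<delta>1 + 2 *\<^sub>q int_comb s b' \<delta>2 | \<alpha> a b'.
        \<alpha> \<in> long_roots F0 R \<and> at_most_one_odd b a}"
proof -
  have l: "3 \<le> l" using valid by (simp add: X)
  note two = two_lengths_C[OF X]
  have B: "X \<noteq> TypeB" by (simp add: X)
  have diag: "C 1 1 = 2" unfolding cartan_entry[OF ends(1) ends(1)] by (simp add: cartan_matrix_def)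
  have dvd: "\<forall>j\<in>{1..l}. 2 dvd C 1 j * long_grading 2 {2..l} j"
  proof
    fix j assume "j \<in> {1..l}"
    then show "2 dvd C 1 j * long_grading 2 {2..l} j"
      using diag by (cases "j = 1") (simp_all add: long_grading_def[OF two])
  qed
  have long_step: "\<exists>x\<in>orbit F0 l \<alpha>1. \<exists>\<beta>\<in>orbit F0 l \<alpha>1. coroot_pairing \<beta> x \<in> {rat_of_int 2, - rat_of_int 2}"
    by (rule steps_simple[OF ends(1) ends(1) orbit_start orbit_start]) (rule disjI1, fact diag)
  have i: "l - 1 \<in> {1..l}" using l by auto
  have "l - 1 \<in> {2..l}" using l by auto
  then have "basis_vec (l - 1) \<in> orbit F0 l \<alpha>l" using two_lengths_orbit(1)[OF two i] by blast
  moreover have "C (l - 1) l = - 1"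
    unfolding cartan_entry[OF i ends(2)] using l by (simp add: cartan_matrix_def X min_def max_def)
  ultimately have short_step: "\<exists>x\<in>orbit F0 l \<alpha>l. \<exists>\<beta>\<in>orbit F0 l \<alpha>l.
      coroot_pairing \<beta> x \<in> {rat_of_int 1, - rat_of_int 1}"
    by (intro steps_simple[OF i ends(2) _ orbit_start]) simp_all
  note layers = two_length_layers[OF two t dvd long_step short_step B]
  show "RW = same_length F RW (short_roots F0 R) \<union> same_length F RW (long_roots F0 R)"
    by (rule layers(1))
  show "same_length F RW (short_roots F0 R) = short_roots F0 R + radical F (l + d)"
    by (rule layers(2))
  show "same_length F RW (long_roots F0 R) =
      {\<alpha> + int_comb b a \<delta>1 + 2 *\<^sub>q int_comb s b' \<delta>2 | \<alpha> a b'.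
        \<alpha> \<in> long_roots F0 R \<and> at_most_one_odd b a}"
    unfolding layers(3) coset_family_2_at_most coset_family_other combs_multiples of_int_numeral
    unfolding combs_def by blast
qed

lemma two_lengths_F:
  assumes X: "X = TypeF"
  shows "two_lengths 2 {3, 4}"
proof -
  have l: "l = 4" using valid by (simp add: X)
  have C: "C 1 2 = - 1" "C 2 1 = - 1" "C 3 4 = - 1" "C 4 3 = - 1" "C 3 2 = - 2" "C 2 3 = - 1"
    "C 3 1 = 0" "C 4 1 = 0" "C 4 2 = 0"
    by (simp_all add: cartan_entry l cartan_matrix_def X)
  have "basis_vec 2 \<in> orbit F0 l \<alpha>1" by (rule adjacent_orbit) (simp_all add: l C del: One_nat_def)
  moreover have "basis_vec 3 \<in> orbit F0 l (basis_vec 4)" by (rule adjacent_orbit) (simp_all add: l C del: One_nat_def)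
  ultimately have "\<forall>i\<in>{1, 2, 3, 4}. basis_vec i \<in> orbit F0 l (if i \<in> {3, 4} then \<alpha>l else \<alpha>1)"
    by (simp add: l orbit_start del: One_nat_def)
  moreover have "{1..l} - {3, 4} = {1, 2}" using l by auto
  ultimately show ?thesis unfolding two_lengths_def using l by (simp add: interval_numerals C del: One_nat_def)
qed

text \<open>
The long roots \<open>\<alpha>\<^sub>1\<close>, \<open>\<alpha>\<^sub>2\<close> are adjacent, and so are the short roots \<open>\<alpha>\<^sub>3\<close>, \<open>\<alpha>\<^sub>4\<close>; both steps are 1.
\<close>

lemma weyl_roots_F:
  assumes X: "X = TypeF" and t: "t = 0"
  shows "RW = same_length F RW (short_roots F0 R) \<union> same_length F RW (long_roots F0 R)"
    and "same_length F RW (short_roots F0 R) = short_roots F0 R + radical F (l + d)"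
    and "same_length F RW (long_roots F0 R) =
      {\<alpha> + int_comb b a \<delta>1 + 2 *\<^sub>q int_comb s b' \<delta>2 | \<alpha> a b'. \<alpha> \<in> long_roots F0 R}"
proof -
  have l: "l = 4" using valid by (simp add: X)
  note two = two_lengths_F[OF X]
  have B: "X \<noteq> TypeB" by (simp add: X)
  have mem: "2 \<in> {1..l}" "3 \<in> {1..l}" using l by auto
  have C: "C 2 1 = - 1" "C 3 l = - 1"
    by (simp_all add: cartan_entry l cartan_matrix_def X)
  have long_step: "\<exists>x\<in>orbit F0 l \<alpha>1. \<exists>\<beta>\<in>orbit F0 l \<alpha>1. coroot_pairing \<beta> x \<in> {rat_of_int 1, - rat_of_int 1}"
    by (rule steps_simple[OF mem(1) ends(1) two_lengths_orbit(2)[OF two mem(1)] orbit_start])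
      (simp_all add: C del: One_nat_def)
  have short_step: "\<exists>x\<in>orbit F0 l \<alpha>l. \<exists>\<beta>\<in>orbit F0 l \<alpha>l. coroot_pairing \<beta> x \<in> {rat_of_int 1, - rat_of_int 1}"
    by (rule steps_simple[OF mem(2) ends(2) two_lengths_orbit(1)[OF two mem(2)] orbit_start])
      (simp_all add: C del: One_nat_def)
  note layers = two_length_layers[OF two t ballI[OF one_dvd] long_step short_step B]
  show "RW = same_length F RW (short_roots F0 R) \<union> same_length F RW (long_roots F0 R)"
    by (rule layers(1))
  show "same_length F RW (short_roots F0 R) = short_roots F0 R + radical F (l + d)"
    by (rule layers(2))
  show "same_length F RW (long_roots F0 R) =
      {\<alpha> + int_comb b a \<delta>1 + 2 *\<^sub>q int_comb s b' \<delta>2 | \<alpha> a b'. \<alpha> \<in> long_roots F0 R}"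
    unfolding layers(3) coset_family_1 coset_family_other combs_multiples of_int_numeral
    unfolding combs_def by blast
qed

lemma two_lengths_G:
  assumes X: "X = TypeG"
  shows "two_lengths 3 {2}"
proof -
  have l: "l = 2" using valid by (simp add: X)
  have C: "C 1 2 = - 1" "C 2 1 = - 3"
    by (simp_all add: cartan_entry l cartan_matrix_def X)
  have "{1..l} - {2} = {1}" using l by auto
  then show ?thesis unfolding two_lengths_def using l by (simp add: interval_numerals C orbit_start del: One_nat_def)
qed

lemma weyl_roots_G:
  assumes X: "X = TypeG" and t: "t = 0"
  shows "RW = same_length F RW (short_roots F0 R) \<union> same_length F RW (long_roots F0 R)"
    and "same_length F RW (short_roots F0 R) = short_roots F0 R + radical F (l + d)"
    and "same_length F RW (long_roots F0 R) =
      {\<alpha> + int_comb b a \<delta>1 + 3 *\<^sub>q int_comb s b' \<delta>2 | \<alpha> a b'. \<alpha> \<in> long_roots F0 R}"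
proof -
  have l: "l = 2" using valid by (simp add: X)
  note two = two_lengths_G[OF X]
  have B: "X \<noteq> TypeB" by (simp add: X)
  have C: "C 1 l = - 1" "C l 1 = - 3"
    by (simp_all add: cartan_entry l cartan_matrix_def X)
  have long_step: "\<exists>x\<in>orbit F0 l \<alpha>1. \<exists>\<beta>\<in>orbit F0 l \<alpha>1. coroot_pairing \<beta> x \<in> {rat_of_int 1, - rat_of_int 1}"
    by (rule reflected_step[OF ends]) (simp add: C del: One_nat_def)
  have short_step: "\<exists>x\<in>orbit F0 l \<alpha>l. \<exists>\<beta>\<in>orbit F0 l \<alpha>l. coroot_pairing \<beta> x \<in> {rat_of_int 1, - rat_of_int 1}"
    by (rule reflected_step[OF ends(2,1)]) (simp add: C del: One_nat_def)
  note layers = two_length_layers[OF two t ballI[OF one_dvd] long_step short_step B]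
  show "RW = same_length F RW (short_roots F0 R) \<union> same_length F RW (long_roots F0 R)"
    by (rule layers(1))
  show "same_length F RW (short_roots F0 R) = short_roots F0 R + radical F (l + d)"
    by (rule layers(2))
  show "same_length F RW (long_roots F0 R) =
      {\<alpha> + int_comb b a \<delta>1 + 3 *\<^sub>q int_comb s b' \<delta>2 | \<alpha> a b'. \<alpha> \<in> long_roots F0 R}"
    unfolding layers(3) coset_family_1 coset_family_other combs_multiples of_int_numeral
    unfolding combs_def by blast
qed

lemma orbit_double: "orbit F0 l (2 *\<^sub>q e) = (*\<^sub>q) 2 ` orbit F0 l e"
proof
  show "(*\<^sub>q) 2 ` orbit F0 l e \<subseteq> orbit F0 l (2 *\<^sub>q e)" using finite.orbit_scale by blast
  show "orbit F0 l (2 *\<^sub>q e) \<subseteq> (*\<^sub>q) 2 ` orbit F0 l e"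
  proof
    fix x assume "x \<in> orbit F0 l (2 *\<^sub>q e)"
    from finite.orbit_scale[OF this, of "1/2"] have "(1/2) *\<^sub>q x \<in> orbit F0 l e" by simp
    moreover have "x = 2 *\<^sub>q ((1/2) *\<^sub>q x)" by simp
    ultimately show "x \<in> (*\<^sub>q) 2 ` orbit F0 l e" by blast
  qed
qed

lemma two_lengths_B:
  assumes X: "X = TypeB"
  shows "two_lengths 2 {l}"
proof -
  have l: "2 \<le> l" using valid by (simp add: X)
  have orbits: "basis_vec i \<in> orbit F0 l (if i \<in> {l} then \<alpha>l else \<alpha>1)" if i: "i \<in> {1..l}" for i
  proof (cases "i = l")
    case True then show ?thesis by (simp add: orbit_start)
  next
    case False
    have "basis_vec i \<in> orbit F0 l \<alpha>1"
    proof (rule chain_orbit)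
      show "1 \<le> i" "{1..i} \<subseteq> {1..l}" using i by auto
      fix j assume j: "1 \<le> j" "j < i"
      then have jl: "j \<in> {1..l}" "j + 1 \<in> {1..l}" using i by auto
      have "i < l" using i False by simp
      then show "C j (j + 1) = - 1 \<and> C (j + 1) j = - 1"
        unfolding cartan_entry[OF jl] cartan_entry[OF jl(2,1)]
        using j by (simp add: cartan_matrix_def X min_def max_def)
    qed
    then show ?thesis using False by simp
  qed
  have even: "2 dvd C i j" if "i \<in> {l}" "j \<in> {1..l} - {l}" for i j
  proof -
    have ij: "i = l" "j \<in> {1..l}" "j \<noteq> l" using that by auto
    show ?thesis unfolding ij(1) cartan_entry[OF ends(2) ij(2)]
      using ij(2,3) by (auto simp: cartan_matrix_def X min_def max_def)
  qed
  have j: "l - 1 \<in> {1..l}" "l - 1 \<in> {1..l} - {l}" using l by auto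
  have "C l (l - 1) = - 2 \<and> C (l - 1) l = - 1"
    unfolding cartan_entry[OF ends(2) j(1)] cartan_entry[OF j(1) ends(2)]
    using l by (auto simp: cartan_matrix_def X min_def max_def)
  then have bond: "\<exists>i\<in>{l}. \<exists>j\<in>{1..l} - {l}. C i j = - 2 \<and> C j i = - 1"
    using j(2) by blast
  have "1 \<notin> {l}" using l by auto
  then show ?thesis unfolding two_lengths_def using orbits even bond ends(2)
    by (intro conjI ballI) auto
qed

text \<open>
Since \<open>\<alpha>\<^sub>l\<^sup>\<or>\<close> takes even values on the root lattice, both \<open>\<alpha>\<^sub>l\<^sup>\<or>\<close> and \<open>(2\<alpha>\<^sub>l)\<^sup>\<or>\<close> are integral.  The step \<open>N\<close> between
  long roots is 1 once there are two adjacent long simple roots.  For \<open>l = 2\<close> the long roots form a system of type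
  \<open>A\<^sub>1 \<times> A\<^sub>1\<close>, and the step is 2.
\<close>

lemma weyl_roots_B:
  assumes X: "X = TypeB"
  defines "N \<equiv> if l = 2 then 2 else 1"
  shows "RW = same_length F RW {\<alpha>l} \<union> same_length F RW {\<alpha>1} \<union> same_length F RW {\<beta>l}" (is ?union)
    and "same_length F RW {\<alpha>l} = {\<alpha> + u + v + w | \<alpha> u v w. \<alpha> \<in> short_roots F0 R \<and>
      u \<in> combs \<delta>1 b (coset_family False True b 1) \<and>
      v \<in> combs \<delta>2 s (coset_family True True s 2) \<and>
      w \<in> combs \<delta>3 t (coset_family False True t 1)}" (is ?short)
    and "same_length F RW {\<alpha>1} = {\<alpha> + u + v + w | \<alpha> u v w. \<alpha> \<in> long_roots F0 R \<and>
      u \<in> combs \<delta>1 b (coset_family True True b N) \<and>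
      v \<in> combs \<delta>2 s (coset_family False True s 2) \<and>
      w \<in> combs \<delta>3 t (coset_family False True t 1)}" (is ?long)
    and "same_length F RW {\<beta>l} = {2 *\<^sub>q \<alpha> + u + v + w | \<alpha> u v w. \<alpha> \<in> short_roots F0 R \<and>
      u \<in> combs \<delta>1 b (coset_family False False b 2) \<and>
      v \<in> combs \<delta>2 s (coset_family False False s 4) \<and>
      w \<in> combs \<delta>3 t (coset_family True False t 2)}" (is ?double)
proof -
  have l: "2 \<le> l" using valid by (simp add: X)
  note two = two_lengths_B[OF X]
  note ne = two_lengths_ends[OF two]
  define D where "D e j = (if e = \<alpha>1 then long_grading 2 {l} j else if e = \<alpha>l then 1 else 2)" for e j
  define M where "M e f = (if e = \<alpha>1 then if f = \<alpha>1 then N else if f = \<alpha>l then 2 else 1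
    else if e = \<alpha>l then if f = \<alpha>l then 2 else 1
    else if f = \<alpha>l then 4 else 2)" for e f :: vec
  define E where "E = {\<alpha>1, \<alpha>l, \<beta>l}"
  have D: "D \<alpha>1 = long_grading 2 {l}" "D \<alpha>l = (\<lambda>_. 1)" "D \<beta>l = (\<lambda>_. 2)"
    using l by (auto simp: D_def)
  have M: "M \<alpha>1 \<alpha>1 = N" "M \<alpha>1 \<alpha>l = 2" "M \<alpha>1 \<beta>l = 1" "M \<alpha>l \<alpha>1 = 1" "M \<alpha>l \<alpha>l = 2" "M \<alpha>l \<beta>l = 1"
    "M \<beta>l \<alpha>1 = 2" "M \<beta>l \<alpha>l = 4" "M \<beta>l \<beta>l = 2"
    using ne ne[symmetric] by (simp_all only: M_def double_basis_vec_neq if_True if_False simp_thms)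
  have E_cases: "e = \<alpha>1 \<or> e = \<alpha>l \<or> e = \<beta>l" if "e \<in> E" for e using that by (simp add: E_def)
  have diag: "C i i = 2" if "i \<in> {1..l}" for i
    unfolding cartan_entry[OF that that] by (simp add: cartan_matrix_def)
  have even: "2 dvd C l j" if j: "j \<in> {1..l}" for j
    unfolding cartan_entry[OF ends(2) j]
    using j by (auto simp: cartan_matrix_def X min_def max_def)
  have even': "2 dvd C l j * z" "4 dvd C l j * 2" if j: "j \<in> {1..l}" for j z
    using even[OF j] by (auto elim!: dvdE)
  have N_dvd: "N dvd C 1 j * long_grading 2 {l} j" if j: "j \<in> {1..l}" for j
  proof (cases "l = 2 \<and> j \<noteq> l")
    case True
    then have "j = 1" using j by auto
    then show ?thesis using diag[OF ends(1)] True by (simp add: N_def)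
  next
    case False
    then show ?thesis by (auto simp: N_def long_grading_def[OF two])
  qed
  have m: "l - 1 \<in> {1..l}" "l - 1 \<notin> {l}" using l by auto
  have m_orbit: "basis_vec (l - 1) \<in> orbit F0 l \<alpha>1"
    using two_lengths_orbit(2)[OF two m] .
  have bond: "C l (l - 1) = - 2" "C (l - 1) l = - 1"
    unfolding cartan_entry[OF ends(2) m(1)] cartan_entry[OF m(1) ends(2)]
    using l by (auto simp: cartan_matrix_def X min_def max_def)
  have steps: "\<exists>x\<in>orbit F0 l e. \<exists>\<beta>\<in>orbit F0 l f.
      coroot_pairing \<beta> x \<in> {rat_of_int (M e f), - rat_of_int (M e f)}"
    if "e \<in> E" "f \<in> E" for e f
  proof -
    have witness: ?thesis if "x \<in> orbit F0 l e" "\<beta> \<in> orbit F0 l f"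
      "coroot_pairing \<beta> x = rat_of_int (M e f) \<or> coroot_pairing \<beta> x = - rat_of_int (M e f)" for x \<beta>
      using that by blast
    note pairings = coroot_pairing_scale_left coroot_pairing_scale_right
      coroot_pairing_basis[OF ends(2) ends(2)] coroot_pairing_basis[OF ends(2) m(1)]
      coroot_pairing_basis[OF m(1) ends(2)] bond diag[OF ends(2)]
    from E_cases[OF that(1)] E_cases[OF that(2)] show ?thesis
    proof (elim disjE)
      assume ef: "e = \<alpha>1" "f = \<alpha>1"
      show ?thesis
      proof (cases "l = 2")
        case True
        then show ?thesis unfolding ef M
          by (intro steps_simple[OF ends(1) ends(1) orbit_start orbit_start])
            (simp only: N_def if_True diag[OF ends(1)] simp_thms)
      next
        case False
        then have i: "2 \<in> {1..l}" "2 \<notin> {l}" using l by auto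
        have "C 2 1 = - 1" unfolding cartan_entry[OF i(1) ends(1)]
          using False by (simp add: cartan_matrix_def X)
        then show ?thesis unfolding ef M using False
          by (intro steps_simple[OF i(1) ends(1) two_lengths_orbit(2)[OF two i] orbit_start])
            (simp add: N_def del: One_nat_def)
      qed
    next
      assume ef: "e = \<alpha>1" "f = \<alpha>l"
      show ?thesis unfolding ef M by (rule two_lengths_steps(1)[OF two])
    next
      assume ef: "e = \<alpha>1" "f = \<beta>l"
      show ?thesis
        by (rule witness[of "basis_vec (l - 1)" \<beta>l])
          (simp_all only: ef M m_orbit orbit_start pairings, simp_all)
    next
      assume ef: "e = \<alpha>l" "f = \<alpha>1"
      show ?thesis unfolding ef M by (rule two_lengths_steps(2)[OF two])
    next
      assume ef: "e = \<alpha>l" "f = \<alpha>l"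
      show ?thesis by (rule witness[of \<alpha>l \<alpha>l]) (simp_all only: ef M orbit_start pairings simp_thms)
    next
      assume ef: "e = \<alpha>l" "f = \<beta>l"
      show ?thesis by (rule witness[of \<alpha>l \<beta>l]) (simp_all only: ef M orbit_start pairings, simp_all)
    next
      assume ef: "e = \<beta>l" "f = \<alpha>1"
      show ?thesis by (rule witness[of \<beta>l "basis_vec (l - 1)"])
          (simp_all only: ef M m_orbit orbit_start pairings, simp_all)
    next
      assume ef: "e = \<beta>l" "f = \<alpha>l"
      show ?thesis by (rule witness[of \<beta>l \<alpha>l]) (simp_all only: ef M orbit_start pairings, simp_all)
    next
      assume ef: "e = \<beta>l" "f = \<beta>l"
      show ?thesis by (rule witness[of \<beta>l \<beta>l]) (simp_all only: ef M orbit_start pairings, simp_all)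
    qed
  qed
  have RW: "RW = (\<Union>e\<in>E. layer e (\<lambda>k. M e (r k)))"
  proof (rule layers_graded[where D = D])
    show "E \<subseteq> {\<alpha>1, \<alpha>l, \<beta>l}" by (simp add: E_def)
    show "\<exists>e\<in>E \<inter> simple_roots l. basis_vec i \<in> orbit F0 l e" if "i \<in> {1..l}" for i
      using two_lengths_orbit[OF two that] ends_simple unfolding E_def by blast
    show "r k \<in> E" if "k \<in> K" for k using added_root[OF that] by (simp only: E_def)
    show "graded (D e) e" if "e \<in> E" for e
      using E_cases[OF that] long_graded[OF two]
        graded_basis_1[of "\<lambda>_. 1" l] graded_basis_2[of "\<lambda>_. 2" l] by (elim disjE) (simp_all only: D)
    show "D e i dvd C i j * D e j" if "e \<in> E" "i \<in> {1..l}" "j \<in> {1..l}" for e i j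
      using E_cases[OF that(1)] long_grading_stable[OF two that(2,3)]
      by (elim disjE) (simp_all only: D, simp_all)
    show "M e (basis_vec i) dvd C i j * D e j"
      if "e \<in> E" "basis_vec i \<in> E" "i \<in> {1..l}" "j \<in> {1..l}" for e i j
    proof -
      have "i = 1 \<or> i = l" using that(2) by (simp add: E_def)
      then show ?thesis
        using E_cases[OF that(1)] N_dvd[OF that(4)] even'[OF that(4)]
        by (elim disjE) (simp_all only: M D one_dvd dvd_triv_right)
    qed
    show "2 * M e \<beta>l dvd C l j * D e j" if "e \<in> E" "\<beta>l \<in> E" "j \<in> {1..l}" for e j
      using E_cases[OF that(1)] even[OF that(3)] even'(2)[OF that(3)]
      by (elim disjE) (simp_all only: M D, simp_all)
  qed (fact steps)
  have norm: "F0 \<beta>l \<beta>l = 4 * F0 \<alpha>l \<alpha>l" "F0 \<alpha>1 \<alpha>1 = 2 * F0 \<alpha>l \<alpha>l" "F0 \<alpha>l \<alpha>l > 0"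
    using two_lengths_norm[OF two] by (simp_all add: finite.bilinear)
  then have inj: "inj_on (\<lambda>e. F0 e e) E" by (auto simp: E_def inj_on_def)
  have E: "E \<subseteq> {\<alpha>1, \<alpha>l, \<beta>l}" "\<alpha>1 \<in> E" "\<alpha>l \<in> E" "\<beta>l \<in> E" by (simp_all add: E_def)
  have length: "same_length F RW {e} = layer e (\<lambda>k. M e (r k))" if "e \<in> E" for e
    by (rule layer_length[OF RW E(1) that inj]) (use that E(1) ends_coord in blast)+
  show ?union
    unfolding length[OF E(2)] length[OF E(3)] length[OF E(4)] by (subst RW) (auto simp: E_def)
  have own: "{k \<in> K. r k = \<alpha>1} = AL" "{k \<in> K. r k = \<alpha>l} = AS" "{k \<in> K. r k = \<beta>l} = AD"
    unfolding K_split using root ne by fastforce+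
  have short: "layer \<alpha>l (\<lambda>k. M \<alpha>l (r k)) = {x + u + v + w | x u v w. x \<in> orbit F0 l \<alpha>l \<and>
      u \<in> combs \<delta>1 b (coset_family False True b 1) \<and>
      v \<in> combs \<delta>2 s (coset_family True True s 2) \<and>
      w \<in> combs \<delta>3 t (coset_family False True t 1)}"
    by (rule layer_eq) (simp_all only: own root M ends_simple if_True if_False simp_thms)
  show ?short unfolding length[OF E(3)] short two_lengths_short[OF two] by (rule refl)
  have long: "layer \<alpha>1 (\<lambda>k. M \<alpha>1 (r k)) = {x + u + v + w | x u v w. x \<in> orbit F0 l \<alpha>1 \<and>
      u \<in> combs \<delta>1 b (coset_family True True b N) \<and>
      v \<in> combs \<delta>2 s (coset_family False True s 2) \<and>
      w \<in> combs \<delta>3 t (coset_family False True t 1)}"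
    by (rule layer_eq) (simp_all only: own root M ends_simple if_True if_False simp_thms)
  show ?long unfolding length[OF E(2)] long two_lengths_long[OF two] by (rule refl)
  have double: "layer \<beta>l (\<lambda>k. M \<beta>l (r k)) = {x + u + v + w | x u v w. x \<in> orbit F0 l \<beta>l \<and>
      u \<in> combs \<delta>1 b (coset_family False False b 2) \<and>
      v \<in> combs \<delta>2 s (coset_family False False s 4) \<and>
      w \<in> combs \<delta>3 t (coset_family True False t 2)}"
    by (rule layer_eq) (simp_all only: own root M ends_simple if_True if_False simp_thms)
  show ?double
    unfolding length[OF E(4)] double orbit_double two_lengths_short[OF two] by blast
qed

text \<open>
Here \<open>\<alpha>\<^sub>l = \<alpha>\<^sub>1\<close>, and the only pairings are those among \<open>\<plusminus>\<alpha>\<^sub>1\<close> and \<open>\<plusminus>2\<alpha>\<^sub>1\<close>.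
\<close>

lemma weyl_roots_A1:
  assumes X: "X = TypeA" and l: "l = 1" and s: "s = 0"
  shows "RW = same_length F RW {\<alpha>1} \<union> same_length F RW {2 *\<^sub>q \<alpha>1}" (is ?union)
    and "same_length F RW {\<alpha>1} = {\<alpha> + u + w | \<alpha> u w. \<alpha> \<in> {\<alpha>1, - \<alpha>1} \<and>
      u \<in> combs \<delta>1 b (coset_family True True b 2) \<and>
      w \<in> combs \<delta>3 t (coset_family False True t 1)}" (is ?short)
    and "same_length F RW {2 *\<^sub>q \<alpha>1} = {2 *\<^sub>q \<alpha> + u + w | \<alpha> u w. \<alpha> \<in> {\<alpha>1, - \<alpha>1} \<and>
      u \<in> combs \<delta>1 b (coset_family False False b 4) \<and>
      w \<in> combs \<delta>3 t (coset_family True False t 2)}" (is ?double)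
proof -
  define \<beta>1 where "\<beta>1 = 2 *\<^sub>q \<alpha>1"
  have \<beta>l: "\<beta>l = \<beta>1" by (simp only: l \<beta>1_def)
  have \<alpha>l: "\<alpha>l = \<alpha>1" by (simp only: l)
  have ne: "\<beta>1 \<noteq> \<alpha>1" "\<alpha>1 \<noteq> \<beta>1" unfolding \<beta>1_def by (fact double_basis_vec_neq)+
  have AS: "AS = {}" using empty_short[OF s] .
  define D where "D e = (\<lambda>_ :: nat. if e = \<alpha>1 then 1 else 2 :: int)" for e
  define M where "M e f = (if e = \<alpha>1 then if f = \<alpha>1 then 2 else 1 else if f = \<alpha>1 then 4 else 2 :: int)"
    for e f :: vec
  define E where "E = {\<alpha>1, \<beta>1}"
  have D: "D \<alpha>1 = (\<lambda>_. 1)" "D \<beta>1 = (\<lambda>_. 2)"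
    using ne by (simp_all only: D_def if_True if_False simp_thms)
  have M: "M \<alpha>1 \<alpha>1 = 2" "M \<alpha>1 \<beta>1 = 1" "M \<beta>1 \<alpha>1 = 4" "M \<beta>1 \<beta>1 = 2"
    using ne by (simp_all only: M_def if_True if_False simp_thms)
  have E_cases: "e = \<alpha>1 \<or> e = \<beta>1" if "e \<in> E" for e using that by (simp add: E_def)
  have diag: "C 1 1 = 2" unfolding cartan_entry[OF ends(1) ends(1)] by (simp add: cartan_matrix_def)
  have one: "i = 1" if "i \<in> {1..l}" for i using that l by simp
  have steps: "\<exists>x\<in>orbit F0 l e. \<exists>\<beta>\<in>orbit F0 l f.
      coroot_pairing \<beta> x \<in> {rat_of_int (M e f), - rat_of_int (M e f)}"
    if "e \<in> E" "f \<in> E" for e f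
  proof (intro bexI)
    have basis: "coroot_pairing \<alpha>1 \<alpha>1 = 2"
      unfolding coroot_pairing_basis[OF ends(1) ends(1)] diag by simp
    note pairings = \<beta>1_def basis coroot_pairing_scale_left coroot_pairing_scale_right
    from E_cases[OF that(1)] E_cases[OF that(2)] have "coroot_pairing f e = rat_of_int (M e f)"
    proof (elim disjE)
      assume ef: "e = \<alpha>1" "f = \<alpha>1"
      show ?thesis unfolding ef M unfolding pairings by simp
    next
      assume ef: "e = \<alpha>1" "f = \<beta>1"
      show ?thesis unfolding ef M unfolding pairings by simp
    next
      assume ef: "e = \<beta>1" "f = \<alpha>1"
      show ?thesis unfolding ef M unfolding pairings by simp
    next
      assume ef: "e = \<beta>1" "f = \<beta>1"
      show ?thesis unfolding ef M unfolding pairings by simp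
    qed
    then show "coroot_pairing f e \<in> {rat_of_int (M e f), - rat_of_int (M e f)}" by blast
  qed (rule orbit_start)+
  have E: "E \<subseteq> {\<alpha>1, \<alpha>l, \<beta>l}" "\<alpha>1 \<in> E" "\<beta>1 \<in> E" unfolding \<beta>l by (simp_all add: E_def)
  have RW: "RW = (\<Union>e\<in>E. layer e (\<lambda>k. M e (r k)))"
  proof (rule layers_graded[where D = D])
    show "E \<subseteq> {\<alpha>1, \<alpha>l, \<beta>l}" by (rule E)
    show "\<exists>e\<in>E \<inter> simple_roots l. basis_vec i \<in> orbit F0 l e" if "i \<in> {1..l}" for i
      unfolding one[OF that] using E(2) ends_simple(1) orbit_start by blast
    show "r k \<in> E" if "k \<in> K" for k
      using added_root[OF that] by (simp add: E_def \<beta>1_def l)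
    show "graded (D e) e" if "e \<in> E" for e
      using E_cases[OF that] graded_basis_1[of "\<lambda>_. 1" 1] graded_basis_2[of "\<lambda>_. 2" 1]
      by (elim disjE) (simp_all only: D \<beta>1_def[symmetric])
    show "D e i dvd C i j * D e j" if "e \<in> E" "i \<in> {1..l}" "j \<in> {1..l}" for e i j
      by (simp add: D_def)
    show "M e (basis_vec i) dvd C i j * D e j"
      if "e \<in> E" "basis_vec i \<in> E" "i \<in> {1..l}" "j \<in> {1..l}" for e i j
      unfolding one[OF that(3)] one[OF that(4)] diag
      using E_cases[OF that(1)] by (elim disjE) (simp_all only: M D, simp_all)
    show "2 * M e \<beta>l dvd C l j * D e j" if "e \<in> E" "\<beta>l \<in> E" "j \<in> {1..l}" for e j
      unfolding one[OF that(3)] one[OF ends(2)] diag \<beta>1_def[symmetric]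
      using E_cases[OF that(1)] by (elim disjE) (simp_all only: M D, simp_all)
  qed (fact steps)
  have "F0 \<beta>1 \<beta>1 = 4 * F0 \<alpha>1 \<alpha>1" "F0 \<alpha>1 \<alpha>1 > 0"
    using gram_positive[OF ends(1)] gram_form_basis[OF ends(1) ends(1)]
    by (simp_all add: \<beta>1_def finite.bilinear)
  then have inj: "inj_on (\<lambda>e. F0 e e) E" by (auto simp: E_def inj_on_def)
  have length: "same_length F RW {e} = layer e (\<lambda>k. M e (r k))" if "e \<in> E" for e
    by (rule layer_length[OF RW E(1) that inj]) (use that E(1) ends_coord in blast)+
  show ?union
    unfolding \<beta>1_def[symmetric] length[OF E(2)] length[OF E(3)] by (subst RW) (auto simp: E_def)
  have orbit: "orbit F0 l \<alpha>1 = {\<alpha>1, - \<alpha>1}"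
  proof
    have neg: "reflection F0 \<alpha>1 \<alpha>1 = - \<alpha>1"
      by (rule finite.reflection_self[OF finite.anisotropic[OF ends(1)]])
    then have neg': "reflection F0 \<alpha>1 (- \<alpha>1) = \<alpha>1"
      using finite.reflection_involution[OF finite.anisotropic[OF ends(1)], of \<alpha>1] by simp
    show "orbit F0 l \<alpha>1 \<subseteq> {\<alpha>1, - \<alpha>1}"
    proof
      fix x assume "x \<in> orbit F0 l \<alpha>1"
      then show "x \<in> {\<alpha>1, - \<alpha>1}"
      proof (induction rule: orbit.induct)
        case (orbit_step x k)
        then show ?case unfolding one[OF orbit_step(2)] using neg neg' by fastforce
      qed simp
    qed
    show "{\<alpha>1, - \<alpha>1} \<subseteq> orbit F0 l \<alpha>1"
      using orbit_start orbit_step[OF orbit_start ends(1), of F0 \<alpha>1] neg by simp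
  qed
  have own: "{k \<in> K. r k = \<alpha>1} = AL" "{k \<in> K. r k = \<beta>1} = AD"
    unfolding K_split AS using root(1,3) ne unfolding \<beta>l by fastforce+
  have AS_any: "P k" if "k \<in> AS" for k P using that AS by blast
  have zero: "combs \<delta>2 s (coset_family False z s 1) = {0}" for z
    by (simp add: combs_def int_comb_def s coset_family_def)
  have short: "layer \<alpha>1 (\<lambda>k. M \<alpha>1 (r k)) = {x + u + v + w | x u v w. x \<in> orbit F0 l \<alpha>1 \<and>
      u \<in> combs \<delta>1 b (coset_family True True b 2) \<and>
      v \<in> combs \<delta>2 s (coset_family False True s 1) \<and>
      w \<in> combs \<delta>3 t (coset_family False True t 1)}"
    by (rule layer_eq, simp_all only: own root(1,3) \<beta>l M ends_simple if_True if_False simp_thms)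
      (rule AS_any)
  show ?short unfolding length[OF E(2)] short orbit zero by (simp only: singleton_iff) auto
  have simple: "\<beta>1 \<notin> simple_roots l" using ends_simple(3) unfolding \<beta>l .
  have double: "layer \<beta>1 (\<lambda>k. M \<beta>1 (r k)) = {x + u + v + w | x u v w. x \<in> orbit F0 l \<beta>1 \<and>
      u \<in> combs \<delta>1 b (coset_family False False b 4) \<and>
      v \<in> combs \<delta>2 s (coset_family False False s 1) \<and>
      w \<in> combs \<delta>3 t (coset_family True False t 2)}"
    by (rule layer_eq, simp_all only: own root(1,3) \<beta>l M simple if_True if_False simp_thms)
      (rule AS_any)
  have orbit': "orbit F0 l \<beta>1 = (*\<^sub>q) 2 ` {\<alpha>1, - \<alpha>1}"
    unfolding \<beta>1_def orbit_double orbit by (rule refl)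
  show ?double unfolding \<beta>1_def[symmetric] length[OF E(3)] double orbit' zero
    by (rule sums_with_zero)
qed

end

theorem theorem4p1:
  fixes X :: cartan_letter
    and l d b s t :: nat
    and C A :: "nat \<Rightarrow> nat \<Rightarrow> int"
    and G :: "nat \<Rightarrow> nat \<Rightarrow> rat"
    and r :: "nat \<Rightarrow> vec"
    and long_idx short_idx double_idx :: "nat \<Rightarrow> nat"
  defines "F0 \<equiv> gram_form l G"
    and "F \<equiv> affine_form l d G r"
  defines "R \<equiv> weyl_roots F0 l"
    and "RW \<equiv> weyl_roots F (l + d)"
  defines "Rs \<equiv> short_roots F0 R"
    and "Rl \<equiv> long_roots F0 R"
    and "\<alpha>1 \<equiv> basis_vec 1"
    and "\<alpha>l \<equiv> basis_vec l"
  defines "\<delta>1 \<equiv> (\<lambda>j. basis_vec (long_idx j) - \<alpha>1)"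
    and "\<delta>l \<equiv> (\<lambda>j. basis_vec (short_idx j) - \<alpha>l)"
    and "\<delta>l' \<equiv> (\<lambda>j. basis_vec (double_idx j) - 2 *\<^sub>q \<alpha>l)"
  assumes cartan: "is_cartan_matrix X l C"
    and form: "induced_gram l C G"
    and affinization: "standard_affinization l d G r A"
    and type: "affinization_type l d G r = (b, s, t)"
    and long: "\<forall>k\<in>added_long l d G r. r k = \<alpha>1"
    and short: "\<forall>k\<in>added_short l d G r. r k = \<alpha>l"
    and double: "\<forall>k\<in>added_double l d r. r k = 2 *\<^sub>q \<alpha>l"
    and long_idx: "bij_betw long_idx {1..b} (added_long l d G r)"
    and short_idx: "bij_betw short_idx {1..s} (added_short l d G r)"
    and double_idx: "bij_betw double_idx {1..t} (added_double l d r)"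
  shows
    "(((X = TypeA \<and> l \<ge> 2) \<or> X = TypeD \<or> X = TypeE) \<and> (b, s, t) = (d, 0, 0) \<longrightarrow>
        RW = R + radical F (l + d)) \<and>
     (X \<in> {TypeC, TypeF, TypeG} \<and> t = 0 \<longrightarrow>
        RW = same_length F RW Rs \<union> same_length F RW Rl \<and>
        same_length F RW Rs = Rs + radical F (l + d) \<and>
        (X = TypeC \<longrightarrow> same_length F RW Rl =
           {\<alpha> + int_comb b a \<delta>1 + 2 *\<^sub>q int_comb s b' \<delta>l | \<alpha> a b'.
              \<alpha> \<in> Rl \<and> at_most_one_odd b a}) \<and>
        (X = TypeF \<longrightarrow> same_length F RW Rl =
           {\<alpha> + int_comb b a \<delta>1 + 2 *\<^sub>q int_comb s b' \<delta>l | \<alpha> a b'. \<alpha> \<in> Rl}) \<and>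
        (X = TypeG \<longrightarrow> same_length F RW Rl =
           {\<alpha> + int_comb b a \<delta>1 + 3 *\<^sub>q int_comb s b' \<delta>l | \<alpha> a b'. \<alpha> \<in> Rl})) \<and>
     (X = TypeA \<and> l = 1 \<and> s = 0 \<longrightarrow>
        RW = same_length F RW {\<alpha>1} \<union> same_length F RW {2 *\<^sub>q \<alpha>1} \<and>
        same_length F RW {\<alpha>1} =
           {\<alpha> + int_comb b a \<delta>1 + int_comb t b' \<delta>l' | \<alpha> a b'.
              \<alpha> \<in> {\<alpha>1, - \<alpha>1} \<and> at_most_one_odd b a} \<and>
        same_length F RW {2 *\<^sub>q \<alpha>1} =
           {2 *\<^sub>q \<alpha> + 4 *\<^sub>q int_comb b a \<delta>1 + int_comb t b' \<delta>l' | \<alpha> a b'.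
              \<alpha> \<in> {\<alpha>1, - \<alpha>1} \<and> exactly_one_odd t b'}) \<and>
     (X = TypeB \<longrightarrow>
        RW = same_length F RW {\<alpha>l} \<union> same_length F RW {\<alpha>1} \<union> same_length F RW {2 *\<^sub>q \<alpha>l} \<and>
        same_length F RW {\<alpha>l} =
           {\<alpha> + int_comb b a \<delta>1 + int_comb s b' \<delta>l + int_comb t c \<delta>l' | \<alpha> a b' c.
              \<alpha> \<in> Rs \<and> at_most_one_odd s b'} \<and>
        same_length F RW {2 *\<^sub>q \<alpha>l} =
           {2 *\<^sub>q \<alpha> + 2 *\<^sub>q int_comb b a \<delta>1 + 4 *\<^sub>q int_comb s b' \<delta>l + int_comb t c \<delta>l' | \<alpha> a b' c.
              \<alpha> \<in> Rs \<and> exactly_one_odd t c} \<and>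
        (l = 2 \<longrightarrow> same_length F RW {\<alpha>1} =
           {\<alpha> + int_comb b a \<delta>1 + 2 *\<^sub>q int_comb s b' \<delta>l + int_comb t c \<delta>l' | \<alpha> a b' c.
              \<alpha> \<in> Rl \<and> at_most_one_odd b a}) \<and>
        (l > 2 \<longrightarrow> same_length F RW {\<alpha>1} =
           {\<alpha> + int_comb b a \<delta>1 + 2 *\<^sub>q int_comb s b' \<delta>l + int_comb t c \<delta>l' | \<alpha> a b' c.
              \<alpha> \<in> Rl}))"
proof -
  interpret labelled_affinization X l d b s t C A G r long_idx short_idx double_idx
    using cartan form affinization type long short double long_idx short_idx double_idx
    unfolding \<alpha>1_def \<alpha>l_def by (rule labelled_affinization.intro)
  note defs = F0_def F_def R_def RW_def Rs_def Rl_def \<alpha>1_def \<alpha>l_def \<delta>1_def \<delta>l_def \<delta>l'_def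
  have ADE: "RW = R + radical F (l + d)"
    if "(X = TypeA \<and> l \<ge> 2) \<or> X = TypeD \<or> X = TypeE" "(b, s, t) = (d, 0, 0)"
    unfolding defs by (rule weyl_roots_simply_laced[OF that])
  have union: "RW = same_length F RW Rs \<union> same_length F RW Rl"
    and radical: "same_length F RW Rs = Rs + radical F (l + d)"
    if "X \<in> {TypeC, TypeF, TypeG}" "t = 0"
    using that weyl_roots_C(1,2) weyl_roots_F(1,2) weyl_roots_G(1,2) unfolding defs by blast+
  have C: "same_length F RW Rl = {\<alpha> + int_comb b a \<delta>1 + 2 *\<^sub>q int_comb s b' \<delta>l | \<alpha> a b'.
      \<alpha> \<in> Rl \<and> at_most_one_odd b a}" if "X = TypeC" "t = 0"
    unfolding defs by (rule weyl_roots_C(3)[OF that])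
  have F: "same_length F RW Rl = {\<alpha> + int_comb b a \<delta>1 + 2 *\<^sub>q int_comb s b' \<delta>l | \<alpha> a b'. \<alpha> \<in> Rl}"
    if "X = TypeF" "t = 0"
    unfolding defs by (rule weyl_roots_F(3)[OF that])
  have G: "same_length F RW Rl = {\<alpha> + int_comb b a \<delta>1 + 3 *\<^sub>q int_comb s b' \<delta>l | \<alpha> a b'. \<alpha> \<in> Rl}"
    if "X = TypeG" "t = 0"
    unfolding defs by (rule weyl_roots_G(3)[OF that])
  note parity = coset_family_1 coset_family_2_at_most coset_family_2_exactly
  note multiples = coset_family_other combs_multiples of_int_numeral
  have A1: "RW = same_length F RW {\<alpha>1} \<union> same_length F RW {2 *\<^sub>q \<alpha>1}"
    "same_length F RW {\<alpha>1} = {\<alpha> + int_comb b a \<delta>1 + int_comb t b' \<delta>l' | \<alpha> a b'.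
      \<alpha> \<in> {\<alpha>1, - \<alpha>1} \<and> at_most_one_odd b a}"
    "same_length F RW {2 *\<^sub>q \<alpha>1} = {2 *\<^sub>q \<alpha> + 4 *\<^sub>q int_comb b a \<delta>1 + int_comb t b' \<delta>l' | \<alpha> a b'.
      \<alpha> \<in> {\<alpha>1, - \<alpha>1} \<and> exactly_one_odd t b'}"
    if X: "X = TypeA" "l = 1" "s = 0"
  proof -
    show "RW = same_length F RW {\<alpha>1} \<union> same_length F RW {2 *\<^sub>q \<alpha>1}"
      unfolding defs by (rule weyl_roots_A1(1)[OF X])
    show "same_length F RW {\<alpha>1} = {\<alpha> + int_comb b a \<delta>1 + int_comb t b' \<delta>l' | \<alpha> a b'.
        \<alpha> \<in> {\<alpha>1, - \<alpha>1} \<and> at_most_one_odd b a}"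
      unfolding defs weyl_roots_A1(2)[OF X] parity unfolding combs_def by blast
    show "same_length F RW {2 *\<^sub>q \<alpha>1} = {2 *\<^sub>q \<alpha> + 4 *\<^sub>q int_comb b a \<delta>1 + int_comb t b' \<delta>l' | \<alpha> a b'.
        \<alpha> \<in> {\<alpha>1, - \<alpha>1} \<and> exactly_one_odd t b'}"
      unfolding defs weyl_roots_A1(3)[OF X] parity multiples unfolding combs_def by blast
  qed
  have B: "RW = same_length F RW {\<alpha>l} \<union> same_length F RW {\<alpha>1} \<union> same_length F RW {2 *\<^sub>q \<alpha>l}"
    "same_length F RW {\<alpha>l} =
      {\<alpha> + int_comb b a \<delta>1 + int_comb s b' \<delta>l + int_comb t c \<delta>l' | \<alpha> a b' c.
        \<alpha> \<in> Rs \<and> at_most_one_odd s b'}"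
    "same_length F RW {2 *\<^sub>q \<alpha>l} =
      {2 *\<^sub>q \<alpha> + 2 *\<^sub>q int_comb b a \<delta>1 + 4 *\<^sub>q int_comb s b' \<delta>l + int_comb t c \<delta>l' | \<alpha> a b' c.
        \<alpha> \<in> Rs \<and> exactly_one_odd t c}"
    if X: "X = TypeB"
  proof -
    show "RW = same_length F RW {\<alpha>l} \<union> same_length F RW {\<alpha>1} \<union> same_length F RW {2 *\<^sub>q \<alpha>l}"
      unfolding defs by (rule weyl_roots_B(1)[OF X])
    show "same_length F RW {\<alpha>l} =
        {\<alpha> + int_comb b a \<delta>1 + int_comb s b' \<delta>l + int_comb t c \<delta>l' | \<alpha> a b' c.
          \<alpha> \<in> Rs \<and> at_most_one_odd s b'}"
      unfolding defs weyl_roots_B(2)[OF X] parity unfolding combs_def by blast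
    show "same_length F RW {2 *\<^sub>q \<alpha>l} =
        {2 *\<^sub>q \<alpha> + 2 *\<^sub>q int_comb b a \<delta>1 + 4 *\<^sub>q int_comb s b' \<delta>l + int_comb t c \<delta>l' | \<alpha> a b' c.
          \<alpha> \<in> Rs \<and> exactly_one_odd t c}"
      unfolding defs weyl_roots_B(4)[OF X] parity multiples unfolding combs_def by blast
  qed
  have B2: "same_length F RW {\<alpha>1} =
      {\<alpha> + int_comb b a \<delta>1 + 2 *\<^sub>q int_comb s b' \<delta>l + int_comb t c \<delta>l' | \<alpha> a b' c.
        \<alpha> \<in> Rl \<and> at_most_one_odd b a}" if X: "X = TypeB" and l: "l = 2"
  proof -
    have N: "(if l = 2 then 2 else 1 :: int) = 2" using l by simp
    show ?thesis
      unfolding defs weyl_roots_B(3)[OF X] N parity multiples unfolding combs_def by blast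
  qed
  have B3: "same_length F RW {\<alpha>1} =
      {\<alpha> + int_comb b a \<delta>1 + 2 *\<^sub>q int_comb s b' \<delta>l + int_comb t c \<delta>l' | \<alpha> a b' c. \<alpha> \<in> Rl}"
    if X: "X = TypeB" and l: "l > 2"
  proof -
    have N: "(if l = 2 then 2 else 1 :: int) = 1" using l by simp
    show ?thesis
      unfolding defs weyl_roots_B(3)[OF X] N parity multiples unfolding combs_def by blast
  qed
  show ?thesis
    by (intro conjI impI; (elim conjE)?)
      (rule ADE union radical C F G A1 B B2 B3; simp)+
qed

end
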